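(* Let $D$ be any connected link diagram, and let $G$ be its signed Tait graph with any order on its edges. There exists a partial skein resolution tree $\mathcal{T}$ of $D$ whose leaves are twisted unknots that correspond to the spanning trees of $G$ (bijectively, a spanning tree $T$ corresponding to the partial smoothing $U(T)$ of $D$). If the leaf $U$ corresponds to the spanning tree $T$, then $$\mu(T)=A^{\sigma(U)}(-A)^{3w(U)}\in\mathbb{Z}[A^{\pm1}],$$ where $w(U)$ is the writhe of $U$ and $\sigma(U)$ is the number of $A$-smoothings minus the number of $B$-smoothings made in passing from $D$ to $U$.
   Context: **Tait graph.** $D$ is checkerboard colored; $G$ has one vertex per shaded region and one edge per crossing. An edge is positive if the $A$-smoothing of its crossing joins the shaded regions, and negative otherwise. **Activities.** Let $T$ be a spanning tree of $G$. For $e\in T$, $cut(T,e)$ is the set of edges of $G$ connecting the two components of $T\setminus e$ (including $e$); for $f\notin T$, $cyc(T,f)$ is the set of edges of the unique cycle in $T\cup f$. An edge $e\in T$ is internally active (live) if it is the lowest edge of $cut(T,e)$, else internally inactive (dead); an edge $e\notin T$ is externally active (live) if it is the lowest edge of $cyc(T,e)$, else externally inactive (dead). Write $L,D,\ell,d$ for a positive edge that is respectively internally active, internally inactive, externally active, externally inactive, and $\bar L,\bar D,\bar\ell,\bar d$ for the same activities of a negative edge. **Weights.** Each edge $e$ gets a monomial $\mu_e$ according to its activity with respect to $T$: $L\mapsto -A^{-3}$, $D\mapsto A$, $\ell\mapsto -A^{3}$, $d\mapsto A^{-1}$, $\bar L\mapsto -A^{3}$, $\bar D\mapsto A^{-1}$,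 $\bar\ell\mapsto -A^{-3}$, $\bar d\mapsto A$; and $\mu(T)=\prod_{e\in G}\mu_e$. **The partial smoothing $U(T)$.** It is obtained from $D$ by smoothing the crossings of all dead edges and leaving the crossings of live edges unchanged, where the crossing of an edge with activity $D$ or $\bar d$ gets the $A$-smoothing, and that of an edge with activity $d$ or $\bar D$ gets the $B$-smoothing. **Twisted unknot.** A diagram obtained from the round unknot using only Reidemeister I moves. (Its writhe is independent of orientation; the sign convention is the one for which the $A$-smoothing of a positive kink splits off a loop.) **Partial skein resolution tree.** A rooted binary tree whose nodes are partial smoothings of $D$, whose root is $D$, and in which the two children of each non-leaf node are obtained from it by the $A$-smoothing and the $B$-smoothing, respectively, of one of its crossings. *)

theory Defs
  imports Main "HOL-Combinatorics.Orbits" "HOL-Library.Poly_Mapping"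
begin

section \<open>Link diagrams as planar combinatorial maps\<close>

text \<open>
  A diagram is drawn on an oriented sphere as a graph whose vertices are its crossings (of valency 4)
  and, so that components without crossings can be represented, auxiliary points on the
  strands (of valency 2). A dart is an end of an edge at a vertex. The permutation \<open>arc\<close> exchanges the
  two darts of each edge; \<open>rot\<close> sends a dart to the next one counterclockwise around its vertex;
  \<open>over\<close> is the set of darts that belong to the upper strand of a crossing.
\<close>

record 'd diagram =
  darts :: "'d set"
  arc :: "'d \<Rightarrow> 'd"
  rot :: "'d \<Rightarrow> 'd"
  over :: "'d set"

definition vertices :: "'d diagram \<Rightarrow> 'd set set" where
  "vertices D = orbit (rot D) ` darts D"

definition crossings :: "'d diagram \<Rightarrow> 'd set set" where
  "crossings D = {v \<in> vertices D. card v = 4}"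

definition arcs :: "'d diagram \<Rightarrow> 'd set set" where
  "arcs D = orbit (arc D) ` darts D"

text \<open>
  The face of a dart is the region on its left when one leaves the vertex of the dart along it,
  i.e. the region that contains the corner between \<open>d\<close> and \<open>rot D d\<close>.
\<close>

definition face :: "'d diagram \<Rightarrow> 'd \<Rightarrow> 'd set" where
  "face D d = orbit (inv (rot D) \<circ> arc D) d"

definition faces :: "'d diagram \<Rightarrow> 'd set set" where
  "faces D = face D ` darts D"

definition dart_step :: "'d diagram \<Rightarrow> 'd \<Rightarrow> 'd \<Rightarrow> bool" where
  "dart_step D x y \<longleftrightarrow> x \<in> darts D \<and> (y = arc D x \<or> y = rot D x)"

text \<open>Connected components of the underlying plane graph, not of the link.\<close>

definition pieces :: "'d diagram \<Rightarrow> 'd set set" where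
  "pieces D = (\<lambda>x. {y. equivclp (dart_step D) x y}) ` darts D"

definition wf_diagram :: "'d diagram \<Rightarrow> bool" where
  "wf_diagram D \<longleftrightarrow>
     finite (darts D) \<and>
     arc D permutes darts D \<and> (\<forall>d\<in>darts D. arc D d \<noteq> d \<and> arc D (arc D d) = d) \<and>
     rot D permutes darts D \<and> (\<forall>v\<in>vertices D. card v = 2 \<or> card v = 4) \<and>
     over D \<subseteq> \<Union>(crossings D) \<and>
     (\<forall>d\<in>\<Union>(crossings D). rot D d \<in> over D \<longleftrightarrow> d \<notin> over D)"

text \<open>Every piece has Euler characteristic at most 2; the equation says that all are spherical.\<close>

definition planar :: "'d diagram \<Rightarrow> bool" where
  "planar D \<longleftrightarrow>
     int (card (vertices D)) - int (card (arcs D)) + int (card (faces D)) = 2 * int (card (pieces D))"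

definition link_diagram :: "'d diagram \<Rightarrow> bool" where
  "link_diagram D \<longleftrightarrow> wf_diagram D \<and> planar D"

definition connected_diagram :: "'d diagram \<Rightarrow> bool" where
  "connected_diagram D \<longleftrightarrow> card (pieces D) = 1"


section \<open>Reidemeister I moves and twisted unknots\<close>

definition round_unknot :: "'d diagram \<Rightarrow> bool" where
  "round_unknot D \<longleftrightarrow> (\<exists>a b. a \<noteq> b \<and>
     D = \<lparr>darts = {a, b}, arc = id(a := b, b := a), rot = id(a := b, b := a), over = {}\<rparr>)"

text \<open>A planar isotopy of the picture: a 2-valent point is added on an edge.\<close>

inductive subdivide :: "'d diagram \<Rightarrow> 'd diagram \<Rightarrow> bool" where
  "\<lbrakk>wf_diagram D; x \<in> darts D; y = arc D x; distinct [p, q]; {p, q} \<inter> darts D = {}\<rbrakk> \<Longrightarrow>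
   subdivide D
     \<lparr>darts = darts D \<union> {p, q},
      arc = (arc D)(x := p, p := x, y := q, q := y),
      rot = (rot D)(p := q, q := p),
      over = over D\<rparr>"

text \<open>
  The edge with darts \<open>x\<close>, \<open>y\<close> receives a kink, whose crossing has the darts \<open>p\<close>, \<open>q\<close>, \<open>r\<close>, \<open>s\<close> in
  counterclockwise order and whose loop joins \<open>r\<close> and \<open>s\<close>. The kink on the other side of the edge
  is obtained by exchanging \<open>x\<close> and \<open>y\<close>, and \<open>u\<close> chooses the upper strand, so that all four
  versions of the move are covered.
\<close>

inductive add_kink :: "'d diagram \<Rightarrow> 'd diagram \<Rightarrow> bool" where
  "\<lbrakk>wf_diagram D; x \<in> darts D; y = arc D x; distinct [p, q, r, s]; {p, q, r, s} \<inter> darts D = {};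
    u = {p, r} \<or> u = {q, s}\<rbrakk> \<Longrightarrow>
   add_kink D
     \<lparr>darts = darts D \<union> {p, q, r, s},
      arc = (arc D)(x := p, p := x, y := q, q := y, r := s, s := r),
      rot = (rot D)(p := q, q := r, r := s, s := p),
      over = over D \<union> u\<rparr>"

text \<open>
  Both the moves that add and those that remove a kink are allowed. Darts are natural numbers here,
  because every diagram on the way needs fresh darts for the next one. There is no separate
  renaming of darts, as they can be chosen freely in the round unknot and in each move.
\<close>

definition twisted_unknot :: "nat diagram \<Rightarrow> bool" where
  "twisted_unknot D \<longleftrightarrow>
     (\<exists>D\<^sub>0. round_unknot D\<^sub>0 \<and> equivclp (\<lambda>E F. subdivide E F \<or> add_kink E F) D\<^sub>0 D)"


section \<open>Writhe\<close>

text \<open>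
  An orientation is given by the darts along which the oriented strands leave their vertices.
  Strands go straight through crossings.
\<close>

definition opposite :: "'d diagram \<Rightarrow> 'd \<Rightarrow> 'd" where
  "opposite D d = (if card (orbit (rot D) d) = 4 then rot D (rot D d) else rot D d)"

definition orientation :: "'d diagram \<Rightarrow> 'd set \<Rightarrow> bool" where
  "orientation D R \<longleftrightarrow> R \<subseteq> darts D \<and>
     (\<forall>d\<in>darts D. (arc D d \<in> R \<longleftrightarrow> d \<notin> R) \<and> (opposite D d \<in> R \<longleftrightarrow> d \<notin> R))"

text \<open>
  A crossing is positive if the outgoing dart of its lower strand is the counterclockwise
  successor of the outgoing dart of its upper strand.
\<close>

definition crossing_sign :: "'d diagram \<Rightarrow> 'd set \<Rightarrow> 'd set \<Rightarrow> int" where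
  "crossing_sign D R c = (if \<forall>d \<in> c \<inter> over D \<inter> R. rot D d \<in> R then 1 else -1)"

text \<open>Well-defined for knot diagrams only, where the sum is the same for both orientations.\<close>

definition writhe :: "'d diagram \<Rightarrow> int" where
  "writhe D = (THE w. \<exists>R. orientation D R \<and> w = (\<Sum>c\<in>crossings D. crossing_sign D R c))"


section \<open>Partial smoothings and skein resolution trees\<close>

datatype smoothing = A_smoothing | B_smoothing

type_synonym 'd state = "'d set \<Rightarrow> smoothing option"

text \<open>
  The A-smoothing opens the two regions swept out when the upper strand turns counterclockwise,
  i.e. those with the corners between \<open>d\<close> and \<open>rot D d\<close> for \<open>d \<in> over D\<close>. So it joins \<open>d\<close> to its
  clockwise neighbour, and the B-smoothing joins it to its counterclockwise neighbour. A
  smoothed crossing becomes two 2-valent points.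
\<close>

definition smooth :: "'d diagram \<Rightarrow> 'd state \<Rightarrow> 'd diagram" where
  "smooth D \<sigma> = D\<lparr>
     rot := (\<lambda>d. case \<sigma> (orbit (rot D) d) of
                  None \<Rightarrow> rot D d
                | Some A_smoothing \<Rightarrow> if d \<in> over D then inv (rot D) d else rot D d
                | Some B_smoothing \<Rightarrow> if d \<in> over D then rot D d else inv (rot D) d),
     over := over D - \<Union>(dom \<sigma>)\<rparr>"

definition smoothing_balance :: "'d state \<Rightarrow> int" where
  "smoothing_balance \<sigma> =
     int (card {c. \<sigma> c = Some A_smoothing}) - int (card {c. \<sigma> c = Some B_smoothing})"

text \<open>
  A node labelled \<open>\<sigma>\<close> stands for the partial smoothing \<open>smooth D \<sigma>\<close>; the first subtree belongs to
  the A-smoothing.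
\<close>

datatype 'd skein_tree =
    Leaf "'d state"
  | Node "'d state" "'d skein_tree" "'d skein_tree"

fun root_state :: "'d skein_tree \<Rightarrow> 'd state" where
  "root_state (Leaf \<sigma>) = \<sigma>"
| "root_state (Node \<sigma> t u) = \<sigma>"

fun leaf_states :: "'d skein_tree \<Rightarrow> 'd state list" where
  "leaf_states (Leaf \<sigma>) = [\<sigma>]"
| "leaf_states (Node \<sigma> t u) = leaf_states t @ leaf_states u"

fun resolves :: "'d diagram \<Rightarrow> 'd skein_tree \<Rightarrow> bool" where
  "resolves D (Leaf \<sigma>) \<longleftrightarrow> True"
| "resolves D (Node \<sigma> t u) \<longleftrightarrow>
     (\<exists>c\<in>crossings (smooth D \<sigma>).
        root_state t = \<sigma>(c \<mapsto> A_smoothing) \<and> root_state u = \<sigma>(c \<mapsto> B_smoothing)) \<and>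
     resolves D t \<and> resolves D u"

definition partial_skein_resolution_tree :: "'d diagram \<Rightarrow> 'd skein_tree \<Rightarrow> bool" where
  "partial_skein_resolution_tree D t \<longleftrightarrow> root_state t = Map.empty \<and> resolves D t"


section \<open>Signed graphs, spanning trees and activities\<close>

text \<open>\<open>ends G e\<close> is the set of end points of the edge \<open>e\<close>, a singleton if \<open>e\<close> is a loop.\<close>

record ('v, 'e) signed_graph =
  verts :: "'v set"
  edges :: "'e set"
  ends :: "'e \<Rightarrow> 'v set"
  positive :: "'e set"

definition joined :: "('v, 'e) signed_graph \<Rightarrow> 'e set \<Rightarrow> 'v \<Rightarrow> 'v \<Rightarrow> bool" where
  "joined G X = (\<lambda>u v. \<exists>e\<in>X. ends G e = {u, v})\<^sup>*\<^sup>*"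

definition is_cycle :: "('v, 'e) signed_graph \<Rightarrow> 'e set \<Rightarrow> bool" where
  "is_cycle G C \<longleftrightarrow> (\<exists>vs es. es \<noteq> [] \<and> length vs = length es \<and> distinct vs \<and> distinct es \<and>
     set vs \<subseteq> verts G \<and> set es \<subseteq> edges G \<and> C = set es \<and>
     (\<forall>i<length es. ends G (es ! i) = {vs ! i, vs ! (Suc i mod length es)}))"

definition spanning_tree :: "('v, 'e) signed_graph \<Rightarrow> 'e set \<Rightarrow> bool" where
  "spanning_tree G T \<longleftrightarrow> T \<subseteq> edges G \<and>
     (\<forall>u\<in>verts G. \<forall>v\<in>verts G. joined G T u v) \<and> (\<nexists>C. is_cycle G C \<and> C \<subseteq> T)"

definition cut :: "('v, 'e) signed_graph \<Rightarrow> 'e set \<Rightarrow> 'e \<Rightarrow> 'e set" where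
  "cut G T e = {f \<in> edges G. \<exists>u v. ends G f = {u, v} \<and> \<not> joined G (T - {e}) u v}"

definition cyc :: "('v, 'e) signed_graph \<Rightarrow> 'e set \<Rightarrow> 'e \<Rightarrow> 'e set" where
  "cyc G T f = (THE C. is_cycle G C \<and> C \<subseteq> insert f T)"

definition lowest :: "'e rel \<Rightarrow> 'e set \<Rightarrow> 'e \<Rightarrow> bool" where
  "lowest r X e \<longleftrightarrow> e \<in> X \<and> (\<forall>f\<in>X. (e, f) \<in> r)"

datatype activity =
  internally_active | internally_inactive | externally_active | externally_inactive

definition activity :: "('v, 'e) signed_graph \<Rightarrow> 'e rel \<Rightarrow> 'e set \<Rightarrow> 'e \<Rightarrow> activity" where
  "activity G r T e =
     (if e \<in> T then if lowest r (cut G T e) e then internally_active else internally_inactive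
      else if lowest r (cyc G T e) e then externally_active else externally_inactive)"


section \<open>Weights\<close>

text \<open>\<open>\<int>[A, A\<^sup>-\<^sup>1]\<close> is the group ring of the integers.\<close>

type_synonym laurent = "int \<Rightarrow>\<^sub>0 int"

definition Avar :: laurent where
  "Avar = Poly_Mapping.single 1 1"

text \<open>Integer powers of a unit; there is no type class with an inverse that \<open>laurent\<close> could belong to.\<close>

definition unit_power :: "'a::comm_ring_1 \<Rightarrow> int \<Rightarrow> 'a" where
  "unit_power x n = (if n \<ge> 0 then x ^ nat n else (THE y. x * y = 1) ^ nat (- n))"

fun weight :: "bool \<Rightarrow> activity \<Rightarrow> laurent" where
  "weight True internally_active = - unit_power Avar (-3)"
| "weight True internally_inactive = Avar"
| "weight True externally_active = - unit_power Avar 3"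
| "weight True externally_inactive = unit_power Avar (-1)"
| "weight False internally_active = - unit_power Avar 3"
| "weight False internally_inactive = unit_power Avar (-1)"
| "weight False externally_active = - unit_power Avar (-3)"
| "weight False externally_inactive = Avar"

definition tree_weight :: "('v, 'e) signed_graph \<Rightarrow> 'e rel \<Rightarrow> 'e set \<Rightarrow> laurent" where
  "tree_weight G r T = (\<Prod>e\<in>edges G. weight (e \<in> positive G) (activity G r T e))"


section \<open>The Tait graph\<close>

text \<open>\<open>S\<close> contains the darts whose face is shaded.\<close>

definition checkerboard :: "'d diagram \<Rightarrow> 'd set \<Rightarrow> bool" where
  "checkerboard D S \<longleftrightarrow> S \<subseteq> darts D \<and>
     (\<forall>d\<in>darts D. \<forall>d'\<in>face D d. d' \<in> S \<longleftrightarrow> d \<in> S) \<and>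
     (\<forall>d\<in>darts D. arc D d \<in> S \<longleftrightarrow> d \<notin> S)"

text \<open>
  The A-smoothing of a crossing joins the regions at the corners that follow its upper darts, so the
  edge is positive if these are shaded.
\<close>

definition tait_graph :: "'d diagram \<Rightarrow> 'd set \<Rightarrow> ('d set, 'd set) signed_graph" where
  "tait_graph D S =
     \<lparr>verts = {F \<in> faces D. F \<subseteq> S},
      edges = crossings D,
      ends = (\<lambda>c. face D ` (c \<inter> S)),
      positive = {c \<in> crossings D. c \<inter> over D \<subseteq> S}\<rparr>"

fun tree_smoothing :: "bool \<Rightarrow> activity \<Rightarrow> smoothing option" where
  "tree_smoothing True internally_inactive = Some A_smoothing"
| "tree_smoothing False externally_inactive = Some A_smoothing"
| "tree_smoothing True externally_inactive = Some B_smoothing"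
| "tree_smoothing False internally_inactive = Some B_smoothing"
| "tree_smoothing _ _ = None"

text \<open>The state of the partial smoothing \<open>U(T)\<close>.\<close>

definition tree_state :: "('v, 'd set) signed_graph \<Rightarrow> 'd set rel \<Rightarrow> 'd set set \<Rightarrow> 'd state" where
  "tree_state G r T = (\<lambda>e.
     if e \<in> edges G then tree_smoothing (e \<in> positive G) (activity G r T e) else None)"

end

theory Submission
  imports Defs "HOL-Library.Sublist"
begin

text \<open>
  A checkerboard colouring alternates around every vertex and along every edge, so every state, given
  by the set \<open>X\<close> of crossings whose shaded regions are joined, traverses its circles coherently: they are
  the orbits of a permutation \<open>state_step D X\<close> of the dart set \<open>S\<close>, and changing the choice at one
  crossing composes this permutation with a transposition. With Euler's formula it follows that
  \<open>X\<close> is a spanning tree of the Tait graph iff there is a single circle. On the circle of a spanning tree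
  every crossing is a chord; two chords are linked only if exchanging both edges gives another
  spanning tree, hence of two linked chords the higher one is dead. So the live chords are pairwise
  unlinked, an innermost one is a kink, and the partial smoothing is undone by Reidemeister I moves,
  where the sign of each kink is read off from the sign and the activity of its edge. The resolution
  tree processes the edges from the highest to the lowest and branches at an edge iff spanning trees
  that agree with the previous choices disagree on it; this happens exactly if the edge is dead.
\<close>

section \<open>Vertices of a diagram\<close>

text \<open>No Jordan curve argument is made: planarity enters through one inequality. Let V be the
  number of shaded regions and E the number of crossings. The empty state has V circles, and by
  Euler's formula the full state has at least E + 2 - V. A switch at one crossing changes the number
  of circles by at most one, so a state \<open>X\<close> with one circle satisfies V <= 1 + |X| and
  E + 2 - V <= 1 + (E - |X|), hence |X| = V - 1. Its circle runs through every shaded dart, so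
  \<open>X\<close> connects all shaded regions, and by the count it is a tree. Linking of chords is
  likewise a property of the cyclic order of the darts.

  The exponents have one source. The choice of the tree at a kink is the one that does not split off
  a loop, so the kink is negative if this choice is the A-smoothing and positive if it is the
  B-smoothing. The same comparison therefore gives the exponent of a dead edge and, with the
  opposite sign k, the factor -A^(3k) = (-A)^(3k) of a live one.\<close>

lemma orbit_funpow_card:
  assumes "permutation f"
  shows "orbit f x = (\<lambda>n. (f ^^ n) x) ` {0..<card (orbit f x)}"
    and "inj_on (\<lambda>n. (f ^^ n) x) {0..<card (orbit f x)}"
    and "(f ^^ card (orbit f x)) x = x"
proof -
  have x: "x \<in> orbit f x"
    by (rule permutation_self_in_orbit[OF assms])
  have "card (orbit f x) = funpow_dist1 f x x"
    using card_image[OF inj_on_funpow_dist1[OF x]] orbit_conv_funpow_dist1[OF x] by simp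
  then show "orbit f x = (\<lambda>n. (f ^^ n) x) ` {0..<card (orbit f x)}"
    and "inj_on (\<lambda>n. (f ^^ n) x) {0..<card (orbit f x)}"
    and "(f ^^ card (orbit f x)) x = x"
    using orbit_conv_funpow_dist1[OF x] inj_on_funpow_dist1[OF x] funpow_dist1_prop[OF x] by simp_all
qed

lemma orbit_card_2:
  assumes "permutation f" and "card (orbit f x) = 2"
  shows "orbit f x = {x, f x}" and "f x \<noteq> x" and "f (f x) = x"
proof -
  have I: "{0..<2::nat} = {0, 1}" by auto
  show "orbit f x = {x, f x}"
    using orbit_funpow_card(1)[OF assms(1), of x] assms(2) I by simp
  show "f x \<noteq> x"
    using orbit_funpow_card(2)[OF assms(1), of x] assms(2) I by auto
  show "f (f x) = x"
    using orbit_funpow_card(3)[OF assms(1), of x] assms(2) by (simp add: numeral_2_eq_2)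
qed

lemma orbit_card_4:
  assumes "permutation f" and "card (orbit f x) = 4"
  shows "orbit f x = {x, f x, f (f x), f (f (f x))}"
    and "distinct [x, f x, f (f x), f (f (f x))]" and "f (f (f (f x))) = x"
proof -
  have I: "{0..<4::nat} = {0, Suc 0, Suc (Suc 0), Suc (Suc (Suc 0))}" by auto
  show "orbit f x = {x, f x, f (f x), f (f (f x))}"
    using orbit_funpow_card(1)[OF assms(1), of x] assms(2) I by simp
  show "distinct [x, f x, f (f x), f (f (f x))]"
    using orbit_funpow_card(2)[OF assms(1), of x] unfolding assms(2) I by auto
  show "f (f (f (f x))) = x"
    using orbit_funpow_card(3)[OF assms(1), of x] assms(2) by (simp add: eval_nat_numeral)
qed

lemma wf_diagram_permutation:
  assumes "wf_diagram D"
  shows "permutation (rot D)" and "permutation (arc D)"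
  using assms unfolding wf_diagram_def permutation_permutes by blast+

lemma wf_diagram_inv_rot [simp]:
  assumes "wf_diagram D"
  shows "inv (rot D) (rot D d) = d" and "rot D (inv (rot D) d) = d"
  using permutation_bijective[OF wf_diagram_permutation(1)[OF assms]]
  by (simp_all add: bij_is_inj bij_is_surj surj_f_inv_f)

lemma wf_diagram_arc_arc [simp]:
  assumes "wf_diagram D"
  shows "arc D (arc D d) = d"
proof (cases "d \<in> darts D")
  case True
  then show ?thesis using assms by (simp add: wf_diagram_def)
next
  case False
  then have "arc D d = d"
    using assms permutes_not_in[of "arc D" "darts D" d] unfolding wf_diagram_def by blast
  then show ?thesis by simp
qed

lemma wf_diagram_darts:
  assumes "wf_diagram D"
  shows "rot D d \<in> darts D \<longleftrightarrow> d \<in> darts D" and "arc D d \<in> darts D \<longleftrightarrow> d \<in> darts D"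
    and "inv (rot D) d \<in> darts D \<longleftrightarrow> d \<in> darts D" and "finite (darts D)"
proof -
  have r: "rot D permutes darts D" and a: "arc D permutes darts D"
    using assms by (simp_all add: wf_diagram_def)
  show "rot D d \<in> darts D \<longleftrightarrow> d \<in> darts D" "arc D d \<in> darts D \<longleftrightarrow> d \<in> darts D"
    "inv (rot D) d \<in> darts D \<longleftrightarrow> d \<in> darts D"
    using permutes_in_image[OF r] permutes_in_image[OF a] permutes_in_image[OF permutes_inv[OF r]]
    by auto
  show "finite (darts D)"
    using assms by (simp add: wf_diagram_def)
qed

abbreviation vertex :: "'d diagram \<Rightarrow> 'd \<Rightarrow> 'd set" where
  "vertex D \<equiv> orbit (rot D)"

lemma vertex_self [simp]:
  assumes "wf_diagram D"
  shows "d \<in> vertex D d"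
  by (rule permutation_self_in_orbit[OF wf_diagram_permutation(1)[OF assms]])

lemma vertex_eqI:
  assumes "wf_diagram D" and "e \<in> vertex D d"
  shows "vertex D e = vertex D d"
  using cyclic_on_orbit'[OF wf_diagram_permutation(1)[OF assms(1)], of d] assms(2)
  by (rule orbit_cyclic_eq3)

lemma vertex_rot [simp]:
  assumes "wf_diagram D"
  shows "vertex D (rot D d) = vertex D d" and "vertex D (inv (rot D) d) = vertex D d"
proof -
  show *: "vertex D (rot D d) = vertex D d" for d
    using vertex_eqI[OF assms orbit.base] .
  show "vertex D (inv (rot D) d) = vertex D d"
    using *[of "inv (rot D) d"] assms by simp
qed

lemma vertex_subset_darts:
  assumes "wf_diagram D" and "d \<in> darts D"
  shows "vertex D d \<subseteq> darts D"
  using assms permutes_orbit_subset unfolding wf_diagram_def by metis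

lemma vertex_card:
  assumes "wf_diagram D" and "d \<in> darts D"
  shows "card (vertex D d) = 2 \<or> card (vertex D d) = 4"
  using assms unfolding wf_diagram_def vertices_def by blast

lemma crossing_vertex:
  assumes "wf_diagram D" and "c \<in> crossings D" and "d \<in> c"
  shows "vertex D d = c" and "d \<in> darts D" and "card c = 4"
proof -
  obtain e where e: "e \<in> darts D" "c = vertex D e" "card c = 4"
    using assms(2) by (auto simp: crossings_def vertices_def)
  show "vertex D d = c" using vertex_eqI[OF assms(1)] e assms(3) by blast
  show "d \<in> darts D" using vertex_subset_darts[OF assms(1) e(1)] e assms(3) by blast
  show "card c = 4" by fact
qed

lemma vertex_in_crossings:
  assumes "wf_diagram D" and "d \<in> darts D"
  shows "vertex D d \<in> crossings D \<longleftrightarrow> card (vertex D d) = 4"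
  using assms by (auto simp: crossings_def vertices_def)

lemma rot_in_crossing:
  assumes "wf_diagram D" and "c \<in> crossings D"
  shows "rot D d \<in> c \<longleftrightarrow> d \<in> c" and "inv (rot D) d \<in> c \<longleftrightarrow> d \<in> c"
  using crossing_vertex(1)[OF assms] vertex_rot[OF assms(1), of d] vertex_self[OF assms(1)]
  by metis+

lemma crossing_cases:
  assumes "wf_diagram D" and "c \<in> crossings D" and "d \<in> c"
  shows "c = {d, rot D d, rot D (rot D d), rot D (rot D (rot D d))}"
    and "distinct [d, rot D d, rot D (rot D d), rot D (rot D (rot D d))]"
    and "rot D (rot D (rot D (rot D d))) = d"
    and "inv (rot D) d = rot D (rot D (rot D d))"
proof -
  have v: "vertex D d = c" "card (vertex D d) = 4"
    using crossing_vertex[OF assms] by simp_all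
  note * = orbit_card_4[OF wf_diagram_permutation(1)[OF assms(1)] v(2), unfolded v(1)]
  show "c = {d, rot D d, rot D (rot D d), rot D (rot D (rot D d))}"
    and "distinct [d, rot D d, rot D (rot D d), rot D (rot D (rot D d))]"
    and "rot D (rot D (rot D (rot D d))) = d"
    by (fact *)+
  show "inv (rot D) d = rot D (rot D (rot D d))"
    using wf_diagram_inv_rot(1)[OF assms(1), of "rot D (rot D (rot D d))"] *(3) by simp
qed

lemma bivalent_cases:
  assumes "wf_diagram D" and "d \<in> darts D" and "vertex D d \<notin> crossings D"
  shows "vertex D d = {d, rot D d}" and "rot D d \<noteq> d" and "rot D (rot D d) = d"
    and "inv (rot D) d = rot D d" and "card (vertex D d) = 2"
proof -
  show v: "card (vertex D d) = 2"
    using assms(3) vertex_card[OF assms(1,2)] vertex_in_crossings[OF assms(1,2)] by simp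
  note * = orbit_card_2[OF wf_diagram_permutation(1)[OF assms(1)] v]
  show "vertex D d = {d, rot D d}" and "rot D d \<noteq> d" and "rot D (rot D d) = d"
    by (fact *)+
  show "inv (rot D) d = rot D d"
    using wf_diagram_inv_rot(1)[OF assms(1), of "rot D d"] *(3) by simp
qed

lemma vertices_disjoint:
  assumes "wf_diagram D" and "c \<in> crossings D" and "c' \<in> crossings D" and "d \<in> c" and "d \<in> c'"
  shows "c = c'"
  using crossing_vertex(1)[OF assms(1)] assms by metis

lemma over_alternates:
  assumes "wf_diagram D" and "c \<in> crossings D" and "d \<in> c"
  shows "rot D d \<in> over D \<longleftrightarrow> d \<notin> over D" and "inv (rot D) d \<in> over D \<longleftrightarrow> d \<notin> over D"
proof -
  show "rot D d \<in> over D \<longleftrightarrow> d \<notin> over D"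
    using assms unfolding wf_diagram_def by blast
  have "inv (rot D) d \<in> c" using assms rot_in_crossing by metis
  then have "rot D (inv (rot D) d) \<in> over D \<longleftrightarrow> inv (rot D) d \<notin> over D"
    using assms unfolding wf_diagram_def by blast
  then show "inv (rot D) d \<in> over D \<longleftrightarrow> d \<notin> over D" using assms(1) by simp
qed

lemma finite_crossings:
  assumes "wf_diagram D"
  shows "finite (crossings D)" and "c \<in> crossings D \<Longrightarrow> finite c"
proof -
  show "finite (crossings D)"
    using wf_diagram_darts(4)[OF assms] by (simp add: crossings_def vertices_def)
  show "c \<in> crossings D \<Longrightarrow> finite c"
    by (metis (lifting) card.infinite crossings_def mem_Collect_eq zero_neq_numeral)
qed

section \<open>Alternating colourings of darts\<close>

text \<open>Phrased by \<open>arc\<close> and \<open>rot\<close> alone, without faces, so that it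
  can be checked dart by dart after a smoothing or the removal of a vertex.\<close>

definition alternating :: "'d diagram \<Rightarrow> 'd set \<Rightarrow> bool" where
  "alternating D S \<longleftrightarrow> wf_diagram D \<and> S \<subseteq> darts D \<and>
     (\<forall>d\<in>darts D. (arc D d \<in> S \<longleftrightarrow> d \<notin> S) \<and> (rot D d \<in> S \<longleftrightarrow> d \<notin> S))"

lemma alternatingD:
  assumes "alternating D S"
  shows "wf_diagram D" and "S \<subseteq> darts D" and "finite S"
    and "d \<in> darts D \<Longrightarrow> arc D d \<in> S \<longleftrightarrow> d \<notin> S"
    and "d \<in> darts D \<Longrightarrow> rot D d \<in> S \<longleftrightarrow> d \<notin> S"
    and "d \<in> darts D \<Longrightarrow> inv (rot D) d \<in> S \<longleftrightarrow> d \<notin> S"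
proof -
  show wf: "wf_diagram D" and "S \<subseteq> darts D"
    using assms by (simp_all add: alternating_def)
  then show "finite S"
    using wf_diagram_darts(4) finite_subset by blast
  show "d \<in> darts D \<Longrightarrow> arc D d \<in> S \<longleftrightarrow> d \<notin> S"
    and *: "d \<in> darts D \<Longrightarrow> rot D d \<in> S \<longleftrightarrow> d \<notin> S" for d
    using assms by (simp_all add: alternating_def)
  show "d \<in> darts D \<Longrightarrow> inv (rot D) d \<in> S \<longleftrightarrow> d \<notin> S"
    using *[of "inv (rot D) d"] wf wf_diagram_darts(3)[OF wf] by simp
qed

lemma crossing_Int_alternating:
  assumes "alternating D S" and "c \<in> crossings D" and "d \<in> c" and "d \<in> S"
  shows "c \<inter> S = {d, rot D (rot D d)}" and "rot D (rot D d) \<noteq> d" and "rot D (rot D d) \<in> S"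
proof -
  note wf = alternatingD(1)[OF assms(1)]
  note cc = crossing_cases[OF wf assms(2,3)]
  have "d \<in> darts D" using crossing_vertex[OF wf assms(2,3)] by simp
  then have "rot D d \<notin> S" "rot D (rot D d) \<in> S" "rot D (rot D (rot D d)) \<notin> S"
    using assms(4) alternatingD(5)[OF assms(1)] wf_diagram_darts(1)[OF wf] by blast+
  then show "c \<inter> S = {d, rot D (rot D d)}" "rot D (rot D d) \<noteq> d" "rot D (rot D d) \<in> S"
    using assms(4) cc(1,2) by auto
qed

text \<open>Both \<open>over D\<close> and \<open>S\<close> alternate around a crossing, so there
  they coincide or are complementary. This dichotomy is the sign of the edge of the Tait
  graph.\<close>

lemma crossing_over_cases:
  assumes "alternating D S" and "c \<in> crossings D"
  shows "c \<inter> over D \<subseteq> S \<Longrightarrow> d \<in> c \<Longrightarrow> d \<in> over D \<longleftrightarrow> d \<in> S"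
    and "\<not> c \<inter> over D \<subseteq> S \<Longrightarrow> d \<in> c \<Longrightarrow> d \<in> over D \<longleftrightarrow> d \<notin> S"
proof -
  note wf = alternatingD(1)[OF assms(1)]
  have *: "(e \<in> over D \<longleftrightarrow> e \<in> S) \<longleftrightarrow> (d \<in> over D \<longleftrightarrow> d \<in> S)" if "d \<in> c" "e \<in> c" for d e
  proof -
    have "(rot D x \<in> over D \<longleftrightarrow> rot D x \<in> S) \<longleftrightarrow> (x \<in> over D \<longleftrightarrow> x \<in> S)" if "x \<in> c" for x
      using over_alternates(1)[OF wf assms(2) that] alternatingD(5)[OF assms(1)]
        crossing_vertex(2)[OF wf assms(2) that] by blast
    moreover have "rot D x \<in> c" if "x \<in> c" for x
      using rot_in_crossing[OF wf assms(2)] that by blast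
    ultimately show ?thesis
      using that crossing_cases(1)[OF wf assms(2) that(1)] by blast
  qed
  show "d \<in> over D \<longleftrightarrow> d \<in> S" if "c \<inter> over D \<subseteq> S" "d \<in> c"
  proof -
    have "\<exists>e\<in>c. e \<in> over D"
      using that(2) over_alternates(1)[OF wf assms(2)] rot_in_crossing[OF wf assms(2)] by metis
    then show ?thesis using * that by blast
  qed
  show "d \<in> over D \<longleftrightarrow> d \<notin> S" if "\<not> c \<inter> over D \<subseteq> S" "d \<in> c"
    using * that by blast
qed

text \<open>A walk along the edge of \<open>d\<close> with shading on the left: it arrives at the
  dart \<open>arc D d\<close> and turns. A left turn, \<open>inv (rot D)\<close>, keeps the shaded
  regions apart at the crossing, a right turn, \<open>rot D\<close>, joins them; at a 2-valent point
  both turns lead to the same dart.\<close>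

definition state_step :: "'d diagram \<Rightarrow> 'd set set \<Rightarrow> 'd \<Rightarrow> 'd" where
  "state_step D X d =
     (if vertex D (arc D d) \<in> X then rot D (arc D d) else inv (rot D) (arc D d))"

lemma vertex_state_step [simp]:
  assumes "wf_diagram D"
  shows "vertex D (state_step D X d) = vertex D (arc D d)"
  using assms by (simp add: state_step_def)

lemma state_step_in:
  assumes "alternating D S"
  shows "d \<in> S \<Longrightarrow> state_step D X d \<in> S"
proof -
  note wf = alternatingD(1)[OF assms]
  assume "d \<in> S"
  then have "d \<in> darts D" "arc D d \<notin> S" "arc D d \<in> darts D"
    using alternatingD[OF assms] wf_diagram_darts[OF wf] by blast+
  then show ?thesis
    using alternatingD(5,6)[OF assms] by (simp add: state_step_def)
qed

text \<open>The vertex reached does not depend on the turn, so darts with equal images arrive at the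
  same vertex and turn the same way there; hence injectivity.\<close>

lemma state_step_permutes:
  assumes wf: "wf_diagram D"
  shows "state_step D X permutes darts D"
proof (rule inj_imp_permutes)
  show "finite (darts D)" by (rule wf_diagram_darts(4)[OF wf])
  show "state_step D X d \<in> darts D" if "d \<in> darts D" for d
    using that wf_diagram_darts[OF wf] by (auto simp: state_step_def)
  show "inj_on (state_step D X) (darts D)"
  proof (rule inj_onI)
    fix d e assume de: "state_step D X d = state_step D X e"
    then have "vertex D (arc D d) = vertex D (arc D e)"
      using vertex_state_step[OF wf] by metis
    then consider "rot D (arc D d) = rot D (arc D e)"
      | "inv (rot D) (arc D d) = inv (rot D) (arc D e)"
      using de by (auto simp: state_step_def split: if_splits)
    then have "arc D d = arc D e"
      by cases (metis wf_diagram_inv_rot[OF wf])+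
    then show "d = e" by (metis wf_diagram_arc_arc[OF wf])
  qed
  show "state_step D X d = d" if "d \<notin> darts D" for d
  proof -
    have "rot D permutes darts D" "arc D permutes darts D"
      using wf by (simp_all add: wf_diagram_def)
    then have "rot D d = d" "arc D d = d" "inv (rot D) d = d"
      using that permutes_inv permutes_not_in by metis+
    then show ?thesis by (simp add: state_step_def)
  qed
qed

section \<open>Writhe under Reidemeister I moves\<close>

text \<open>The sums for all orientations together. A singleton says that an orientation exists and
  that the sum is independent of it, which is what \<open>THE\<close> in \<open>writhe\<close>
  requires; as a set it can be carried through the moves before this is known.\<close>

definition writhe_values :: "'d diagram \<Rightarrow> int set" where
  "writhe_values D = (\<lambda>R. \<Sum>c\<in>crossings D. crossing_sign D R c) ` {R. orientation D R}"

lemma writhe_eqI: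
  assumes "writhe_values D = {w}"
  shows "writhe D = w"
proof -
  have "(\<exists>R. orientation D R \<and> v = (\<Sum>c\<in>crossings D. crossing_sign D R c)) \<longleftrightarrow> v = w" for v
    using assms by (auto simp: writhe_values_def)
  then show ?thesis by (simp add: writhe_def)
qed

lemma vertex_cong:
  assumes "wf_diagram D" and "\<And>e. e \<in> vertex D d \<Longrightarrow> rot D' e = rot D e"
  shows "vertex D' d = vertex D d"
  using vertex_self[OF assms(1)] assms(2) by (rule orbit_cong)

lemma over_subset_darts:
  assumes "wf_diagram D"
  shows "over D \<subseteq> darts D"
proof
  fix d assume "d \<in> over D"
  then obtain c where "c \<in> crossings D" "d \<in> c"
    using assms unfolding wf_diagram_def by blast
  then show "d \<in> darts D" using crossing_vertex(2)[OF assms] by blast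
qed

lemma crossing_sign_cong:
  assumes "c \<inter> over D = c \<inter> over D'" and "c \<inter> R = c \<inter> R'"
    and "\<And>d. d \<in> c \<Longrightarrow> rot D' d = rot D d \<and> rot D d \<in> c"
  shows "crossing_sign D R c = crossing_sign D' R' c"
proof -
  have "c \<inter> over D \<inter> R = c \<inter> over D' \<inter> R'"
    using assms(1,2) by blast
  moreover have "rot D d \<in> R \<longleftrightarrow> rot D' d \<in> R'" if "d \<in> c" for d
    using assms(2,3) that by (metis Int_iff)
  ultimately have "(\<forall>d\<in>c \<inter> over D \<inter> R. rot D d \<in> R) \<longleftrightarrow> (\<forall>d\<in>c \<inter> over D' \<inter> R'. rot D' d \<in> R')"
    by auto
  then show ?thesis by (simp add: crossing_sign_def)
qed

text \<open>Every orientation of the new diagram restricts to one of the old (\<open>down\<close>),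
  every old one arises in this way (\<open>up\<close>), and restriction does not touch the
  crossings.\<close>

lemma writhe_values_subdivide:
  assumes "subdivide D D'"
  shows "writhe_values D' = writhe_values D"
  using assms
proof cases
  case (1 x y p q)
  note wf = \<open>wf_diagram D\<close>
  have arcx: "arc D x = y" "arc D y = x" "x \<noteq> y" "y \<in> darts D"
    using 1(3,4) wf wf_diagram_darts(2)[OF wf] by (auto simp: wf_diagram_def)
  have fresh: "p \<notin> darts D" "q \<notin> darts D" "p \<noteq> q" "p \<noteq> x" "p \<noteq> y" "q \<noteq> x" "q \<noteq> y"
    using 1(3,5,6) arcx(4) by auto
  have sel: "darts D' = darts D \<union> {p, q}" "over D' = over D"
    "rot D' p = q" "rot D' q = p" "arc D' x = p" "arc D' p = x" "arc D' y = q" "arc D' q = y"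
    using 1(1) fresh arcx(3) by simp_all
  have sel': "rot D' d = rot D d" "d \<noteq> x \<Longrightarrow> d \<noteq> y \<Longrightarrow> arc D' d = arc D d" if "d \<in> darts D" for d
    using 1(1) fresh that by auto
  have vD: "vertex D' d = vertex D d" if "d \<in> darts D" for d
    using vertex_subset_darts[OF wf that] sel'(1) by (intro vertex_cong[OF wf]) blast
  have vp: "vertex D' p = {p, q}" "vertex D' q = {p, q}"
  proof -
    have "vertex D' p = {(rot D' ^^ m) p |m. m < 2}" "vertex D' q = {(rot D' ^^ m) q |m. m < 2}"
      by (rule orbit_altdef_bounded; simp add: sel numeral_2_eq_2)+
    then show "vertex D' p = {p, q}" "vertex D' q = {p, q}"
      using sel by (auto simp: less_2_cases_iff intro: exI[of _ 0] exI[of _ "Suc 0"])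
  qed
  have "vertices D' = insert {p, q} (vertices D)"
    using vD vp by (auto simp: vertices_def sel(1) image_iff)
  then have cr: "crossings D' = crossings D"
    using fresh by (auto simp: crossings_def)
  have opp: "opposite D' d = opposite D d \<and> opposite D d \<in> darts D" if "d \<in> darts D" for d
    using that vD sel'(1) wf_diagram_darts(1)[OF wf] by (simp add: opposite_def)
  have opp': "opposite D' p = q" "opposite D' q = p"
    using fresh sel vp by (simp_all add: opposite_def)
  have sums: "(\<Sum>c\<in>crossings D'. crossing_sign D' R' c) = (\<Sum>c\<in>crossings D. crossing_sign D R c)"
    if "R = R' \<inter> darts D" for R R'
    unfolding cr
  proof (rule sum.cong[OF refl])
    fix c assume c: "c \<in> crossings D"
    have "c \<subseteq> darts D" using crossing_vertex(2)[OF wf c] by blast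
    then show "crossing_sign D' R' c = crossing_sign D R c"
      using that sel(2) sel'(1) rot_in_crossing(1)[OF wf c]
      by (intro crossing_sign_cong) auto
  qed
  have down: "orientation D (R' \<inter> darts D)" if R': "orientation D' R'" for R'
  proof -
    have a: "arc D' d \<in> R' \<longleftrightarrow> d \<notin> R'" and o: "opposite D' d \<in> R' \<longleftrightarrow> d \<notin> R'"
      if "d \<in> darts D'" for d using R' that by (auto simp: orientation_def)
    have xy: "y \<in> R' \<longleftrightarrow> x \<notin> R'"
      using a[of p] a[of q] o[of p] opp'(1) sel by simp
    have "arc D d \<in> R' \<longleftrightarrow> d \<notin> R'" if "d \<in> darts D" for d
      using that a[of d] xy sel(1) sel'(2)[OF that] arcx(1,2) by (cases "d = x \<or> d = y") auto
    moreover have "opposite D d \<in> R' \<longleftrightarrow> d \<notin> R'" if "d \<in> darts D" for d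
      using that o[of d] opp[OF that] sel(1) by auto
    ultimately show ?thesis
      using opp wf_diagram_darts(2)[OF wf] by (auto simp: orientation_def)
  qed
  have up: "\<exists>R'. orientation D' R' \<and> R = R' \<inter> darts D" if R: "orientation D R" for R
  proof (intro exI conjI)
    let ?R = "R \<union> (if x \<in> R then {} else {p}) \<union> (if y \<in> R then {} else {q})"
    have sub: "R \<subseteq> darts D" and a: "\<And>d. d \<in> darts D \<Longrightarrow> arc D d \<in> R \<longleftrightarrow> d \<notin> R"
      and o: "\<And>d. d \<in> darts D \<Longrightarrow> opposite D d \<in> R \<longleftrightarrow> d \<notin> R"
      using R by (auto simp: orientation_def)
    have pq: "p \<notin> R" "q \<notin> R" using sub fresh by auto
    have xy: "y \<in> R \<longleftrightarrow> x \<notin> R" using a[OF 1(3)] arcx by simp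
    have inR: "e \<in> ?R \<longleftrightarrow> e \<in> R" if "e \<in> darts D" for e using that fresh by auto
    show "R = ?R \<inter> darts D" using sub fresh by auto
    have "arc D' d \<in> ?R \<longleftrightarrow> d \<notin> ?R" if "d \<in> darts D'" for d
    proof (cases "d \<in> {x, y, p, q}")
      case True
      then show ?thesis using sel pq xy fresh by auto
    next
      case False
      then have d: "d \<in> darts D" using that sel(1) by auto
      then show ?thesis
        using False sel'(2)[OF d] inR[OF d] inR[of "arc D d"] a[OF d] wf_diagram_darts(2)[OF wf, of d] d
        by simp
    qed
    moreover have "opposite D' d \<in> ?R \<longleftrightarrow> d \<notin> ?R" if "d \<in> darts D'" for d
    proof (cases "d \<in> {p, q}")
      case True
      then show ?thesis using opp' pq xy fresh by auto
    next
      case False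
      then have d: "d \<in> darts D" using that sel(1) by auto
      show ?thesis using inR[OF d] inR[of "opposite D d"] opp[OF d] o[OF d] by simp
    qed
    ultimately show "orientation D' ?R"
      using sub sel(1) by (auto simp: orientation_def)
  qed
  have img: "f ` {R. orientation D' R} = g ` {R. orientation D R}"
    if "\<And>R'. f R' = g (R' \<inter> darts D)" for f g :: "'a set \<Rightarrow> int"
    using down up that by (auto simp: image_iff)
  show ?thesis
    unfolding writhe_values_def by (rule img) (rule sums[OF refl])
qed

text \<open>The strand leaves the new crossing either along \<open>q\<close> and \<open>r\<close> or
  along \<open>p\<close> and \<open>s\<close>. In both cases the outgoing lower dart follows the
  outgoing upper one exactly if the upper strand is \<open>{q, s}\<close>, so the kink contributes
  the same sign for every orientation.\<close>

lemma writhe_values_add_kink: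
  assumes "wf_diagram D" and "x \<in> darts D" and "y = arc D x" and "distinct [p, q, r, s]"
    and "{p, q, r, s} \<inter> darts D = {}" and "u = {p, r} \<or> u = {q, s}"
    and D': "D' = \<lparr>darts = darts D \<union> {p, q, r, s},
      arc = (arc D)(x := p, p := x, y := q, q := y, r := s, s := r),
      rot = (rot D)(p := q, q := r, r := s, s := p),
      over = over D \<union> u\<rparr>"
  shows "writhe_values D' = (\<lambda>w. (if u = {p, r} then -1 else 1) + w) ` writhe_values D"
proof -
  note wf = \<open>wf_diagram D\<close>
  let ?K = "{p, q, r, s}"
  have arcx: "arc D x = y" "arc D y = x" "x \<noteq> y" "y \<in> darts D"
    using assms(1-3) wf_diagram_darts(2)[OF wf] by (auto simp: wf_diagram_def)
  have fresh: "p \<notin> darts D" "q \<notin> darts D" "r \<notin> darts D" "s \<notin> darts D"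
    using assms(5) by auto
  have neq: "x \<notin> ?K" "y \<notin> ?K"
    using assms(2) arcx(4) fresh by auto
  have dis: "p \<noteq> q" "p \<noteq> r" "p \<noteq> s" "q \<noteq> r" "q \<noteq> s" "r \<noteq> s"
    using assms(4) by auto
  have sel: "darts D' = darts D \<union> ?K" "over D' = over D \<union> u"
    "rot D' p = q" "rot D' q = r" "rot D' r = s" "rot D' s = p"
    "arc D' x = p" "arc D' p = x" "arc D' y = q" "arc D' q = y" "arc D' r = s" "arc D' s = r"
    using neq dis arcx(3) by (auto simp: D')
  have sel': "rot D' d = rot D d" "d \<noteq> x \<Longrightarrow> d \<noteq> y \<Longrightarrow> arc D' d = arc D d" if "d \<in> darts D" for d
    using fresh that by (auto simp: D')
  have vD: "vertex D' d = vertex D d" if "d \<in> darts D" for d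
    using vertex_subset_darts[OF wf that] sel'(1) by (intro vertex_cong[OF wf]) blast
  have vK: "vertex D' d = ?K" if "d \<in> ?K" for d
  proof -
    have "vertex D' d = {(rot D' ^^ m) d |m. m < 4}"
      using that sel by (intro orbit_altdef_bounded) (auto simp: eval_nat_numeral)
    also have "\<dots> = {d, rot D' d, rot D' (rot D' d), rot D' (rot D' (rot D' d))}"
    proof -
      have "{..<4::nat} = {0, Suc 0, Suc (Suc 0), Suc (Suc (Suc 0))}" by auto
      moreover have "{(rot D' ^^ m) d |m. m < 4} = (\<lambda>m. (rot D' ^^ m) d) ` {..<4}" by auto
      ultimately show ?thesis by simp
    qed
    also have "\<dots> = ?K" using that sel by auto
    finally show ?thesis .
  qed
  have cK: "card ?K = 4" using dis by simp
  have nK: "?K \<notin> crossings D" using crossing_vertex(2)[OF wf, of ?K] fresh by blast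
  have "vertices D' = insert ?K (vertices D)"
    using vD vK by (auto simp: vertices_def sel(1) image_iff)
  then have cr: "crossings D' = insert ?K (crossings D)"
    using cK by (auto simp: crossings_def)
  have opp: "opposite D' d = opposite D d \<and> opposite D d \<in> darts D" if "d \<in> darts D" for d
    using that vD sel'(1) wf_diagram_darts(1)[OF wf] by (simp add: opposite_def)
  have opp': "opposite D' p = r" "opposite D' q = s" "opposite D' r = p" "opposite D' s = q"
    using vK cK sel by (simp_all add: opposite_def)
  have ou: "?K \<inter> over D' = u"
    using assms(6) sel(2) fresh over_subset_darts[OF wf] by auto
  have sums: "(\<Sum>c\<in>crossings D'. crossing_sign D' R' c) =
      (if u = {p, r} then -1 else 1) + (\<Sum>c\<in>crossings D. crossing_sign D R c)"
    if "R = R' \<inter> darts D" and R': "orientation D' R'" for R R'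
  proof -
    have a: "arc D' d \<in> R' \<longleftrightarrow> d \<notin> R'" and o: "opposite D' d \<in> R' \<longleftrightarrow> d \<notin> R'"
      if "d \<in> darts D'" for d using R' that by (auto simp: orientation_def)
    have "(s \<in> R' \<longleftrightarrow> r \<notin> R') \<and> (r \<in> R' \<longleftrightarrow> p \<notin> R') \<and> (s \<in> R' \<longleftrightarrow> q \<notin> R')"
      using a[of r] o[of p] o[of q] sel opp' by auto
    moreover have "u = {p, r} \<longleftrightarrow> u \<noteq> {q, s}"
      using assms(6) dis by auto
    moreover have "crossing_sign D' R' ?K = (if \<forall>d\<in>u \<inter> R'. rot D' d \<in> R' then 1 else -1)"
      unfolding crossing_sign_def ou ..
    ultimately have K: "crossing_sign D' R' ?K = (if u = {p, r} then -1 else 1)"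
      using assms(6) sel by auto
    have "(\<Sum>c\<in>crossings D. crossing_sign D' R' c) = (\<Sum>c\<in>crossings D. crossing_sign D R c)"
    proof (rule sum.cong[OF refl])
      fix c assume c: "c \<in> crossings D"
      have "c \<subseteq> darts D" using crossing_vertex(2)[OF wf c] by blast
      then show "crossing_sign D' R' c = crossing_sign D R c"
        using that sel(2) sel'(1) rot_in_crossing(1)[OF wf c] fresh assms(6)
        by (intro crossing_sign_cong) auto
    qed
    then show ?thesis
      using K nK finite_crossings(1)[OF wf] by (simp add: cr)
  qed
  have down: "orientation D (R' \<inter> darts D)" if R': "orientation D' R'" for R'
  proof -
    have a: "arc D' d \<in> R' \<longleftrightarrow> d \<notin> R'" and o: "opposite D' d \<in> R' \<longleftrightarrow> d \<notin> R'"
      if "d \<in> darts D'" for d using R' that by (auto simp: orientation_def)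
    have rs: "y \<in> R' \<longleftrightarrow> x \<notin> R'"
      using a[of r] o[of p] o[of q] a[of p] a[of q] sel opp' by auto
    have "arc D d \<in> R' \<longleftrightarrow> d \<notin> R'" if "d \<in> darts D" for d
      using that a[of d] rs sel(1) sel'(2)[OF that] arcx(1,2) by (cases "d = x \<or> d = y") auto
    moreover have "opposite D d \<in> R' \<longleftrightarrow> d \<notin> R'" if "d \<in> darts D" for d
      using that o[of d] opp[OF that] sel(1) by auto
    ultimately show ?thesis
      using opp wf_diagram_darts(2)[OF wf] by (auto simp: orientation_def)
  qed
  have up: "\<exists>R'. orientation D' R' \<and> R = R' \<inter> darts D" if R: "orientation D R" for R
  proof (intro exI conjI)
    \<comment> \<open>The strand that leaves along \<open>x\<close> enters at \<open>p\<close>, goes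
      straight on to \<open>r\<close>, returns through the loop at \<open>s\<close> and leaves at
      \<open>q\<close> towards \<open>y\<close>. In the other direction the complementary pair is
      outgoing.\<close>
    let ?R = "R \<union> (if x \<in> R then {q, r} else {p, s})"
    have sub: "R \<subseteq> darts D" and a: "\<And>d. d \<in> darts D \<Longrightarrow> arc D d \<in> R \<longleftrightarrow> d \<notin> R"
      and o: "\<And>d. d \<in> darts D \<Longrightarrow> opposite D d \<in> R \<longleftrightarrow> d \<notin> R"
      using R by (auto simp: orientation_def)
    have pq: "p \<notin> R" "q \<notin> R" "r \<notin> R" "s \<notin> R" using sub fresh by auto
    have xy: "y \<in> R \<longleftrightarrow> x \<notin> R" using a[OF assms(2)] arcx by simp
    have inR: "e \<in> ?R \<longleftrightarrow> e \<in> R" if "e \<in> darts D" for e using that fresh by auto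
    show "R = ?R \<inter> darts D" using sub fresh by auto
    have "arc D' d \<in> ?R \<longleftrightarrow> d \<notin> ?R" if "d \<in> darts D'" for d
    proof (cases "d \<in> {x, y, p, q, r, s}")
      case True
      then show ?thesis using sel pq xy dis neq by auto
    next
      case False
      then have d: "d \<in> darts D" using that sel(1) by auto
      then show ?thesis
        using False sel'(2)[OF d] inR[OF d] inR[of "arc D d"] a[OF d] wf_diagram_darts(2)[OF wf, of d] d
        by simp
    qed
    moreover have "opposite D' d \<in> ?R \<longleftrightarrow> d \<notin> ?R" if "d \<in> darts D'" for d
    proof (cases "d \<in> ?K")
      case True
      then show ?thesis using opp' pq xy dis by auto
    next
      case False
      then have d: "d \<in> darts D" using that sel(1) by auto
      show ?thesis using inR[OF d] inR[of "opposite D d"] opp[OF d] o[OF d] by simp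
    qed
    ultimately show "orientation D' ?R"
      using sub sel(1) by (auto simp: orientation_def)
  qed
  have img: "f ` {R. orientation D' R} = h ` g ` {R. orientation D R}"
    if "\<And>R'. orientation D' R' \<Longrightarrow> f R' = h (g (R' \<inter> darts D))"
    for f g :: "'a set \<Rightarrow> int" and h :: "int \<Rightarrow> int"
    using down up that by (auto simp: image_iff)
  show ?thesis
    unfolding writhe_values_def by (rule img) (rule sums[OF refl])
qed

section \<open>Cycles as lists\<close>

text \<open>A cycle of \<open>f\<close> cut open at a chosen point. Linking of chords then becomes a
  condition on subsequences, and undoing a move deletes list entries.\<close>

definition cyc_list :: "('a \<Rightarrow> 'a) \<Rightarrow> 'a list \<Rightarrow> bool" where
  "cyc_list f L \<longleftrightarrow> L \<noteq> [] \<and> distinct L \<and> successively (\<lambda>x y. f x = y) L \<and> f (last L) = hd L"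

text \<open>The new map jumps from \<open>x\<close> over the block \<open>K\<close> to whatever
  followed it. This may be the head of the list, if \<open>K\<close> stands at its end.\<close>

lemma cyc_list_remove:
  assumes "cyc_list f (L1 @ [x] @ K @ L2)" and "K \<noteq> []"
    and "g x = f (last K)" and "\<And>d. d \<in> set L1 \<union> set L2 \<Longrightarrow> g d = f d"
  shows "cyc_list g (L1 @ [x] @ L2)"
proof -
  have d: "distinct (L1 @ [x] @ L2)"
    using assms(1) by (auto simp: cyc_list_def)
  have s: "successively (\<lambda>x y. f x = y) L1" "successively (\<lambda>x y. f x = y) L2"
    "L1 \<noteq> [] \<Longrightarrow> f (last L1) = x" "L2 \<noteq> [] \<Longrightarrow> f (last K) = hd L2"
    using assms(1,2) by (auto simp: cyc_list_def successively_append_iff successively_Cons split: if_splits)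
  have "f (last (if L2 = [] then K else L2)) = hd (L1 @ [x])"
    using assms(1,2) by (auto simp: cyc_list_def hd_append)
  then have l: "g (last (x # L2)) = hd (L1 @ [x])"
    using assms(3,4) by (cases "L2 = []") auto
  have "successively (\<lambda>x y. g x = y) L1" "successively (\<lambda>x y. g x = y) L2"
    using s(1,2) assms(4) by (auto elim!: successively_mono)
  moreover have "L1 \<noteq> [] \<Longrightarrow> g (last L1) = x" "L2 \<noteq> [] \<Longrightarrow> g x = hd L2"
    using s(3,4) assms(3,4) by simp_all
  ultimately have "successively (\<lambda>x y. g x = y) (L1 @ [x] @ L2)"
    by (auto simp: successively_append_iff successively_Cons)
  then show ?thesis
    using d l by (simp add: cyc_list_def hd_append)
qed

text \<open>Take two entries with equal key at minimal distance. An entry between them has a partner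
  of its own: inside, it gives a closer pair; outside, it gives an alternating pattern. So nothing
  lies between them.\<close>

lemma adjacent_pair:
  assumes "M \<noteq> []" and "\<And>v. v \<in> set M \<Longrightarrow> \<exists>v'\<in>set M. v' \<noteq> v \<and> k v' = k v"
    and nc: "\<And>u v u' v'. subseq [u, v, u', v'] M \<Longrightarrow> k u = k u' \<Longrightarrow> k v = k v' \<Longrightarrow> k u = k v"
  shows "\<exists>A u u' C. M = A @ [u, u'] @ C \<and> k u = k u'"
proof -
  let ?P = "\<lambda>n. \<exists>A u B u' C. M = A @ [u] @ B @ [u'] @ C \<and> k u = k u' \<and> length B = n"
  have pair: "\<exists>A w B w' C. M = A @ [w] @ B @ [w'] @ C \<and> {w, w'} = {v, v'}"
    if v: "v \<in> set M" "v' \<in> set M" "v \<noteq> v'" for v v'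
  proof -
    obtain P Q where PQ: "M = P @ v # Q" using v(1) split_list by metis
    then consider "v' \<in> set P" | "v' \<in> set Q" using v by auto
    then show ?thesis
    proof cases
      case 1
      then obtain A B where "P = A @ v' # B" using split_list by metis
      then have "M = A @ [v'] @ B @ [v] @ Q \<and> {v', v} = {v, v'}" using PQ by auto
      then show ?thesis by blast
    next
      case 2
      then obtain A B where "Q = A @ v' # B" using split_list by metis
      then have "M = P @ [v] @ A @ [v'] @ B \<and> {v, v'} = {v, v'}" using PQ by auto
      then show ?thesis by blast
    qed
  qed
  obtain v where v: "v \<in> set M" using assms(1) by fastforce
  then obtain v' where "v' \<in> set M" "v' \<noteq> v" "k v' = k v" using assms(2) by blast
  then have "\<exists>n. ?P n" using pair[OF v, of v'] by (metis doubleton_eq_iff)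
  then obtain n where n: "?P n" and min: "\<And>m. m < n \<Longrightarrow> \<not> ?P m"
    using exists_least_iff[of ?P] by blast
  from n obtain A u B u' C where M: "M = A @ [u] @ B @ [u'] @ C" "k u = k u'" "length B = n"
    by blast
  have "B = []"
  proof (rule ccontr)
    assume "B \<noteq> []"
    then obtain v B' where B: "B = v # B'" by (cases B) auto
    have "v \<in> set M" using M(1) B by simp
    then obtain v' where v': "v' \<in> set M" "v' \<noteq> v" "k v' = k v" using assms(2) by blast
    have kv: "k v \<noteq> k u"
    proof
      assume "k v = k u"
      then have "?P (length B')"
        using M(1,2) B by (intro exI[of _ "A @ [u]"] exI[of _ v] exI[of _ B'] exI[of _ u'] exI[of _ C]) simp
      then show False using min[of "length B'"] M(3) B by simp
    qed
    then have "v' \<noteq> u" "v' \<noteq> u'" using v'(3) M(2) by auto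
    then consider "v' \<in> set A" | "v' \<in> set B'" | "v' \<in> set C"
      using v' M(1) B by auto
    then show False
    proof cases
      case 1
      then have "subseq ([v'] @ [u] @ [v] @ [u']) (A @ [u] @ B @ ([u'] @ C))"
        by (intro list_emb_append_mono subseq_rev_drop_many) (auto simp: subseq_singleton_left B)
      then show False using nc[of v' u v u'] v'(3) M(1,2) kv by simp
    next
      case 2
      then obtain B1 B2 where B': "B' = B1 @ v' # B2" using split_list by metis
      then have "?P (length B1)"
        using M(1,2) B v'(3)
        by (intro exI[of _ "A @ [u]"] exI[of _ v] exI[of _ B1] exI[of _ v'] exI[of _ "B2 @ [u'] @ C"]) simp
      then show False using min[of "length B1"] M(3) B B' by simp
    next
      case 3
      then have "subseq ([u] @ [v] @ [u'] @ [v']) ((A @ [u]) @ B @ [u'] @ C)"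
        by (intro list_emb_append_mono subseq_drop_many) (auto simp: subseq_singleton_left B)
      then show False using nc[of u v u' v'] v'(3) M(1,2) kv by simp
    qed
  qed
  then show ?thesis using M(1,2) by auto
qed

section \<open>Removing a vertex\<close>

text \<open>The darts \<open>x\<close> and \<open>y\<close> are those outside \<open>K\<close> whose
  edges lead into \<open>K\<close>; they become the two ends of one edge. The darts of
  \<open>K\<close> are fixed by both maps, because permutations of the remaining darts must be the
  identity elsewhere.\<close>

definition remove_vertex :: "'d diagram \<Rightarrow> 'd set \<Rightarrow> 'd \<Rightarrow> 'd \<Rightarrow> 'd diagram" where
  "remove_vertex D K x y =
     \<lparr>darts = darts D - K,
      arc = (\<lambda>d. if d \<in> K then d else if d = x then y else if d = y then x else arc D d),
      rot = (\<lambda>d. if d \<in> K then d else rot D d),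
      over = over D - K\<rparr>"

text \<open>Serves the inverses of both moves: \<open>K\<close> is a 2-valent point or the crossing
  of a kink. In the last claim the walk along \<open>x\<close> now arrives at \<open>y\<close>,
  where the old walk arrived from the dart \<open>arc D y\<close> of \<open>K\<close>, so it
  continues as the old walk did after leaving \<open>K\<close>.\<close>

lemma remove_vertex:
  assumes wf: "wf_diagram D" and "k \<in> darts D" and K: "K = vertex D k"
    and "x \<in> darts D" and "y \<in> darts D" and "x \<notin> K" and "y \<notin> K" and "x \<noteq> y"
    and "arc D x \<in> K" and "arc D y \<in> K" and "\<forall>d\<in>K. arc D d \<in> K \<union> {x, y}"
  defines "D\<^sub>0 \<equiv> remove_vertex D K x y"
  shows "wf_diagram D\<^sub>0"
    and "\<And>d. d \<notin> K \<Longrightarrow> vertex D\<^sub>0 d = vertex D d"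
    and "crossings D\<^sub>0 = crossings D - {K}"
    and "\<And>S. alternating D S \<Longrightarrow> (x \<in> S \<longleftrightarrow> y \<notin> S) \<Longrightarrow>
       alternating D\<^sub>0 (S - K)"
    and "\<And>X d. d \<notin> K \<Longrightarrow> d \<noteq> x \<Longrightarrow> d \<noteq> y \<Longrightarrow>
       state_step D\<^sub>0 X d = state_step D X d"
    and "\<And>X. state_step D\<^sub>0 X x = state_step D X (arc D y)"
proof -
  have rK: "rot D d \<in> K \<longleftrightarrow> d \<in> K" "inv (rot D) d \<in> K \<longleftrightarrow> d \<in> K" for d
    using vertex_rot[OF wf, of d] vertex_eqI[OF wf] vertex_self[OF wf] unfolding K by metis+
  have Ksub: "K \<subseteq> darts D"
    using vertex_subset_darts[OF wf] assms(2) K by blast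
  have aa: "arc D (arc D d) = d" for d using wf by simp
  have a_in: "arc D d \<notin> K \<and> arc D d \<noteq> x \<and> arc D d \<noteq> y" if "d \<notin> K" "d \<noteq> x" "d \<noteq> y" for d
    using that assms(9-11) aa[of d] by (metis Un_iff insert_iff singletonD)
  have dD: "darts D\<^sub>0 = darts D - K" by (simp add: D\<^sub>0_def remove_vertex_def)
  have axy: "arc D\<^sub>0 x = y" "arc D\<^sub>0 y = x"
    using assms(6,7) by (auto simp: D\<^sub>0_def remove_vertex_def)
  have a0: "d \<in> K \<Longrightarrow> arc D\<^sub>0 d = d"
    "d \<notin> K \<Longrightarrow> d \<noteq> x \<Longrightarrow> d \<noteq> y \<Longrightarrow> arc D\<^sub>0 d = arc D d" for d
    using assms(6,7) by (auto simp: D\<^sub>0_def remove_vertex_def)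
  have r0: "d \<in> K \<Longrightarrow> rot D\<^sub>0 d = d" "d \<notin> K \<Longrightarrow> rot D\<^sub>0 d = rot D d" for d
    by (auto simp: D\<^sub>0_def remove_vertex_def)
  have a0a: "arc D\<^sub>0 (arc D\<^sub>0 d) = d" for d
    using a0[of d] a0[of "arc D d"] axy a_in[of d] aa[of d] by (cases "d \<in> K \<or> d = x \<or> d = y") auto
  have a0D: "arc D\<^sub>0 d \<in> darts D\<^sub>0" if "d \<in> darts D\<^sub>0" for d
  proof (cases "d = x \<or> d = y")
    case True
    then show ?thesis using axy assms(4-7) unfolding dD by auto
  next
    case False
    have "d \<notin> K" "d \<in> darts D" using that unfolding dD by simp_all
    then show ?thesis
      using False a0(2)[of d] a_in[of d] wf_diagram_darts(2)[OF wf, of d] unfolding dD by simp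
  qed
  have ap: "arc D\<^sub>0 permutes darts D\<^sub>0"
  proof (rule inj_imp_permutes)
    show "inj_on (arc D\<^sub>0) (darts D\<^sub>0)" by (metis a0a inj_onI)
    show "finite (darts D\<^sub>0)" using wf_diagram_darts(4)[OF wf] dD by simp
    show "arc D\<^sub>0 d = d" if "d \<notin> darts D\<^sub>0" for d
      using that axy a0[of d] dD assms(4-7) wf permutes_not_in[of "arc D" "darts D" d]
      unfolding wf_diagram_def by (metis DiffI)
  qed (rule a0D)
  have rp: "rot D\<^sub>0 permutes darts D\<^sub>0"
  proof (rule inj_imp_permutes)
    show "inj_on (rot D\<^sub>0) (darts D\<^sub>0)"
      using r0(2) wf_diagram_inv_rot(1)[OF wf] by (intro inj_onI) (metis DiffD2 dD)
    show "finite (darts D\<^sub>0)" using wf_diagram_darts(4)[OF wf] dD by simp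
    show "rot D\<^sub>0 d \<in> darts D\<^sub>0" if "d \<in> darts D\<^sub>0" for d
      using that r0(2)[of d] rK(1)[of d] dD wf_diagram_darts(1)[OF wf, of d] by simp
    show "rot D\<^sub>0 d = d" if "d \<notin> darts D\<^sub>0" for d
      using that r0[of d] dD wf permutes_not_in[of "rot D" "darts D" d]
      unfolding wf_diagram_def by (metis DiffI)
  qed
  show v0: "vertex D\<^sub>0 d = vertex D d" if "d \<notin> K" for d
  proof (rule vertex_cong[OF wf])
    fix e assume "e \<in> vertex D d"
    then have "e \<notin> K"
      using that vertex_eqI[OF wf] vertex_self[OF wf] unfolding K by metis
    then show "rot D\<^sub>0 e = rot D e" by (rule r0)
  qed
  have vK: "vertex D d \<noteq> K" if "d \<notin> K" for d using that vertex_self[OF wf, of d] by blast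
  have vK': "vertex D d = K" if "d \<in> K" for d using that vertex_eqI[OF wf] K by blast
  have V: "vertices D\<^sub>0 = vertices D - {K}"
  proof -
    have "vertices D\<^sub>0 = vertex D ` (darts D - K)"
      unfolding vertices_def dD by (rule image_cong) (auto simp: v0)
    also have "\<dots> = vertices D - {K}"
      using vK vK' by (auto simp: vertices_def)
    finally show ?thesis .
  qed
  then show cr: "crossings D\<^sub>0 = crossings D - {K}"
    by (auto simp: crossings_def)
  have ov: "over D\<^sub>0 = over D - K" by (simp add: D\<^sub>0_def remove_vertex_def)
  have cK: "c \<inter> K = {}" if "c \<in> crossings D" "c \<noteq> K" for c
    using that crossing_vertex(1)[OF wf that(1)] vK' by blast
  show wf0: "wf_diagram D\<^sub>0"
    unfolding wf_diagram_def
  proof (intro conjI ballI)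
    show "finite (darts D\<^sub>0)" using wf_diagram_darts(4)[OF wf] dD by simp
    show "arc D\<^sub>0 d \<noteq> d" if "d \<in> darts D\<^sub>0" for d
      using that axy a0[of d] assms(8) dD wf by (cases "d = x \<or> d = y") (auto simp: wf_diagram_def)
    show "card v = 2 \<or> card v = 4" if "v \<in> vertices D\<^sub>0" for v
      using that V wf by (auto simp: wf_diagram_def)
    show "over D\<^sub>0 \<subseteq> \<Union> (crossings D\<^sub>0)"
    proof -
      have "over D \<subseteq> \<Union> (crossings D)" using wf by (simp add: wf_diagram_def)
      then show ?thesis unfolding cr ov by blast
    qed
    show "(rot D\<^sub>0 d \<in> over D\<^sub>0) = (d \<notin> over D\<^sub>0)" if "d \<in> \<Union> (crossings D\<^sub>0)" for d
    proof -
      obtain c where c: "c \<in> crossings D" "d \<in> c" "c \<noteq> K" using \<open>d \<in> _\<close> cr by blast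
      then have "d \<notin> K" using cK by blast
      then show ?thesis
        using over_alternates(1)[OF wf c(1,2)] r0(2)[of d] rK(1)[of d] ov by auto
    qed
  qed (simp_all add: ap rp a0a)
  show "alternating D\<^sub>0 (S - K)" if S: "alternating D S" "x \<in> S \<longleftrightarrow> y \<notin> S" for S
    unfolding alternating_def
  proof (intro conjI ballI)
    show "S - K \<subseteq> darts D\<^sub>0" using alternatingD(2)[OF S(1)] dD by blast
    fix d assume d: "d \<in> darts D\<^sub>0"
    then have d': "d \<in> darts D" "d \<notin> K" using dD by auto
    show "arc D\<^sub>0 d \<in> S - K \<longleftrightarrow> d \<notin> S - K"
      using d' alternatingD(4)[OF S(1) d'(1)] S(2) axy a0[of d] a_in[of d] assms(6,7)
      by (cases "d = x \<or> d = y") auto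
    show "rot D\<^sub>0 d \<in> S - K \<longleftrightarrow> d \<notin> S - K"
      using d' alternatingD(5)[OF S(1) d'(1)] r0(2)[of d] rK(1)[of d] by auto
  qed (rule wf0)
  have i0: "inv (rot D\<^sub>0) d = inv (rot D) d" if "d \<notin> K" for d
    using r0(2)[of "inv (rot D) d"] rK(2)[of d] that wf_diagram_inv_rot(1)[OF wf0, of "inv (rot D) d"]
      wf_diagram_inv_rot(2)[OF wf, of d] by simp
  show "state_step D\<^sub>0 X d = state_step D X d" if "d \<notin> K" "d \<noteq> x" "d \<noteq> y" for X d
    using a_in[OF that] a0(2)[OF that] v0 r0(2) i0 by (simp add: state_step_def)
  show "state_step D\<^sub>0 X x = state_step D X (arc D y)" for X
    using assms(7) axy(1) v0 r0(2) i0 aa by (simp add: state_step_def)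
qed

section \<open>Noncrossing state circles\<close>

text \<open>A crossing has two darts in \<open>S\<close>, so a list of all of \<open>S\<close>
  passes it twice; its chord joins these two places. Two chords are linked if their ends alternate
  in the list.\<close>

definition noncrossing :: "'d diagram \<Rightarrow> 'd list \<Rightarrow> bool" where
  "noncrossing D L \<longleftrightarrow> (\<forall>u v u' v'. subseq [u, v, u', v'] L \<longrightarrow>
     vertex D u \<in> crossings D \<longrightarrow> vertex D v \<in> crossings D \<longrightarrow>
     vertex D u = vertex D u' \<longrightarrow> vertex D v = vertex D v' \<longrightarrow> vertex D u = vertex D v)"

lemma noncrossingD:
  assumes "noncrossing D L" and "subseq [u, v, u', v'] L"
    and "vertex D u \<in> crossings D" and "vertex D v \<in> crossings D"
    and "vertex D u = vertex D u'" and "vertex D v = vertex D v'"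
  shows "vertex D u = vertex D v"
  using assms(1)[unfolded noncrossing_def, rule_format, OF assms(2-6)] .

lemma noncrossing_subseq:
  assumes "noncrossing D L" and "subseq L\<^sub>0 L" and "\<And>d. d \<in> set L\<^sub>0 \<Longrightarrow> vertex D\<^sub>0 d = vertex D d"
    and "crossings D\<^sub>0 \<subseteq> crossings D"
  shows "noncrossing D\<^sub>0 L\<^sub>0"
  unfolding noncrossing_def
proof (intro allI impI)
  fix u v u' v'
  assume s: "subseq [u, v, u', v'] L\<^sub>0"
    and c: "vertex D\<^sub>0 u \<in> crossings D\<^sub>0" "vertex D\<^sub>0 v \<in> crossings D\<^sub>0"
      "vertex D\<^sub>0 u = vertex D\<^sub>0 u'" "vertex D\<^sub>0 v = vertex D\<^sub>0 v'"
  have "{u, v, u', v'} \<subseteq> set L\<^sub>0"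
    using list_emb_set[OF s] by auto
  then have "vertex D\<^sub>0 u = vertex D u" "vertex D\<^sub>0 v = vertex D v" "vertex D\<^sub>0 u' = vertex D u'"
    "vertex D\<^sub>0 v' = vertex D v'"
    using assms(3) by blast+
  moreover have "subseq [u, v, u', v'] L"
    using s assms(2) by (rule subseq_order.trans)
  ultimately show "vertex D\<^sub>0 u = vertex D\<^sub>0 v"
    using c assms(1,4) unfolding noncrossing_def by (metis subsetD)
qed

text \<open>The comparison holds if the choice of \<open>X\<close> at \<open>c\<close> is the
  A-smoothing. A state with a single circle does not split off the loop of a kink, and the
  A-smoothing of a positive kink would do so; therefore A belongs to -1.\<close>

definition kink_sign :: "'d diagram \<Rightarrow> 'd set \<Rightarrow> 'd set set \<Rightarrow> 'd set \<Rightarrow> int" where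
  "kink_sign D S X c = (if c \<inter> over D \<subseteq> S \<longleftrightarrow> c \<in> X then -1 else 1)"

text \<open>The dart \<open>x\<close> precedes \<open>d\<close> on the circle, so its edge ends at
  the other dart of the point. Both edges at the point are thus known, and merging them is inverse
  to a subdivision.\<close>

lemma remove_bivalent_point:
  assumes alt: "alternating D S" and cyc: "cyc_list (state_step D X) (L1 @ [x] @ [d] @ L2)"
    and L: "set (L1 @ [x] @ [d] @ L2) = S" and "vertex D d \<notin> crossings D"
  shows "\<exists>D\<^sub>0. subdivide D\<^sub>0 D \<and> alternating D\<^sub>0 (S - {d}) \<and>
    cyc_list (state_step D\<^sub>0 X) (L1 @ [x] @ L2) \<and> crossings D\<^sub>0 = crossings D \<and>
    over D\<^sub>0 = over D \<and> (\<forall>e\<in>S - {d}. vertex D\<^sub>0 e = vertex D e)"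
proof -
  note wf = alternatingD(1)[OF alt]
  have xd: "x \<in> S" "d \<in> S" "x \<noteq> d"
    using cyc L by (auto simp: cyc_list_def)
  then have D: "x \<in> darts D" "d \<in> darts D"
    using alternatingD(2)[OF alt] by auto
  note bv = bivalent_cases[OF wf D(2) assms(4)]
  define p where "p = rot D d"
  define y where "y = arc D d"
  define K where "K = vertex D d"
  have K: "K = {d, p}" using bv(1) by (simp add: K_def p_def)
  have stepx: "state_step D X x = d"
    using cyc by (auto simp: cyc_list_def successively_append_iff successively_Cons)
  have vx: "vertex D (arc D x) = vertex D d"
    using vertex_state_step[OF wf, of X x] stepx by simp
  have ax: "arc D x = p"
  proof -
    have "arc D x \<in> {d, p}" using vertex_self[OF wf, of "arc D x"] vx K K_def by simp
    moreover have "arc D x \<notin> S" using alternatingD(4)[OF alt D(1)] xd(1) by simp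
    ultimately show ?thesis using xd(2) by auto
  qed
  have aa: "arc D (arc D e) = e" for e using wf by simp
  have pS: "p \<notin> S" and yS: "y \<notin> S"
    using alternatingD(4,5)[OF alt D(2)] xd(2) by (simp_all add: p_def y_def)
  have pD: "p \<in> darts D" and yD: "y \<in> darts D"
    using D(2) wf_diagram_darts(1,2)[OF wf] by (simp_all add: p_def y_def)
  have yK: "y \<noteq> d" "y \<noteq> p" "y \<noteq> x" "x \<noteq> p" "d \<noteq> p"
  proof -
    \<comment> \<open>Otherwise a single edge would run from the point back to itself and
      \<open>x\<close> would equal \<open>d\<close>.\<close>
    show "y \<noteq> p" using aa[of d] aa[of x] ax xd(3) unfolding y_def by metis
  qed (use xd pS yS in auto)
  have ap: "arc D p = x" and ay: "arc D y = d" and ad: "arc D d = y"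
    using aa[of x] aa[of d] ax by (simp_all add: y_def)
  define D\<^sub>0 where "D\<^sub>0 = remove_vertex D K x y"
  note rv = remove_vertex[OF wf D(2) K_def D(1) yD, folded D\<^sub>0_def]
  have side: "x \<notin> K" "y \<notin> K" "x \<noteq> y" "arc D x \<in> K" "arc D y \<in> K"
    "\<forall>e\<in>K. arc D e \<in> K \<union> {x, y}"
    using yK xd(3) ax ay ap ad by (auto simp: K)
  note rv = rv[OF side]
  have SK: "S - K = S - {d}" using pS K by auto
  have alt0: "alternating D\<^sub>0 (S - {d})"
    using rv(4)[OF alt] xd(1) yS unfolding SK by simp
  have cr0: "crossings D\<^sub>0 = crossings D"
    using rv(3) assms(4) by (simp add: K_def)
  have Kov: "K \<inter> over D = {}"
  proof -
    have "c \<inter> K = {}" if c: "c \<in> crossings D" for c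
    proof (rule ccontr)
      assume "c \<inter> K \<noteq> {}"
      then obtain e where "e \<in> c" "e \<in> K" by blast
      then have "c = K" using crossing_vertex(1)[OF wf c] vertex_eqI[OF wf] K_def by metis
      then show False using c assms(4) K_def by simp
    qed
    then show ?thesis using wf unfolding wf_diagram_def by blast
  qed
  have ov0: "over D\<^sub>0 = over D" using Kov by (auto simp: D\<^sub>0_def remove_vertex_def)
  have v0: "\<forall>e\<in>S - {d}. vertex D\<^sub>0 e = vertex D e"
    using rv(2) pS K by auto
  have "state_step D\<^sub>0 X e = state_step D X e" if "e \<in> set L1 \<union> set L2" for e
  proof (rule rv(5))
    have "e \<in> S" "e \<noteq> x" "e \<noteq> d"
      using that L cyc by (auto simp: cyc_list_def)
    then show "e \<notin> K" "e \<noteq> x" "e \<noteq> y" using pS yS by (auto simp: K)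
  qed
  then have cyc0: "cyc_list (state_step D\<^sub>0 X) (L1 @ [x] @ L2)"
    using rv(6)[of X] ay by (intro cyc_list_remove[OF cyc]) simp_all
  have "subdivide D\<^sub>0 \<lparr>darts = darts D\<^sub>0 \<union> {p, d},
      arc = (arc D\<^sub>0)(x := p, p := x, y := d, d := y),
      rot = (rot D\<^sub>0)(p := d, d := p), over = over D\<^sub>0\<rparr>"
    using D(1) side(1) yK
    by (intro subdivide.intros rv(1)) (auto simp: D\<^sub>0_def remove_vertex_def K)
  moreover have "\<lparr>darts = darts D\<^sub>0 \<union> {p, d},
      arc = (arc D\<^sub>0)(x := p, p := x, y := d, d := y),
      rot = (rot D\<^sub>0)(p := d, d := p), over = over D\<^sub>0\<rparr> = D"
    using D(2) pD bv(3) ax ap ay ad Kov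
    by (intro diagram.equality) (auto simp: D\<^sub>0_def remove_vertex_def K fun_eq_iff p_def)
  ultimately have "subdivide D\<^sub>0 D" by simp
  then show ?thesis
    using alt0 cyc0 cr0 ov0 v0 by blast
qed

text \<open>As \<open>u\<close> is followed by \<open>u'\<close> at the same crossing, the edge of
  \<open>u\<close> returns to this crossing, to a dart adjacent to \<open>u\<close>. It is the loop
  of a kink, and the turn prescribed by \<open>X\<close> decides on which side of the strand the
  kink lies.\<close>

lemma remove_kink:
  assumes alt: "alternating D S" and cyc: "cyc_list (state_step D X) (L1 @ [x] @ [u, u'] @ L2)"
    and L: "set (L1 @ [x] @ [u, u'] @ L2) = S" and c: "c \<in> crossings D"
    and "vertex D u = c" and "vertex D u' = c"
  shows "\<exists>D\<^sub>0. add_kink D\<^sub>0 D \<and> alternating D\<^sub>0 (S - {u, u'}) \<and>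
    cyc_list (state_step D\<^sub>0 X) (L1 @ [x] @ L2) \<and> crossings D\<^sub>0 = crossings D - {c} \<and>
    over D\<^sub>0 = over D - c \<and> (\<forall>e\<in>S - {u, u'}. vertex D\<^sub>0 e = vertex D e) \<and>
    writhe_values D = (\<lambda>w. kink_sign D S X c + w) ` writhe_values D\<^sub>0"
proof -
  note wf = alternatingD(1)[OF alt]
  have xu: "x \<in> S" "u \<in> S" "u' \<in> S" "x \<noteq> u" "x \<noteq> u'" "u \<noteq> u'"
    using cyc L by (auto simp: cyc_list_def)
  then have D: "x \<in> darts D" "u \<in> darts D" "u' \<in> darts D"
    using alternatingD(2)[OF alt] by auto
  have uc: "u \<in> c" "u' \<in> c" using assms(5,6) vertex_self[OF wf] by blast+
  note cu = crossing_cases[OF wf c uc(1)]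
  have u': "u' = rot D (rot D u)"
    using crossing_Int_alternating(1)[OF alt c uc(1) xu(2)] uc(2) xu(3,6)
    by (metis IntI insert_iff singletonD)
  define a where "a = rot D u"
  define b where "b = rot D u'"
  have rots: "rot D u = a" "rot D a = u'" "rot D u' = b" "rot D b = u"
    using cu(3) by (simp_all add: a_def b_def u')
  have irots: "inv (rot D) u = b" "inv (rot D) u' = a" "inv (rot D) a = u" "inv (rot D) b = u'"
    using rots wf_diagram_inv_rot(1)[OF wf] by metis+
  have K: "c = {u, a, u', b}" and dis: "distinct [u, a, u', b]"
    using cu(1,2) by (simp_all add: a_def b_def u')
  have KS: "a \<notin> S" "b \<notin> S"
    using alternatingD(5)[OF alt] D(2,3) xu(2,3) by (simp_all add: a_def b_def)
  have stepx: "state_step D X x = u" and stepu: "state_step D X u = u'"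
    using cyc by (auto simp: cyc_list_def successively_append_iff successively_Cons)
  have vx: "vertex D (arc D x) = c" and vu: "vertex D (arc D u) = c"
    using vertex_state_step[OF wf, of X x] vertex_state_step[OF wf, of X u] stepx stepu assms(5,6)
    by simp_all
  define y where "y = arc D u'"
  \<comment> \<open>With a turn by \<open>rot\<close> the edge of \<open>x\<close> must end just
    before \<open>u\<close>, at \<open>b\<close>, and that of \<open>u\<close> just before
    \<open>u'\<close>, at \<open>a\<close>; with the opposite turn the roles of \<open>a\<close> and
    \<open>b\<close> are exchanged.\<close>
  define p where "p = (if c \<in> X then b else a)"
  define p' where "p' = (if c \<in> X then a else b)"
  have ax: "arc D x = p" and au: "arc D u = p'"
    using stepx stepu vx vu rots irots wf_diagram_inv_rot[OF wf]
    unfolding state_step_def p_def p'_def by (metis (full_types))+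
  have aa: "arc D (arc D e) = e" for e using wf by simp
  have ap: "arc D p = x" "arc D p' = u" "arc D u' = y" "arc D y = u'"
    using aa[of x] aa[of u] aa[of u'] ax au by (simp_all add: y_def)
  have yS: "y \<notin> S" using alternatingD(4)[OF alt D(3)] xu(3) by (simp add: y_def)
  have yD: "y \<in> darts D" using D(3) wf_diagram_darts(2)[OF wf] by (simp add: y_def)
  have pp: "{p, p'} = {a, b}" "p \<noteq> p'" "p \<notin> S" "p' \<notin> S"
    using dis KS by (auto simp: p_def p'_def)
  have K': "c = {u, u', p, p'}" using K pp(1) by auto
  have yK: "y \<notin> c" "x \<notin> c" "x \<noteq> y"
  proof -
    have "y \<noteq> p" "y \<noteq> p'"
      using ap xu(5,6) by auto
    then show "y \<notin> c" "x \<notin> c" "x \<noteq> y"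
      using xu pp(3,4) yS unfolding K' by auto
  qed
  define D\<^sub>0 where "D\<^sub>0 = remove_vertex D c x y"
  have side: "x \<notin> c" "y \<notin> c" "x \<noteq> y" "arc D x \<in> c" "arc D y \<in> c"
    "\<forall>e\<in>c. arc D e \<in> c \<union> {x, y}"
    using yK ax au ap unfolding K' by simp_all
  note rv = remove_vertex[OF wf D(2) assms(5)[symmetric] D(1) yD side, folded D\<^sub>0_def]
  have SK: "S - c = S - {u, u'}" using pp(3,4) unfolding K' by auto
  have alt0: "alternating D\<^sub>0 (S - {u, u'})"
    using rv(4)[OF alt] xu(1) yS unfolding SK by simp
  have cr0: "crossings D\<^sub>0 = crossings D - {c}" by (rule rv(3))
  have ov0: "over D\<^sub>0 = over D - c" by (simp add: D\<^sub>0_def remove_vertex_def)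
  have v0: "\<forall>e\<in>S - {u, u'}. vertex D\<^sub>0 e = vertex D e"
    using rv(2) SK by blast
  have "state_step D\<^sub>0 X e = state_step D X e" if "e \<in> set L1 \<union> set L2" for e
  proof (rule rv(5))
    have "e \<in> S" "e \<noteq> x" "e \<noteq> u" "e \<noteq> u'"
      using that L cyc by (auto simp: cyc_list_def)
    then show "e \<notin> c" "e \<noteq> x" "e \<noteq> y" using pp(3,4) yS unfolding K' by auto
  qed
  then have cyc0: "cyc_list (state_step D\<^sub>0 X) (L1 @ [x] @ L2)"
    using rv(6)[of X] ap by (intro cyc_list_remove[OF cyc]) simp_all
  have D0: "darts D\<^sub>0 = darts D - c" "arc D\<^sub>0 x = y" "arc D\<^sub>0 y = x" "rot D\<^sub>0 = (\<lambda>d. if d \<in> c then d else rot D d)"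
    "arc D\<^sub>0 = (\<lambda>d. if d \<in> c then d else if d = x then y else if d = y then x else arc D d)"
    using yK by (auto simp: D\<^sub>0_def remove_vertex_def)
  have cD: "c \<subseteq> darts D" using crossing_vertex(2)[OF wf c] by blast
  have ovD: "over D = over D\<^sub>0 \<union> c \<inter> over D" using ov0 by auto
  have ovc: "c \<inter> over D = (if c \<inter> over D \<subseteq> S then {u, u'} else {a, b})"
  proof -
    have "c \<inter> S = {u, u'}" "c - S = {a, b}"
      using xu(2,3) KS unfolding K by auto
    moreover have "c \<inter> over D = (if c \<inter> over D \<subseteq> S then c \<inter> S else c - S)"
      using crossing_over_cases[OF alt c] by (cases "c \<inter> over D \<subseteq> S") auto
    ultimately show ?thesis by metis
  qed
  have KD: "c \<inter> darts D\<^sub>0 = {}" "darts D = darts D\<^sub>0 \<union> c" using D0(1) cD by auto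
  show ?thesis
  proof (cases "c \<in> X")
    case True
    then have p: "p = b" "p' = a" by (simp_all add: p_def p'_def)
    \<comment> \<open>The loop joins \<open>u\<close> to its successor \<open>a\<close>. Read
      counterclockwise, the kink starts at \<open>u'\<close>, whose edge leads to \<open>y\<close>,
      so \<open>y\<close> takes the place of the dart \<open>x\<close> of the move.\<close>
    have set: "{u', b, u, a} = c" using K by auto
    have hyp: "y \<in> darts D\<^sub>0" "x = arc D\<^sub>0 y" "distinct [u', b, u, a]" "{u', b, u, a} \<inter> darts D\<^sub>0 = {}"
      "c \<inter> over D = {u', u} \<or> c \<inter> over D = {b, a}"
    proof -
      show "y \<in> darts D\<^sub>0" using yD yK D0(1) by simp
      show "c \<inter> over D = {u', u} \<or> c \<inter> over D = {b, a}"
        using ovc by (metis insert_commute)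
    qed (use dis set KD D0(2,3) in auto)
    have eq: "D = \<lparr>darts = darts D\<^sub>0 \<union> {u', b, u, a},
      arc = (arc D\<^sub>0)(y := u', u' := y, x := b, b := x, u := a, a := u),
      rot = (rot D\<^sub>0)(u' := b, b := u, u := a, a := u'),
      over = over D\<^sub>0 \<union> c \<inter> over D\<rparr>" (is "D = ?D")
    proof (intro diagram.equality)
      show "arc D = arc ?D"
        using ax au ap p yK K by (simp add: fun_eq_iff D0(5))
      show "rot D = rot ?D"
        using rots K by (simp add: fun_eq_iff D0(4))
    qed (use KD(2) set ovD in simp_all)
    have add: "add_kink D\<^sub>0 D"
      using add_kink.intros[OF rv(1) hyp] eq by metis
    have "kink_sign D S X c = (if c \<inter> over D = {u', u} then -1 else 1)"
    proof (cases "c \<inter> over D \<subseteq> S")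
      case pos: True
      then have "c \<inter> over D = {u', u}" using ovc by (metis insert_commute)
      then show ?thesis using True pos by (simp add: kink_sign_def)
    next
      case neg: False
      then have "c \<inter> over D = {a, b}" using ovc by metis
      then have "c \<inter> over D \<noteq> {u', u}" using dis by (auto simp: doubleton_eq_iff)
      then show ?thesis using True neg by (simp add: kink_sign_def)
    qed
    then have "writhe_values D = (\<lambda>w. kink_sign D S X c + w) ` writhe_values D\<^sub>0"
      by (simp only: writhe_values_add_kink[OF rv(1) hyp eq])
    then show ?thesis
      using add alt0 cyc0 cr0 ov0 v0 by (intro exI[of _ D\<^sub>0] conjI)
  next
    case False
    then have p: "p = a" "p' = b" by (simp_all add: p_def p'_def)
    \<comment> \<open>Here the loop joins \<open>b\<close> to its successor \<open>u\<close>, and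
      the kink starts at \<open>a\<close>, whose edge leads to \<open>x\<close>.\<close>
    have set: "{a, u', b, u} = c" using K by auto
    have hyp: "x \<in> darts D\<^sub>0" "y = arc D\<^sub>0 x" "distinct [a, u', b, u]" "{a, u', b, u} \<inter> darts D\<^sub>0 = {}"
      "c \<inter> over D = {a, b} \<or> c \<inter> over D = {u', u}"
    proof -
      show "x \<in> darts D\<^sub>0" using D(1) yK D0(1) by simp
      show "c \<inter> over D = {a, b} \<or> c \<inter> over D = {u', u}"
        using ovc by (metis insert_commute)
    qed (use dis set KD D0(2,3) in auto)
    have eq: "D = \<lparr>darts = darts D\<^sub>0 \<union> {a, u', b, u},
      arc = (arc D\<^sub>0)(x := a, a := x, y := u', u' := y, b := u, u := b),
      rot = (rot D\<^sub>0)(a := u', u' := b, b := u, u := a),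
      over = over D\<^sub>0 \<union> c \<inter> over D\<rparr>" (is "D = ?D")
    proof (intro diagram.equality)
      show "arc D = arc ?D"
        using ax au ap p yK K by (simp add: fun_eq_iff D0(5))
      show "rot D = rot ?D"
        using rots K by (simp add: fun_eq_iff D0(4))
    qed (use KD(2) set ovD in simp_all)
    have add: "add_kink D\<^sub>0 D"
      using add_kink.intros[OF rv(1) hyp] eq by metis
    have "kink_sign D S X c = (if c \<inter> over D = {a, b} then -1 else 1)"
    proof (cases "c \<inter> over D \<subseteq> S")
      case pos: True
      then have "c \<inter> over D = {u, u'}" using ovc by metis
      then have "c \<inter> over D \<noteq> {a, b}" using dis by (auto simp: doubleton_eq_iff)
      then show ?thesis using False pos by (simp add: kink_sign_def)
    next
      case neg: False
      then have "c \<inter> over D = {a, b}" using ovc by metis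
      then show ?thesis using False neg by (simp add: kink_sign_def)
    qed
    then have "writhe_values D = (\<lambda>w. kink_sign D S X c + w) ` writhe_values D\<^sub>0"
      by (simp only: writhe_values_add_kink[OF rv(1) hyp eq])
    then show ?thesis
      using add alt0 cyc0 cr0 ov0 v0 by (intro exI[of _ D\<^sub>0] conjI)
  qed
qed

lemma state_circle_single_vertex:
  assumes alt: "alternating D {b}" and "state_step D X b = b" and "vertex D b \<notin> crossings D"
  shows "round_unknot D" and "crossings D = {}" and "writhe_values D = {0}"
proof -
  note wf = alternatingD(1)[OF alt]
  have bD: "b \<in> darts D" using alternatingD(2)[OF alt] by simp
  define a where "a = arc D b"
  note bv = bivalent_cases[OF wf bD assms(3)]
  have aD: "a \<in> darts D" using bD wf_diagram_darts(2)[OF wf] by (simp add: a_def)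
  have ab: "a \<noteq> b" using alternatingD(4)[OF alt bD] by (auto simp: a_def)
  have darts: "darts D = {a, b}"
  proof -
    have "d = a \<or> d = b" if "d \<in> darts D" for d
    proof (cases "d = b")
      case False
      then have "arc D d = b" using alternatingD(4)[OF alt that] by simp
      then show ?thesis using wf_diagram_arc_arc[OF wf, of d] by (simp add: a_def)
    qed simp
    then show ?thesis using aD bD by auto
  qed
  have rb: "rot D b = a"
    using bv(2) darts wf_diagram_darts(1)[OF wf, of b] bD by auto
  have vb: "vertex D b = {b, a}" using bv(1) rb by simp
  have va: "vertex D a = {b, a}" using vertex_eqI[OF wf, of a b] vb by simp
  show cr: "crossings D = {}"
    using ab by (auto simp: crossings_def vertices_def darts va vb)
  have "over D = {}" using wf cr by (simp add: wf_diagram_def)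
  moreover have "arc D = id(a := b, b := a)"
  proof
    fix d
    show "arc D d = (id(a := b, b := a)) d"
    proof (cases "d \<in> {a, b}")
      case True
      then show ?thesis using wf_diagram_arc_arc[OF wf, of b] ab by (auto simp: a_def)
    next
      case False
      then have "d \<notin> darts D" using darts by simp
      then show ?thesis
        using False wf permutes_not_in[of "arc D" "darts D" d] by (simp add: wf_diagram_def)
    qed
  qed
  moreover have "rot D = id(a := b, b := a)"
  proof
    fix d
    show "rot D d = (id(a := b, b := a)) d"
    proof (cases "d \<in> {a, b}")
      case True
      then show ?thesis using bv(3) rb ab by auto
    next
      case False
      then have "d \<notin> darts D" using darts by simp
      then show ?thesis
        using False wf permutes_not_in[of "rot D" "darts D" d] by (simp add: wf_diagram_def)
    qed
  qed
  ultimately show "round_unknot D"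
    unfolding round_unknot_def using ab darts
    by (intro exI[of _ a] exI[of _ b] conjI diagram.equality) simp_all
  have "opposite D b = a" "opposite D a = b"
    using ab bv(3) rb by (simp_all add: opposite_def va vb)
  moreover have "arc D b = a" "arc D a = b"
    using wf_diagram_arc_arc[OF wf, of b] by (simp_all add: a_def)
  ultimately have "orientation D {b}"
    using ab by (auto simp: orientation_def darts)
  then have "{R. orientation D R} \<noteq> {}" by blast
  then show "writhe_values D = {0}"
    by (auto simp: writhe_values_def cr)
qed

lemma twisted_unknot_move:
  assumes "twisted_unknot D" and "subdivide D D' \<or> add_kink D D' \<or> subdivide D' D"
  shows "twisted_unknot D'"
proof -
  define M :: "nat diagram \<Rightarrow> nat diagram \<Rightarrow> bool"
    where "M = (\<lambda>E F. subdivide E F \<or> add_kink E F)"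
  have tw: "twisted_unknot E \<longleftrightarrow> (\<exists>D\<^sub>0. round_unknot D\<^sub>0 \<and> equivclp M D\<^sub>0 E)" for E
    by (simp add: twisted_unknot_def M_def)
  have "M D D' \<or> M D' D"
    using assms(2) by (auto simp: M_def)
  then have "equivclp M D D'"
    using r_into_equivclp[of M] equivclp_sym[of M] by blast
  then show ?thesis
    using assms(1) equivclp_trans[of M] unfolding tw by blast
qed

text \<open>The head of \<open>L\<close> is a base point that survives all removals down to the
  round unknot. It guarantees that every point or pair to be removed from the tail has a predecessor
  on the list.\<close>

proposition noncrossing_based_circle:
  fixes D :: "nat diagram"
  assumes "alternating D S" and "cyc_list (state_step D X) L" and "set L = S"
    and "noncrossing D L" and "vertex D (hd L) \<notin> crossings D"
  shows "twisted_unknot D \<and> writhe_values D = {\<Sum>c\<in>crossings D. kink_sign D S X c}"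
  using assms
proof (induction "length L" arbitrary: D S L rule: less_induct)
  case less
  note alt = less.prems(1) and cyc = less.prems(2) and L = less.prems(3)
  note wf = alternatingD(1)[OF alt]
  obtain b M where bM: "L = b # M"
    using cyc by (cases L) (auto simp: cyc_list_def)
  have dist: "distinct L" using cyc by (simp add: cyc_list_def)
  \<comment> \<open>The 2-valent points are removed before any kink, so that afterwards an innermost
    chord has its two ends adjacent in the tail.\<close>
  consider "M = []" | d where "d \<in> set M" "vertex D d \<notin> crossings D"
    | "M \<noteq> []" "\<forall>d\<in>set M. vertex D d \<in> crossings D" by blast
  then show ?case
  proof cases
    case 1
    then have "S = {b}" "state_step D X b = b"
      using bM L cyc by (auto simp: cyc_list_def)
    then have "round_unknot D" "crossings D = {}" "writhe_values D = {0}"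
      using state_circle_single_vertex[of D b X] alt less.prems(5) bM by auto
    then show ?thesis by (auto simp: twisted_unknot_def)
  next
    case 2
    obtain A C where M: "M = A @ d # C" using 2(1) split_list by metis
    define P where "P = butlast (b # A)"
    define x where "x = last (b # A)"
    have Px: "b # A = P @ [x]" unfolding P_def x_def by simp
    then have L': "L = P @ [x] @ [d] @ C" using bM M by simp
    let ?L = "P @ [x] @ C"
    obtain D\<^sub>0 where D0: "subdivide D\<^sub>0 D" "alternating D\<^sub>0 (S - {d})"
      "cyc_list (state_step D\<^sub>0 X) ?L" "crossings D\<^sub>0 = crossings D" "over D\<^sub>0 = over D"
      "\<forall>e\<in>S - {d}. vertex D\<^sub>0 e = vertex D e"
      using remove_bivalent_point[OF alt cyc[unfolded L'] L[unfolded L'] 2(2)] by blast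
    have hd: "hd ?L = b" using Px by (metis append_assoc append_Cons list.sel(1))
    have S: "set ?L = S - {d}" using dist unfolding L[symmetric] L' by auto
    have "subseq ?L L" unfolding L' by (intro list_emb_append_mono) auto
    then have nc: "noncrossing D\<^sub>0 ?L"
      using D0(4,6) by (intro noncrossing_subseq[OF less.prems(4)]) (simp_all only: S Diff_subset)
    have b: "b \<in> S - {d}" using S hd by (metis D0(3) cyc_list_def hd_in_set)
    have "twisted_unknot D\<^sub>0 \<and> writhe_values D\<^sub>0 = {\<Sum>c\<in>crossings D\<^sub>0. kink_sign D\<^sub>0 (S - {d}) X c}"
    proof (rule less.hyps[OF _ D0(2,3) S nc])
      show "length ?L < length L" by (simp add: L')
      show "vertex D\<^sub>0 (hd ?L) \<notin> crossings D\<^sub>0"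
        using less.prems(5) D0(4,6) b hd bM by simp
    qed
    moreover have "kink_sign D\<^sub>0 (S - {d}) X c = kink_sign D S X c" if "c \<in> crossings D" for c
    proof -
      have "d \<notin> c" using crossing_vertex(1)[OF wf that] 2(2) that by blast
      then have "c \<inter> over D \<subseteq> S - {d} \<longleftrightarrow> c \<inter> over D \<subseteq> S" by blast
      then show ?thesis by (simp add: kink_sign_def D0(5))
    qed
    then have "sum (kink_sign D\<^sub>0 (S - {d}) X) (crossings D) = sum (kink_sign D S X) (crossings D)"
      by (intro sum.cong refl)
    ultimately show ?thesis
      using twisted_unknot_move[of D\<^sub>0 D] D0(1,4) writhe_values_subdivide[OF D0(1)] by simp
  next
    case 3
    have "\<exists>A u u' C. M = A @ [u, u'] @ C \<and> vertex D u = vertex D u'"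
    proof (rule adjacent_pair[OF 3(1)])
      show "\<exists>v'\<in>set M. v' \<noteq> v \<and> vertex D v' = vertex D v" if v: "v \<in> set M" for v
      proof -
        have c: "vertex D v \<in> crossings D" and vS: "v \<in> S" using 3(2) v L bM by auto
        let ?v = "rot D (rot D v)"
        have "?v \<noteq> v" "?v \<in> S"
          using crossing_Int_alternating[OF alt c vertex_self[OF wf] vS] by auto
        moreover have "vertex D ?v = vertex D v" using wf by simp
        \<comment> \<open>The head lies at no crossing, so it cannot be the second passage of this
          one.\<close>
        moreover have "?v \<in> set M" using calculation c less.prems(5) L bM by auto
        ultimately show ?thesis by blast
      qed
      show "vertex D u = vertex D v"
        if s: "subseq [u, v, u', v'] M" and eq: "vertex D u = vertex D u'" "vertex D v = vertex D v'"
        for u v u' v'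
      proof -
        have "{u, v} \<subseteq> set M" using list_emb_set[OF s] by auto
        then have "vertex D u \<in> crossings D" "vertex D v \<in> crossings D" using 3(2) by simp_all
        moreover have "subseq [u, v, u', v'] L" unfolding bM by (rule list_emb_Cons[OF s])
        ultimately show ?thesis using noncrossingD[OF less.prems(4)] eq by metis
      qed
    qed
    then obtain A u u' C where M: "M = A @ [u, u'] @ C" and uu: "vertex D u = vertex D u'"
      by blast
    define c where "c = vertex D u"
    have c: "c \<in> crossings D" using 3(2) M by (simp add: c_def)
    have cu': "vertex D u' = c" using uu by (simp add: c_def)
    define P where "P = butlast (b # A)"
    define x where "x = last (b # A)"
    have Px: "b # A = P @ [x]" unfolding P_def x_def by simp
    then have L': "L = P @ [x] @ [u, u'] @ C" using bM M by simp
    let ?L = "P @ [x] @ C"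
    obtain D\<^sub>0 where D0: "add_kink D\<^sub>0 D" "alternating D\<^sub>0 (S - {u, u'})"
      "cyc_list (state_step D\<^sub>0 X) ?L" "crossings D\<^sub>0 = crossings D - {c}" "over D\<^sub>0 = over D - c"
      "\<forall>e\<in>S - {u, u'}. vertex D\<^sub>0 e = vertex D e"
      "writhe_values D = (\<lambda>w. kink_sign D S X c + w) ` writhe_values D\<^sub>0"
      using remove_kink[OF alt cyc[unfolded L'] L[unfolded L'] c c_def[symmetric] cu'] by blast
    have hd: "hd ?L = b" using Px by (metis append_assoc append_Cons list.sel(1))
    have S: "set ?L = S - {u, u'}" using dist unfolding L[symmetric] L' by auto
    have "subseq ?L L" unfolding L' by (intro list_emb_append_mono) auto
    then have nc: "noncrossing D\<^sub>0 ?L"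
      using D0(4,6) by (intro noncrossing_subseq[OF less.prems(4)]) (simp_all only: S Diff_subset)
    have b: "b \<in> S - {u, u'}" using S hd by (metis D0(3) cyc_list_def hd_in_set)
    have "twisted_unknot D\<^sub>0 \<and>
      writhe_values D\<^sub>0 = {\<Sum>c\<in>crossings D\<^sub>0. kink_sign D\<^sub>0 (S - {u, u'}) X c}"
    proof (rule less.hyps[OF _ D0(2,3) S nc])
      show "length ?L < length L" by (simp add: L')
      show "vertex D\<^sub>0 (hd ?L) \<notin> crossings D\<^sub>0"
        using less.prems(5) D0(4,6) b hd bM by simp
    qed
    moreover have "kink_sign D\<^sub>0 (S - {u, u'}) X c' = kink_sign D S X c'" if "c' \<in> crossings D - {c}" for c'
    proof -
      have "c' \<inter> c = {}" using vertices_disjoint[OF wf _ c] that by blast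
      moreover have "{u, u'} \<subseteq> c" using uu c_def vertex_self[OF wf] by blast
      ultimately have "c' \<inter> over D\<^sub>0 = c' \<inter> over D" "c' \<inter> over D \<subseteq> S - {u, u'} \<longleftrightarrow> c' \<inter> over D \<subseteq> S"
        using D0(5) by blast+
      then show ?thesis by (simp add: kink_sign_def)
    qed
    then have "sum (kink_sign D\<^sub>0 (S - {u, u'}) X) (crossings D - {c}) =
        sum (kink_sign D S X) (crossings D - {c})"
      by (intro sum.cong refl)
    ultimately have "twisted_unknot D\<^sub>0"
      "writhe_values D\<^sub>0 = {\<Sum>c\<in>crossings D - {c}. kink_sign D S X c}"
      using D0(4) by simp_all
    then show ?thesis
      using twisted_unknot_move D0(1,7) sum.remove[OF finite_crossings(1)[OF wf] c, of "kink_sign D S X"]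
      by auto
  qed
qed

text \<open>The circle is first given an auxiliary base point, because a diagram with one crossing and no
  other vertices does not arise by adding a kink to an edge.\<close>

theorem noncrossing_circle:
  fixes D :: "nat diagram"
  assumes alt: "alternating D S" and cyc: "cyc_list (state_step D X) L" and L: "set L = S"
    and nc: "noncrossing D L"
  shows "twisted_unknot D \<and> writhe D = (\<Sum>c\<in>crossings D. kink_sign D S X c)"
proof -
  note wf = alternatingD(1)[OF alt]
  obtain p where p: "p \<notin> darts D"
    using ex_new_if_finite[OF infinite_UNIV_nat wf_diagram_darts(4)[OF wf]] by blast
  obtain q where q: "q \<notin> insert p (darts D)"
    using ex_new_if_finite[OF infinite_UNIV_nat, of "insert p (darts D)"] wf_diagram_darts(4)[OF wf] by auto
  define x where "x = last L"
  define y where "y = arc D x"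
  have xS: "x \<in> S" using cyc L by (auto simp: cyc_list_def x_def)
  have xD: "x \<in> darts D" using xS alternatingD(2)[OF alt] by blast
  have yS: "y \<notin> S" using alternatingD(4)[OF alt xD] xS by (simp add: y_def)
  have yD: "y \<in> darts D" using xD wf_diagram_darts(2)[OF wf] by (simp add: y_def)
  have ay: "arc D y = x" using wf by (simp add: y_def)
  \<comment> \<open>The base point is put on the edge that closes the circle from the last entry of
    \<open>L\<close> to the first; its shaded dart \<open>q\<close> thus comes in front of
    \<open>L\<close>.\<close>
  define D' where "D' = \<lparr>darts = darts D \<union> {p, q},
      arc = (arc D)(x := p, p := x, y := q, q := y),
      rot = (rot D)(p := q, q := p),
      over = over D\<rparr>"
  have sub: "subdivide D D'"
    unfolding D'_def using wf xD y_def p q by (intro subdivide.intros) auto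
  have neq: "p \<noteq> q" "p \<notin> S" "q \<notin> S" "x \<noteq> y" "x \<noteq> p" "x \<noteq> q" "y \<noteq> p" "y \<noteq> q"
    using p q xD yD xS yS alternatingD(2)[OF alt] by auto
  have aD': "arc D' x = p" "arc D' p = x" "arc D' y = q" "arc D' q = y"
    "d \<notin> {x, y, p, q} \<Longrightarrow> arc D' d = arc D d" for d
    using neq by (auto simp: D'_def)
  have rD': "rot D' p = q" "rot D' q = p" "d \<notin> {p, q} \<Longrightarrow> rot D' d = rot D d" for d
    using neq by (auto simp: D'_def)
  have dD': "darts D' = insert p (insert q (darts D))" by (simp add: D'_def)
  have vD: "vertex D' d = vertex D d" if "d \<in> darts D" for d
  proof (rule vertex_cong[OF wf])
    fix e assume "e \<in> vertex D d"
    then have "e \<in> darts D" using vertex_subset_darts[OF wf that] by blast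
    then show "rot D' e = rot D e" using rD'(3)[of e] p q by auto
  qed
  have vp: "vertex D' p = {p, q}" "vertex D' q = {p, q}"
  proof -
    have "vertex D' p = {(rot D' ^^ m) p |m. m < 2}" "vertex D' q = {(rot D' ^^ m) q |m. m < 2}"
      by (rule orbit_altdef_bounded; simp add: rD' numeral_2_eq_2)+
    then show "vertex D' p = {p, q}" "vertex D' q = {p, q}"
      using rD'(1,2) by (auto simp: less_2_cases_iff intro: exI[of _ 0] exI[of _ "Suc 0"])
  qed
  have V': "vertices D' = insert {p, q} (vertices D)"
    using vD vp by (auto simp: vertices_def dD' image_iff)
  then have cr: "crossings D' = crossings D"
    using neq by (auto simp: crossings_def)
  have old: "arc D d \<in> darts D - {x, y}" if "d \<in> darts D" "d \<noteq> x" "d \<noteq> y" for d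
    using that ay y_def wf_diagram_arc_arc[OF wf, of d] wf_diagram_darts(2)[OF wf, of d] by auto
  have cases': "d \<in> {x, y, p, q} \<or> d \<in> darts D \<and> d \<notin> {x, y, p, q}" if "d \<in> darts D'" for d
    using that dD' p q by auto
  have aa': "arc D' (arc D' d) = d" "arc D' d \<noteq> d" "arc D' d \<in> darts D'" if "d \<in> darts D'" for d
  proof -
    have "arc D' (arc D' d) = d \<and> arc D' d \<noteq> d \<and> arc D' d \<in> darts D'"
      using cases'[OF that]
    proof
      assume "d \<in> {x, y, p, q}"
      then consider "d = x" | "d = y" | "d = p" | "d = q" by auto
      then show ?thesis
        by cases (use aD'(1-4) neq dD' xD yD in simp_all)
    next
      assume d: "d \<in> darts D \<and> d \<notin> {x, y, p, q}"
      then have "arc D d \<notin> {x, y, p, q}" "arc D d \<in> darts D" using old[of d] p q by auto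
      moreover have "arc D d \<noteq> d" using d wf by (simp add: wf_diagram_def)
      ultimately show ?thesis using aD'(5) d wf dD' by simp
    qed
    then show "arc D' (arc D' d) = d" "arc D' d \<noteq> d" "arc D' d \<in> darts D'" by simp_all
  qed
  have fin': "finite (darts D')" using dD' wf_diagram_darts(4)[OF wf] by simp
  \<comment> \<open>The rule for \<open>subdivide\<close> demands well-formedness of the old
    diagram, and that of the new one has to be derived.\<close>
  have wf': "wf_diagram D'"
    unfolding wf_diagram_def
  proof (intro conjI ballI fin')
    show "arc D' permutes darts D'"
    proof (rule inj_imp_permutes[OF _ fin'])
      show "inj_on (arc D') (darts D')" by (metis aa'(1) inj_onI)
      show "arc D' d = d" if "d \<notin> darts D'" for d
      proof -
        have "d \<notin> darts D" "d \<notin> {x, y, p, q}" using that dD' xD yD by auto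
        then show ?thesis
          using aD'(5) wf permutes_not_in[of "arc D" "darts D" d] by (simp add: wf_diagram_def)
      qed
    qed (rule aa'(3))
    show "rot D' permutes darts D'"
    proof (rule inj_imp_permutes[OF _ fin'])
      have r: "rot D' d \<in> darts D \<longleftrightarrow> d \<notin> {p, q}" if "d \<in> darts D'" for d
        using that rD' dD' p q wf_diagram_darts(1)[OF wf, of d] by (cases "d \<in> {p, q}") auto
      show "inj_on (rot D') (darts D')"
      proof (rule inj_onI)
        fix d e assume de: "d \<in> darts D'" "e \<in> darts D'" "rot D' d = rot D' e"
        then have "d \<in> {p, q} \<longleftrightarrow> e \<in> {p, q}" using r by metis
        then consider "d \<in> {p, q}" "e \<in> {p, q}" | "d \<notin> {p, q}" "e \<notin> {p, q}" by blast
        then show "d = e"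
        proof cases
          case 1
          then show ?thesis using de(3) rD'(1,2) neq(1) by auto
        next
          case 2
          then have "rot D d = rot D e" using de(3) rD'(3) by simp
          then show ?thesis by (metis wf_diagram_inv_rot(1)[OF wf])
        qed
      qed
      show "rot D' d \<in> darts D'" if "d \<in> darts D'" for d
        using that rD' dD' wf_diagram_darts(1)[OF wf, of d] by (cases "d \<in> {p, q}") auto
      show "rot D' d = d" if "d \<notin> darts D'" for d
        using that rD'(3) dD' wf permutes_not_in[of "rot D" "darts D" d] by (simp add: wf_diagram_def)
    qed
    show "card v = 2 \<or> card v = 4" if "v \<in> vertices D'" for v
      using that V' wf neq(1) by (auto simp: wf_diagram_def)
    show "over D' \<subseteq> \<Union> (crossings D')"
      using wf cr by (simp add: wf_diagram_def D'_def)
    show "rot D' d \<in> over D' \<longleftrightarrow> d \<notin> over D'" if "d \<in> \<Union> (crossings D')" for d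
    proof -
      obtain c where c: "c \<in> crossings D" "d \<in> c" using \<open>d \<in> _\<close> cr by blast
      then have "d \<notin> {p, q}" using crossing_vertex(2)[OF wf] p q by blast
      then show ?thesis using over_alternates(1)[OF wf c] rD'(3) by (simp add: D'_def)
    qed
  qed (use aa' in auto)
  have alt': "alternating D' (insert q S)"
    unfolding alternating_def
  proof (intro conjI ballI wf')
    show "insert q S \<subseteq> darts D'" using alternatingD(2)[OF alt] dD' by blast
    fix d assume d: "d \<in> darts D'"
    show "arc D' d \<in> insert q S \<longleftrightarrow> d \<notin> insert q S"
    proof (cases "d \<in> {x, y, p, q}")
      case True
      then consider "d = x" | "d = y" | "d = p" | "d = q" by auto
      then show ?thesis
        by cases (use aD'(1-4) neq xS yS in simp_all)
    next
      case False
      then have "d \<in> darts D" using d dD' by simp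
      then show ?thesis
        using False aD'(5)[of d] alternatingD(4)[OF alt, of d] wf_diagram_darts(2)[OF wf, of d] q by auto
    qed
    show "rot D' d \<in> insert q S \<longleftrightarrow> d \<notin> insert q S"
    proof (cases "d \<in> {p, q}")
      case True
      then show ?thesis using rD'(1,2) neq by auto
    next
      case False
      then have "d \<in> darts D" using d dD' by simp
      then show ?thesis
        using False rD'(3)[of d] alternatingD(5)[OF alt, of d] wf_diagram_darts(1)[OF wf, of d] q by auto
    qed
  qed
  have iD': "inv (rot D') d = inv (rot D) d" if "d \<in> darts D" for d
  proof -
    have "inv (rot D) d \<in> darts D" using that wf_diagram_darts(3)[OF wf] by simp
    then have "rot D' (inv (rot D) d) = d" using rD'(3)[of "inv (rot D) d"] p q wf by auto
    then show ?thesis using wf_diagram_inv_rot(1)[OF wf'] by metis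
  qed
  have ip: "inv (rot D') p = q"
    using rD'(2) wf_diagram_inv_rot(1)[OF wf'] by metis
  have step: "state_step D' X d = state_step D X d" if "d \<in> S" "d \<noteq> x" for d
  proof -
    have "d \<in> darts D" "d \<notin> {x, y, p, q}"
      using that alternatingD(2)[OF alt] neq yS by auto
    moreover from this have "arc D d \<in> darts D" using wf_diagram_darts(2)[OF wf] by blast
    moreover from this have "arc D d \<notin> {p, q}" using p q by auto
    ultimately show ?thesis
      using aD'(5)[of d] vD[of "arc D d"] iD'[of "arc D d"] rD'(3)[of "arc D d"]
      by (simp add: state_step_def)
  qed
  have stepq: "state_step D' X q = state_step D X x"
    using aD'(4) vD[OF yD] iD'[OF yD] rD'(3)[of y] neq(7,8) y_def by (simp add: state_step_def)
  have stepx: "state_step D' X x = q"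
    using aD'(1) rD'(1) ip by (simp add: state_step_def)
  have cyc': "cyc_list (state_step D' X) (q # L)"
  proof -
    have s: "successively (\<lambda>d e. state_step D' X d = e) L"
    proof -
      obtain M where M: "L = M @ [x]"
        using cyc x_def by (metis append_butlast_last_id cyc_list_def)
      then have "successively (\<lambda>d e. state_step D X d = e) M" "M \<noteq> [] \<Longrightarrow> state_step D X (last M) = x"
        and d: "x \<notin> set M" "set M \<subseteq> S"
        using cyc L by (auto simp: cyc_list_def successively_append_iff)
      then have "successively (\<lambda>d e. state_step D' X d = e) M" "M \<noteq> [] \<Longrightarrow> state_step D' X (last M) = x"
        using step d by (auto elim!: successively_mono) (metis last_in_set subsetD)
      then show ?thesis using M by (auto simp: successively_append_iff)
    qed
    show ?thesis
      using s cyc L neq stepq stepx by (auto simp: cyc_list_def x_def successively_Cons)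
  qed
  have nc': "noncrossing D' (q # L)"
    unfolding noncrossing_def
  proof (intro allI impI)
    fix u v u' v'
    assume s: "subseq [u, v, u', v'] (q # L)"
      and c: "vertex D' u \<in> crossings D'" "vertex D' v \<in> crossings D'"
        "vertex D' u = vertex D' u'" "vertex D' v = vertex D' v'"
    have "card {p, q} \<noteq> 4" using neq by simp
    then have "{p, q} \<notin> crossings D'" by (auto simp: crossings_def)
    then have nq: "u \<noteq> q" "v \<noteq> q" "u' \<noteq> q" "v' \<noteq> q" using c vp by auto
    then have s': "subseq [u, v, u', v'] L" using s by simp
    then have "{u, v, u', v'} \<subseteq> darts D"
      using list_emb_set[OF s'] L alternatingD(2)[OF alt] by auto
    then show "vertex D' u = vertex D' v"
      using c vD cr noncrossingD[OF nc s'] by simp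
  qed
  have "vertex D' (hd (q # L)) \<notin> crossings D'"
    using vp neq by (auto simp: crossings_def)
  then have *: "twisted_unknot D' \<and>
      writhe_values D' = {\<Sum>c\<in>crossings D'. kink_sign D' (insert q S) X c}"
    using noncrossing_based_circle[OF alt' cyc' _ nc'] L by simp
  have "kink_sign D' (insert q S) X c = kink_sign D S X c" if "c \<in> crossings D" for c
  proof -
    have "q \<notin> c" using crossing_vertex(2)[OF wf that] q by blast
    then have "c \<inter> over D \<subseteq> insert q S \<longleftrightarrow> c \<inter> over D \<subseteq> S" by blast
    then show ?thesis by (simp add: kink_sign_def D'_def)
  qed
  then have "writhe_values D = {\<Sum>c\<in>crossings D. kink_sign D S X c}"
    using * writhe_values_subdivide[OF sub] cr by (simp cong: sum.cong)
  then show ?thesis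
    using * sub twisted_unknot_move writhe_eqI by metis
qed

section \<open>Spanning trees and activities\<close>

text \<open>The closure relation of the graphic matroid. Cuts, fundamental cycles and trees are all
  expressed by it, which reduces exchanges of edges to one exchange property.\<close>

definition spans :: "('v, 'e) signed_graph \<Rightarrow> 'e set \<Rightarrow> 'e \<Rightarrow> bool" where
  "spans G X f \<longleftrightarrow> (\<forall>u v. ends G f = {u, v} \<longrightarrow> joined G X u v)"

lemma joined_refl [simp]: "joined G X u u"
  by (simp add: joined_def)

lemma joined_trans: "joined G X u v \<Longrightarrow> joined G X v w \<Longrightarrow> joined G X u w"
  by (simp add: joined_def)

lemma joined_edge: "e \<in> X \<Longrightarrow> ends G e = {u, v} \<Longrightarrow> joined G X u v"
  unfolding joined_def by (rule r_into_rtranclp) blast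

lemma joined_sym: "joined G X u v \<Longrightarrow> joined G X v u"
  unfolding joined_def
proof (induction rule: rtranclp_induct)
  case (step y z)
  then have "\<exists>e\<in>X. ends G e = {z, y}" by (metis insert_commute)
  then show ?case using step.IH by (rule converse_rtranclp_into_rtranclp)
qed simp

lemma joined_mono:
  assumes "joined G X u v" and "\<And>f. f \<in> X \<Longrightarrow> spans G Y f"
  shows "joined G Y u v"
  using assms(1) unfolding joined_def
proof (induction rule: rtranclp_induct)
  case (step y z)
  then have "joined G Y y z" using assms(2) unfolding spans_def by blast
  then show ?case using step.IH unfolding joined_def by simp
qed simp

lemma spans_mem: "f \<in> X \<Longrightarrow> spans G X f"
  by (simp add: spans_def joined_edge)

lemma spans_iff:
  assumes "ends G f = {u, v}"
  shows "spans G X f \<longleftrightarrow> joined G X u v"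
  using assms joined_sym[of G X] unfolding spans_def by (metis doubleton_eq_iff)

lemma joined_subset: "joined G X u v \<Longrightarrow> X \<subseteq> Y \<Longrightarrow> joined G Y u v"
  by (erule joined_mono) (auto intro: spans_mem)

lemma spans_subset: "spans G X f \<Longrightarrow> X \<subseteq> Y \<Longrightarrow> spans G Y f"
  unfolding spans_def by (meson joined_subset)

text \<open>A walk can be shortened until it uses \<open>e\<close> at most once, in one of the two
  directions.\<close>

lemma joined_insert:
  assumes "joined G (insert e Y) u v" and "ends G e = {a, b}"
  shows "joined G Y u v \<or> joined G Y u a \<and> joined G Y b v \<or> joined G Y u b \<and> joined G Y a v"
  using assms(1) unfolding joined_def[of G "insert e Y"]
proof (induction rule: rtranclp_induct)
  case base
  then show ?case by simp
next
  case (step y z)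
  then obtain f where f: "f \<in> insert e Y" "ends G f = {y, z}" by blast
  show ?case
  proof (cases "f \<in> Y")
    case True
    then have "joined G Y y z" using f joined_edge by metis
    then show ?thesis using step.IH joined_trans by metis
  next
    case False
    then have "y = a \<and> z = b \<or> y = b \<and> z = a"
      using f assms(2) by (auto simp: doubleton_eq_iff)
    then show ?thesis using step.IH joined_trans[of G Y] by (metis joined_refl)
  qed
qed

text \<open>The rest of the cycle, followed from the far end of \<open>e\<close>, leads back to its
  near end; the index \<open>k\<close> below counts the edges passed so far.\<close>

lemma cycle_spans:
  assumes "is_cycle G C" and "e \<in> C"
  shows "spans G (C - {e}) e"
proof -
  obtain vs es where c: "es \<noteq> []" "length vs = length es" "distinct es" "C = set es"
    "\<And>i. i < length es \<Longrightarrow> ends G (es ! i) = {vs ! i, vs ! (Suc i mod length es)}"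
    using assms(1) unfolding is_cycle_def by blast
  let ?n = "length es"
  obtain i where i: "i < ?n" "es ! i = e" using assms(2) c(4) by (metis in_set_conv_nth)
  have "joined G (C - {e}) (vs ! (Suc i mod ?n)) (vs ! (Suc (i + k) mod ?n))" if "k < ?n" for k
    using that
  proof (induction k)
    case 0
    then show ?case by simp
  next
    case (Suc k)
    let ?j = "Suc (i + k) mod ?n"
    have j: "?j < ?n" using c(1) by simp
    have "?j \<noteq> i"
    proof
      assume "?j = i"
      then have "Suc (i + k) mod ?n = i mod ?n" using i(1) by simp
      then have "?n dvd Suc k" using mod_eq_dvd_iff_nat[of i "Suc (i + k)" ?n] by simp
      then show False using Suc.prems by (simp add: nat_dvd_not_less)
    qed
    then have "es ! ?j \<in> C - {e}"
      using j i c(3,4) by (auto simp: nth_eq_iff_index_eq)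
    moreover have "ends G (es ! ?j) = {vs ! ?j, vs ! (Suc (i + Suc k) mod ?n)}"
      using c(5)[OF j] by (simp add: mod_Suc_eq)
    ultimately have "joined G (C - {e}) (vs ! ?j) (vs ! (Suc (i + Suc k) mod ?n))"
      by (rule joined_edge)
    then show ?case using Suc joined_trans by (metis Suc_lessD)
  qed
  from this[of "?n - 1"] have "joined G (C - {e}) (vs ! (Suc i mod ?n)) (vs ! i)"
    using c(1) i(1) by simp
  moreover have "ends G e = {vs ! (Suc i mod ?n), vs ! i}" using c(5)[OF i(1)] i(2) by auto
  ultimately show ?thesis by (simp add: spans_iff)
qed

section \<open>Cycles, exchange and spanning trees in a finite graph with loops and multiple
  edges\<close>

locale multigraph =
  fixes G :: "('v, 'e) signed_graph"
  assumes finite_edges: "finite (edges G)"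
    and ends_edge: "e \<in> edges G \<Longrightarrow> \<exists>u\<in>verts G. \<exists>v\<in>verts G. ends G e = {u, v}"
begin

text \<open>The walk is extended edge by edge; when it returns to a vertex of the path, the closed
  part is cut off.\<close>

lemma simple_path:
  assumes "joined G X u v" and "X \<subseteq> edges G" and "u \<in> verts G"
  shows "\<exists>vs es. length vs = Suc (length es) \<and> distinct vs \<and> hd vs = u \<and> last vs = v \<and>
    set vs \<subseteq> verts G \<and> set es \<subseteq> X \<and> (\<forall>i<length es. ends G (es ! i) = {vs ! i, vs ! Suc i})"
  using assms(1) unfolding joined_def
proof (induction rule: rtranclp_induct)
  case base
  show ?case using assms(3) by (intro exI[of _ "[u]"] exI[of _ "[]"]) simp
next
  case (step y z)
  then obtain vs es where p: "length vs = Suc (length es)" "distinct vs" "hd vs = u" "last vs = y"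
    "set vs \<subseteq> verts G" "set es \<subseteq> X" "\<And>i. i < length es \<Longrightarrow> ends G (es ! i) = {vs ! i, vs ! Suc i}"
    by blast
  obtain f where f: "f \<in> X" "ends G f = {y, z}" using step by blast
  show ?case
  proof (cases "z \<in> set vs")
    case True
    then obtain k where k: "k < length vs" "vs ! k = z" by (metis in_set_conv_nth)
    have "last (take (Suc k) vs) = z" using k by (simp add: take_Suc_conv_app_nth)
    moreover have "hd (take (Suc k) vs) = u" using p(1,3) by simp
    ultimately show ?thesis
      using p k by (intro exI[of _ "take (Suc k) vs"] exI[of _ "take k es"])
        (auto dest: in_set_takeD)
  next
    case False
    have "z \<in> verts G" using ends_edge[of f] f assms(2) by (auto simp: doubleton_eq_iff)
    moreover have "vs ! length es = y" using p(1,4) by (simp add: last_conv_nth flip: length_0_conv)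
    ultimately show ?thesis
      using p False f
      by (intro exI[of _ "vs @ [z]"] exI[of _ "es @ [f]"])
        (auto simp: nth_append less_Suc_eq hd_append)
  qed
qed

text \<open>A simple path between the ends of \<open>e\<close>, closed up by \<open>e\<close>. Its
  edges are distinct because its vertices are; for a loop \<open>e\<close> the path may have no
  edges at all.\<close>

lemma spans_cycle:
  assumes "spans G X e" and "X \<subseteq> edges G" and "e \<in> edges G" and "e \<notin> X"
  shows "\<exists>C. is_cycle G C \<and> C \<subseteq> insert e X"
proof -
  obtain u v where uv: "u \<in> verts G" "ends G e = {u, v}" using ends_edge assms(3) by blast
  then have "joined G X u v" using assms(1) by (simp add: spans_iff)
  then obtain vs es where p: "length vs = Suc (length es)" "distinct vs" "hd vs = u" "last vs = v"
    "set vs \<subseteq> verts G" "set es \<subseteq> X" "\<And>i. i < length es \<Longrightarrow> ends G (es ! i) = {vs ! i, vs ! Suc i}"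
    using simple_path[OF _ assms(2) uv(1)] by blast
  have "i = j" if ij: "i < length es" "j < length es" "es ! i = es ! j" for i j
  proof -
    have "{vs ! i, vs ! Suc i} = {vs ! j, vs ! Suc j}" using p(7) ij by metis
    then show ?thesis using ij p(1,2) by (auto simp: doubleton_eq_iff nth_eq_iff_index_eq)
  qed
  then have "distinct es" by (auto simp: distinct_conv_nth)
  then have dist: "distinct (es @ [e])" using assms(4) p(6) by auto
  have nth: "vs ! length es = v" "vs ! 0 = u"
    using p(1,3,4) by (simp_all add: last_conv_nth hd_conv_nth flip: length_0_conv)
  have "ends G ((es @ [e]) ! i) = {vs ! i, vs ! (Suc i mod length (es @ [e]))}"
    if "i < length (es @ [e])" for i
  proof (cases "i < length es")
    case True
    then show ?thesis using p(7) by (simp add: nth_append)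
  next
    case False
    then have "i = length es" using that by simp
    then show ?thesis using nth uv(2) by (simp add: insert_commute)
  qed
  then have "is_cycle G (set (es @ [e]))"
    unfolding is_cycle_def using dist p(1,2,5,6) assms(2,3)
    by (intro exI[of _ vs] exI[of _ "es @ [e]"]) auto
  then show ?thesis using p(6) by (intro exI[of _ "set (es @ [e])"]) auto
qed

text \<open>The Steinitz exchange property: a walk between the ends of \<open>g\<close> has to pass
  \<open>f\<close>, so its two remaining parts together with \<open>g\<close> connect the ends of
  \<open>f\<close>.\<close>

lemma spans_exchange:
  assumes "spans G (insert f Y) g" and "\<not> spans G Y g" and "f \<in> edges G" and "g \<in> edges G"
  shows "spans G (insert g Y) f"
proof -
  obtain a b where f: "ends G f = {a, b}" using ends_edge assms(3) by blast
  obtain u v where g: "ends G g = {u, v}" using ends_edge assms(4) by blast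
  have "joined G Y u a \<and> joined G Y b v \<or> joined G Y u b \<and> joined G Y a v"
    using assms(1,2) joined_insert[OF _ f] unfolding spans_iff[OF g] by blast
  then have "joined G (insert g Y) u a \<and> joined G (insert g Y) b v \<or>
      joined G (insert g Y) u b \<and> joined G (insert g Y) a v"
    using joined_subset[of G Y _ _ "insert g Y"] by blast
  moreover have "joined G (insert g Y) u v" using g by (intro joined_edge) auto
  ultimately show ?thesis
    unfolding spans_iff[OF f] using joined_trans[of G "insert g Y"] joined_sym[of G "insert g Y"] by metis
qed

lemma spanning_tree_iff:
  "spanning_tree G T \<longleftrightarrow> T \<subseteq> edges G \<and> (\<forall>u\<in>verts G. \<forall>v\<in>verts G. joined G T u v) \<and>
     (\<forall>e\<in>T. \<not> spans G (T - {e}) e)"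
proof -
  have "(\<nexists>C. is_cycle G C \<and> C \<subseteq> T) \<longleftrightarrow> (\<forall>e\<in>T. \<not> spans G (T - {e}) e)" if "T \<subseteq> edges G"
  proof
    assume nc: "\<nexists>C. is_cycle G C \<and> C \<subseteq> T"
    show "\<forall>e\<in>T. \<not> spans G (T - {e}) e"
    proof (intro ballI notI)
      fix e assume e: "e \<in> T" "spans G (T - {e}) e"
      then have "\<exists>C. is_cycle G C \<and> C \<subseteq> insert e (T - {e})"
        using that by (intro spans_cycle) auto
      then show False using nc e(1) by (simp add: insert_absorb)
    qed
  next
    assume ac: "\<forall>e\<in>T. \<not> spans G (T - {e}) e"
    show "\<nexists>C. is_cycle G C \<and> C \<subseteq> T"
    proof (intro notI, elim exE conjE)
      fix C assume C: "is_cycle G C" "C \<subseteq> T"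
      then obtain e where e: "e \<in> C" unfolding is_cycle_def by fastforce
      then have "spans G (T - {e}) e"
        using cycle_spans[OF C(1) e] C(2) by (auto elim: spans_subset)
      then show False using ac e C(2) by blast
    qed
  qed
  then show ?thesis by (auto simp: spanning_tree_def)
qed

lemma spanning_treeD:
  assumes "spanning_tree G T"
  shows "T \<subseteq> edges G" and "u \<in> verts G \<Longrightarrow> v \<in> verts G \<Longrightarrow> joined G T u v"
    and "e \<in> T \<Longrightarrow> \<not> spans G (T - {e}) e" and "f \<in> edges G \<Longrightarrow> spans G T f" and "finite T"
proof -
  show *: "T \<subseteq> edges G" "u \<in> verts G \<Longrightarrow> v \<in> verts G \<Longrightarrow> joined G T u v"
    "e \<in> T \<Longrightarrow> \<not> spans G (T - {e}) e" for u v e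
    using assms by (simp_all add: spanning_tree_iff)
  show "f \<in> edges G \<Longrightarrow> spans G T f"
    using ends_edge[of f] *(2) spans_iff by metis
  show "finite T" using *(1) finite_edges by (rule finite_subset)
qed

lemma connected_contains_spanning_tree:
  assumes "X \<subseteq> edges G" and "\<And>u v. u \<in> verts G \<Longrightarrow> v \<in> verts G \<Longrightarrow> joined G X u v"
  shows "\<exists>T\<subseteq>X. spanning_tree G T"
  using assms
proof (induction "card X" arbitrary: X rule: less_induct)
  case less
  show ?case
  proof (cases "\<forall>e\<in>X. \<not> spans G (X - {e}) e")
    case True
    then have "spanning_tree G X" using less.prems by (simp add: spanning_tree_iff)
    then show ?thesis by blast
  next
    case False
    then obtain e where e: "e \<in> X" "spans G (X - {e}) e" by blast
    have "finite X" using less.prems(1) finite_edges by (rule finite_subset)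
    then have "card (X - {e}) < card X" using e(1) by (rule card_Diff1_less)
    moreover have "joined G (X - {e}) u v" if "u \<in> verts G" "v \<in> verts G" for u v
      using less.prems(2)[OF that] by (rule joined_mono) (metis e(2) insertE insert_Diff_single insert_absorb spans_mem insertCI Diff_iff singletonD)
    moreover have "X - {e} \<subseteq> edges G" using less.prems(1) by blast
    ultimately have "\<exists>T\<subseteq>X - {e}. spanning_tree G T" by (intro less.hyps)
    then show ?thesis by blast
  qed
qed

text \<open>Exchange is used twice: \<open>f\<close> is spanned with the help of \<open>e\<close>,
  so \<open>e\<close> is spanned with the help of \<open>f\<close>; and an edge that became
  redundant through \<open>f\<close> would make \<open>T - {e}\<close> span
  \<open>f\<close>.\<close>

lemma spanning_tree_swap:
  assumes T: "spanning_tree G T" and "e \<in> T" and "f \<in> edges G" and "\<not> spans G (T - {e}) f"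
  shows "spanning_tree G (insert f (T - {e}))"
  unfolding spanning_tree_iff
proof (intro conjI ballI notI)
  note TD = spanning_treeD[OF T]
  have eE: "e \<in> edges G" using TD(1) assms(2) by blast
  have ins: "insert e T = T" using assms(2) by blast
  have e: "spans G (insert f (T - {e})) e"
    using TD(4)[OF assms(3)] assms(3,4) eE
      spans_exchange[of e "T - {e}" f] by (simp add: ins)
  show "insert f (T - {e}) \<subseteq> edges G" using TD(1) assms(3) by blast
  show "joined G (insert f (T - {e})) u v" if "u \<in> verts G" "v \<in> verts G" for u v
    using TD(2)[OF that]
  proof (rule joined_mono)
    show "spans G (insert f (T - {e})) g" if "g \<in> T" for g
      using that e by (cases "g = e") (auto intro: spans_mem)
  qed
  have fT: "f \<notin> T - {e}" using assms(4) spans_mem by metis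
  fix g assume g: "g \<in> insert f (T - {e})" "spans G (insert f (T - {e}) - {g}) g"
  show False
  proof (cases "g = f")
    case True
    then show False using g(2) fT assms(4) by (simp add: Diff_triv)
  next
    case False
    let ?Y = "T - {e} - {g}"
    have gT: "g \<in> T - {e}" using g(1) False by blast
    have "insert f (T - {e}) - {g} = insert f ?Y" using False by blast
    then have "spans G (insert f ?Y) g" using g(2) by simp
    moreover have "\<not> spans G ?Y g"
    proof
      assume "spans G ?Y g"
      then have "spans G (T - {g}) g" by (rule spans_subset) blast
      then show False using TD(3)[of g] gT by simp
    qed
    moreover have "g \<in> edges G" using TD(1) gT by blast
    ultimately have "spans G (insert g ?Y) f"
      using spans_exchange[of f ?Y g] assms(3) by simp
    moreover have "insert g ?Y = T - {e}" using gT by blast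
    ultimately show False using assms(4) by simp
  qed
qed

lemma spanning_tree_inclusion:
  assumes "spanning_tree G T" and "spanning_tree G T'" and "T \<subseteq> T'"
  shows "T = T'"
proof (rule ccontr)
  assume "T \<noteq> T'"
  then obtain e where e: "e \<in> T'" "e \<notin> T" using assms(3) by blast
  have "spans G T e" using spanning_treeD(1)[OF assms(2)] e(1) spanning_treeD(4)[OF assms(1)] by blast
  then have "spans G (T' - {e}) e" using assms(3) e(2) by (auto elim: spans_subset)
  then show False using spanning_treeD(3)[OF assms(2) e(1)] by simp
qed

lemma cut_eq: "cut G T e = {f \<in> edges G. \<not> spans G (T - {e}) f}"
  unfolding cut_def spans_def by auto

text \<open>If \<open>T - {e}\<close> spanned \<open>f\<close> for an edge \<open>e\<close> of the
  cycle other than \<open>f\<close>, then in the rest of the cycle \<open>f\<close> could be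
  replaced and \<open>T - {e}\<close> would span \<open>e\<close>. Conversely, a cycle avoiding
  \<open>e\<close> lies in \<open>insert f (T - {e})\<close> and spans \<open>f\<close> without
  \<open>e\<close>. The equivalence also settles the uniqueness behind \<open>THE\<close> in
  \<open>cyc\<close>.\<close>

lemma fundamental_cycle:
  assumes T: "spanning_tree G T" and f: "f \<in> edges G" "f \<notin> T"
  shows "is_cycle G C \<and> C \<subseteq> insert f T \<longleftrightarrow> C = insert f {e \<in> T. \<not> spans G (T - {e}) f}"
proof -
  note TD = spanning_treeD[OF T]
  have unique: "C = insert f {e \<in> T. \<not> spans G (T - {e}) f}"
    if C: "is_cycle G C" "C \<subseteq> insert f T" for C
  proof -
    have fC: "f \<in> C"
    proof (rule ccontr)
      assume "f \<notin> C"
      then have "C \<subseteq> T" using C(2) by blast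
      then show False using C(1) T by (auto simp: spanning_tree_def)
    qed
    have "\<not> spans G (T - {e}) f" if e: "e \<in> C" "e \<noteq> f" for e
    proof
      assume s: "spans G (T - {e}) f"
      have eT: "e \<in> T" using e C(2) by blast
      have "spans G (C - {e}) e" using cycle_spans[OF C(1) e(1)] .
      then have "spans G (insert f (T - {e})) e"
        by (rule spans_subset) (use C(2) in blast)
      then have "spans G (T - {e}) e"
        unfolding spans_def
      proof (intro allI impI)
        fix u v assume "\<forall>u v. ends G e = {u, v} \<longrightarrow> joined G (insert f (T - {e})) u v"
          and uv: "ends G e = {u, v}"
        then have "joined G (insert f (T - {e})) u v" by blast
        then show "joined G (T - {e}) u v"
          by (rule joined_mono) (use s in \<open>auto intro: spans_mem\<close>)
      qed
      then show False using TD(3)[OF eT] by simp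
    qed
    moreover have "e \<in> C" if e: "e \<in> T" "\<not> spans G (T - {e}) f" for e
    proof (rule ccontr)
      assume "e \<notin> C"
      then have "C - {f} \<subseteq> T - {e}" using C(2) by blast
      then have "spans G (T - {e}) f" using cycle_spans[OF C(1) fC] spans_subset by metis
      then show False using e(2) by simp
    qed
    ultimately show ?thesis using fC C(2) by blast
  qed
  moreover obtain C where "is_cycle G C" "C \<subseteq> insert f T"
    using spans_cycle[OF TD(4)[OF f(1)] TD(1) f] by blast
  ultimately show ?thesis by metis
qed

lemma cyc_eq:
  assumes "spanning_tree G T" and "f \<in> edges G" and "f \<notin> T"
  shows "cyc G T f = insert f {e \<in> T. \<not> spans G (T - {e}) f}"
  unfolding cyc_def fundamental_cycle[OF assms] by simp

section \<open>Activities and the exchange of edges\<close>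

definition live :: "'e rel \<Rightarrow> 'e set \<Rightarrow> 'e \<Rightarrow> bool" where
  "live r T e \<longleftrightarrow> activity G r T e \<in> {internally_active, externally_active}"

lemma live_iff:
  assumes "spanning_tree G T" and "e \<in> edges G" and "linear_order_on (edges G) r"
  shows "e \<in> T \<Longrightarrow> live r T e \<longleftrightarrow> (\<forall>f\<in>edges G. \<not> spans G (T - {e}) f \<longrightarrow> (e, f) \<in> r)"
    and "e \<notin> T \<Longrightarrow> live r T e \<longleftrightarrow> (\<forall>g\<in>T. \<not> spans G (T - {g}) e \<longrightarrow> (e, g) \<in> r)"
proof -
  have "(e, e) \<in> r"
    using assms(2,3) by (auto simp: linear_order_on_def partial_order_on_def preorder_on_def refl_on_def)
  then show "e \<in> T \<Longrightarrow> live r T e \<longleftrightarrow> (\<forall>f\<in>edges G. \<not> spans G (T - {e}) f \<longrightarrow> (e, f) \<in> r)"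
    and "e \<notin> T \<Longrightarrow> live r T e \<longleftrightarrow> (\<forall>g\<in>T. \<not> spans G (T - {g}) e \<longrightarrow> (e, g) \<in> r)"
    using assms(2) spanning_treeD(3)[OF assms(1)]
    by (auto simp: live_def activity_def lowest_def cut_eq cyc_eq[OF assms(1,2)])
qed

text \<open>This links activities to the resolution tree: activity is tested by comparison with
  lower edges, but whether \<open>e\<close> is dead turns out to depend only on the part of
  \<open>T\<close> from \<open>e\<close> upwards.\<close>

lemma dead_iff:
  assumes T: "spanning_tree G T" and e: "e \<in> edges G" and r: "linear_order_on (edges G) r"
  shows "\<not> live r T e \<longleftrightarrow> (\<exists>T'. spanning_tree G T' \<and> (e \<in> T' \<longleftrightarrow> e \<notin> T) \<and>
    (\<forall>f\<in>edges G. (e, f) \<in> r \<longrightarrow> f \<noteq> e \<longrightarrow> (f \<in> T' \<longleftrightarrow> f \<in> T)))" (is "_ \<longleftrightarrow> (\<exists>T'. ?agree T')")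
proof (cases "e \<in> T")
  case True
  note TD = spanning_treeD[OF T]
  show ?thesis
  proof
    assume "\<not> live r T e"
    then obtain f where f: "f \<in> edges G" "\<not> spans G (T - {e}) f" "(e, f) \<notin> r"
      using live_iff(1)[OF T e r True] by blast
    have "f \<notin> T - {e}" using f(2) spans_mem by metis
    moreover have "f \<noteq> e"
      using f(3) e r by (auto simp: linear_order_on_def partial_order_on_def preorder_on_def refl_on_def)
    ultimately have "?agree (insert f (T - {e}))"
      using spanning_tree_swap[OF T True f(1,2)] True f(3) by auto
    then show "\<exists>T'. ?agree T'" ..
  next
    assume "\<exists>T'. ?agree T'"
    then obtain T' where T': "spanning_tree G T'" "e \<notin> T'"
      "\<And>f. f \<in> edges G \<Longrightarrow> (e, f) \<in> r \<Longrightarrow> f \<noteq> e \<Longrightarrow> f \<in> T' \<longleftrightarrow> f \<in> T"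
      using True by blast
    \<comment> \<open>The tree \<open>T'\<close> has to cross the cut of \<open>e\<close>. Since
      \<open>T'\<close> agrees with \<open>T\<close> above \<open>e\<close>, the crossing edge
      cannot be higher than \<open>e\<close>, so \<open>e\<close> is not the lowest edge of its
      cut.\<close>
    have "\<exists>f\<in>T'. \<not> spans G (T - {e}) f"
    proof (rule ccontr)
      assume "\<not> ?thesis"
      then have "joined G (T - {e}) u v" if "u \<in> verts G" "v \<in> verts G" for u v
        using joined_mono[OF spanning_treeD(2)[OF T'(1) that]] by blast
      then have "spans G (T - {e}) e" using ends_edge[OF e] spans_iff by metis
      then show False using TD(3)[OF True] by simp
    qed
    then obtain f where f: "f \<in> T'" "\<not> spans G (T - {e}) f" by blast
    have "f \<notin> T - {e}" using f(2) spans_mem by metis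
    moreover have "f \<in> edges G" using f(1) spanning_treeD(1)[OF T'(1)] by blast
    ultimately show "\<not> live r T e"
      using f T'(2,3) live_iff(1)[OF T e r True] by blast
  qed
next
  case False
  note TD = spanning_treeD[OF T]
  show ?thesis
  proof
    assume "\<not> live r T e"
    then obtain g where g: "g \<in> T" "\<not> spans G (T - {g}) e" "(e, g) \<notin> r"
      using live_iff(2)[OF T e r False] by blast
    then have "?agree (insert e (T - {g}))"
      using spanning_tree_swap[OF T g(1) e g(2)] False by auto
    then show "\<exists>T'. ?agree T'" ..
  next
    assume "\<exists>T'. ?agree T'"
    then obtain T' where T': "spanning_tree G T'" "e \<in> T'"
      "\<And>f. f \<in> edges G \<Longrightarrow> (e, f) \<in> r \<Longrightarrow> f \<noteq> e \<Longrightarrow> f \<in> T' \<longleftrightarrow> f \<in> T"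
      using False by blast
    define C where "C = insert e {g \<in> T. \<not> spans G (T - {g}) e}"
    have C: "is_cycle G C" using fundamental_cycle[OF T e False] C_def by blast
    show "\<not> live r T e"
    proof
      assume "live r T e"
      \<comment> \<open>If \<open>e\<close> were the lowest edge of its cycle, the other edges,
        being higher and in \<open>T\<close>, would lie in \<open>T'\<close> as well, and
        \<open>T'\<close> would contain the whole cycle.\<close>
      then have "C - {e} \<subseteq> T' - {e}"
        using live_iff(2)[OF T e r False] T'(3) TD(1) unfolding C_def by blast
      moreover have "spans G (C - {e}) e" by (rule cycle_spans[OF C]) (simp add: C_def)
      ultimately show False
        using spans_subset spanning_treeD(3)[OF T'(1,2)] by metis
    qed
  qed
qed

text \<open>If exactly one of the two edges lies in \<open>T\<close>, each belongs to the cut or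
  cycle of the other, so both being lowest contradicts antisymmetry. Otherwise one of the two
  spanning trees would properly contain the other.\<close>

lemma live_not_exchangeable:
  assumes T: "spanning_tree G T" and "c \<in> edges G" and "c' \<in> edges G" and "c \<noteq> c'"
    and r: "linear_order_on (edges G) r" and "live r T c" and "live r T c'"
  shows "\<not> spanning_tree G (sym_diff T {c, c'})"
proof
  assume T': "spanning_tree G (sym_diff T {c, c'})"
  have antisym: "antisym r" using r by (simp add: linear_order_on_def partial_order_on_def)
  have swap: False
    if cd: "c \<in> T" "d \<notin> T" "c \<in> edges G" "d \<in> edges G" "live r T c" "live r T d"
      "spanning_tree G (insert d (T - {c}))" for c d
  proof -
    have "\<not> spans G (T - {c}) d"
      using spanning_treeD(3)[OF cd(7), of d] cd(2) by (simp add: insert_absorb)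
    then have "(c, d) \<in> r" "(d, c) \<in> r"
      using live_iff(1)[OF T cd(3) r cd(1)] live_iff(2)[OF T cd(4) r cd(2)] cd by blast+
    then show False using antisym cd(1,2) by (metis antisymD)
  qed
  consider "c \<in> T" "c' \<in> T" | "c \<notin> T" "c' \<notin> T" | "c \<in> T" "c' \<notin> T" | "c \<notin> T" "c' \<in> T" by blast
  then show False
  proof cases
    case 1
    then have "sym_diff T {c, c'} \<subseteq> T" "c \<notin> sym_diff T {c, c'}" by auto
    then show False using spanning_tree_inclusion[OF T' T] 1 by blast
  next
    case 2
    then have "T \<subseteq> sym_diff T {c, c'}" "c \<in> sym_diff T {c, c'}" by auto
    then show False using spanning_tree_inclusion[OF T T'] 2 by blast
  next
    case 3
    then have "sym_diff T {c, c'} = insert c' (T - {c})" by auto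
    then show False using swap[of c c'] 3 assms T' by simp
  next
    case 4
    then have "sym_diff T {c, c'} = insert c (T - {c'})" by auto
    then show False using swap[of c' c] 4 assms T' by simp
  qed
qed

end

section \<open>State circles of the Tait graph\<close>

lemma cyc_list_orbit:
  assumes "cyc_list f L" and "x \<in> set L"
  shows "orbit f x = set L"
proof -
  let ?n = "length L"
  have n: "?n > 0" and s: "\<And>i. Suc i < ?n \<Longrightarrow> f (L ! i) = L ! Suc i" and l: "f (last L) = hd L"
    using assms(1) by (auto simp: cyc_list_def successively_conv_nth)
  have step: "f (L ! i) = L ! (Suc i mod ?n)" if "i < ?n" for i
  proof (cases "Suc i < ?n")
    case False
    then have "i = ?n - 1" using that by simp
    then show ?thesis using l n by (simp add: last_conv_nth hd_conv_nth)
  qed (simp add: s)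
  have pow: "(f ^^ k) (L ! 0) = L ! (k mod ?n)" for k
  proof (induction k)
    case (Suc k)
    then show ?case using step[of "k mod ?n"] n by (simp add: mod_Suc_eq)
  qed (use n in simp)
  have "(f ^^ k) (L ! 0) \<in> set L" for k
    unfolding pow using n by simp
  moreover have "\<exists>k>0. (f ^^ k) (L ! 0) = L ! i" if "i < ?n" for i
    using that n pow by (intro exI[of _ "i + ?n"]) simp
  ultimately have "orbit f (L ! 0) = set L"
    unfolding orbit_altdef set_conv_nth by (auto simp: pow) metis
  then have "cyclic_on f (set L)"
    unfolding cyclic_on_def using n nth_mem by blast
  then show ?thesis using assms(2) by (rule orbit_cyclic_eq3)
qed

lemma cyc_list_exists:
  assumes "permutation f"
  obtains L where "cyc_list f L" and "hd L = x" and "set L = orbit f x"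
proof -
  let ?n = "card (orbit f x)"
  let ?L = "map (\<lambda>n. (f ^^ n) x) [0..<?n]"
  note o = orbit_funpow_card[OF assms, of x]
  have n: "?n > 0"
    using finite_orbit[OF permutation_self_in_orbit[OF assms]] orbit_nonempty
    by (metis card_gt_0_iff)
  obtain m where m: "?n = Suc m" using n by (cases ?n) auto
  have "f (last ?L) = (f ^^ ?n) x" by (simp add: m)
  then have "f (last ?L) = hd ?L"
    using n o(3) by (simp add: hd_map)
  then have "cyc_list f ?L"
    using n o(2) by (auto simp: cyc_list_def successively_conv_nth distinct_map)
  moreover have "hd ?L = x" using n by (simp add: hd_map)
  moreover have "set ?L = orbit f x" using o(1) by simp
  ultimately show thesis using that by blast
qed

lemma successively_tl_mono:
  assumes "successively (\<lambda>x y. f x = y) (w # B)"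
    and "\<And>x. x \<in> set (w # B) \<Longrightarrow> f x \<in> set B \<Longrightarrow> g x = f x"
  shows "successively (\<lambda>x y. g x = y) (w # B)"
  using assms
proof (induction B arbitrary: w)
  case (Cons b B)
  have "g w = b" using Cons.prems by simp
  moreover have "successively (\<lambda>x y. g x = y) (b # B)"
    using Cons.prems by (intro Cons.IH) auto
  ultimately show ?case by simp
qed simp

text \<open>Only the closing steps of the two cycles end at \<open>u\<close> or \<open>v\<close>;
  the transposition redirects each of them to the start of the other cycle.\<close>

lemma cyc_list_merge:
  assumes "cyc_list f (u # A)" and "cyc_list f (v # B)" and "set (u # A) \<inter> set (v # B) = {}"
    and g: "\<And>d. d \<in> set (u # A) \<union> set (v # B) \<Longrightarrow> g d = transpose u v (f d)"
  shows "cyc_list g ((u # A) @ (v # B))"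
proof -
  have A: "successively (\<lambda>x y. f x = y) (u # A)" "f (last (u # A)) = u" "u \<notin> set A"
    and B: "successively (\<lambda>x y. f x = y) (v # B)" "f (last (v # B)) = v" "v \<notin> set B"
    and d: "distinct ((u # A) @ (v # B))"
    using assms(1-3) by (auto simp: cyc_list_def)
  have "successively (\<lambda>x y. g x = y) (u # A)"
    using A(1)
  proof (rule successively_tl_mono)
    show "g x = f x" if "x \<in> set (u # A)" "f x \<in> set A" for x
      using that g[of x] A(3) assms(3) by (auto simp: transpose_def)
  qed
  moreover have "successively (\<lambda>x y. g x = y) (v # B)"
    using B(1)
  proof (rule successively_tl_mono)
    show "g x = f x" if "x \<in> set (v # B)" "f x \<in> set B" for x
      using that g[of x] B(3) assms(3) by (auto simp: transpose_def)
  qed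
  moreover have "g (last (u # A)) = v"
    using g[OF UnI1[OF last_in_set]] A(2) by (simp del: last.simps)
  moreover have "g (last (v # B)) = u"
    using g[OF UnI2[OF last_in_set]] B(2) by (simp del: last.simps)
  ultimately show ?thesis
    unfolding cyc_list_def successively_append_iff using d by (simp del: successively.simps last.simps) simp
qed

text \<open>The chords \<open>uu'\<close> and \<open>vv'\<close> of the circle are linked, so switching both keeps it connected.\<close>

lemma cyc_list_linked:
  assumes "cyc_list f (A @ (u # B) @ (v # C) @ (u' # E) @ (v' # F))"
    and g: "\<And>d. d \<in> set (A @ (u # B) @ (v # C) @ (u' # E) @ (v' # F)) \<Longrightarrow>
      g d = transpose v v' (transpose u u' (f d))"
  shows "cyc_list g (A @ (u' # E) @ (v # C) @ (u # B) @ (v' # F))"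
proof -
  let ?L = "A @ (u # B) @ (v # C) @ (u' # E) @ (v' # F)"
  have dist: "distinct ?L" and suc: "successively (\<lambda>x y. f x = y) ?L" and l: "f (last ?L) = hd ?L"
    using assms(1) by (auto simp: cyc_list_def)
  have ne: "distinct [u, v, u', v']" using dist by auto
  have same: "g d = f d" if "d \<in> set ?L" "f d \<notin> {u, v, u', v'}" for d
    using g[OF that(1)] that(2) by (simp add: transpose_def)
  have blocks: "successively (\<lambda>x y. f x = y) A" "successively (\<lambda>x y. f x = y) (u # B)"
    "successively (\<lambda>x y. f x = y) (v # C)" "successively (\<lambda>x y. f x = y) (u' # E)"
    "successively (\<lambda>x y. f x = y) (v' # F)"
    and joins: "A \<noteq> [] \<Longrightarrow> f (last A) = u" "f (last (u # B)) = v" "f (last (v # C)) = u'"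
      "f (last (u' # E)) = v'"
    using suc unfolding successively_append_iff by (simp_all del: successively.simps last.simps)
  have block: "successively (\<lambda>x y. g x = y) (w # M)"
    if "successively (\<lambda>x y. f x = y) (w # M)" "set (w # M) \<subseteq> set ?L" "set M \<inter> {u, v, u', v'} = {}" for w M
    using that(1) by (rule successively_tl_mono) (use that(2,3) same in blast)
  have disj: "set B \<inter> {u, v, u', v'} = {}" "set C \<inter> {u, v, u', v'} = {}"
    "set E \<inter> {u, v, u', v'} = {}" "set F \<inter> {u, v, u', v'} = {}" "set A \<inter> {u, v, u', v'} = {}"
    using dist by auto
  have gB: "successively (\<lambda>x y. g x = y) (u # B)" using blocks(2) by (rule block) (use disj in auto)
  have gC: "successively (\<lambda>x y. g x = y) (v # C)" using blocks(3) by (rule block) (use disj in auto)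
  have gE: "successively (\<lambda>x y. g x = y) (u' # E)" using blocks(4) by (rule block) (use disj in auto)
  have gF: "successively (\<lambda>x y. g x = y) (v' # F)" using blocks(5) by (rule block) (use disj in auto)
  have gA: "successively (\<lambda>x y. g x = y) A"
    using blocks(1) by (rule successively_mono) (use same disj(5) in auto)
  have mem: "A \<noteq> [] \<Longrightarrow> last A \<in> set ?L" "last (u # B) \<in> set ?L" "last (v # C) \<in> set ?L"
    "last (u' # E) \<in> set ?L" "last (v' # F) \<in> set ?L"
    by auto
  have tr: "transpose v v' (transpose u u' u) = u'" "transpose v v' (transpose u u' v) = v'"
    "transpose v v' (transpose u u' u') = u" "transpose v v' (transpose u u' v') = v"
    using ne by (auto simp: transpose_def)
  have j: "A \<noteq> [] \<Longrightarrow> g (last A) = u'" "g (last (u # B)) = v'" "g (last (v # C)) = u"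
    "g (last (u' # E)) = v"
    using g[OF mem(1)] g[OF mem(2)] g[OF mem(3)] g[OF mem(4)] joins tr
    by (simp_all del: last.simps)
  have lL: "f (last (v' # F)) = hd ?L" using l by simp
  have lF: "g (last (v' # F)) = hd (A @ u' # E)"
  proof (cases A)
    case Nil
    then have "f (last (v' # F)) = u" using lL by (simp del: last.simps)
    then show ?thesis using g[OF mem(5)] tr(1) Nil by (simp del: last.simps)
  next
    case (Cons a A')
    then have "f (last (v' # F)) = a" using lL by (simp del: last.simps)
    moreover have "a \<notin> {u, v, u', v'}" using disj(5) Cons by auto
    ultimately show ?thesis using same[OF mem(5)] Cons by (simp del: last.simps)
  qed
  have "successively (\<lambda>x y. g x = y) (A @ (u' # E) @ (v # C) @ (u # B) @ (v' # F))"
    unfolding successively_append_iff using gA gB gC gE gF j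
    by (auto simp del: successively.simps last.simps simp: hd_append)
  moreover have "distinct (A @ (u' # E) @ (v # C) @ (u # B) @ (v' # F))"
    using dist by auto
  moreover have "last (A @ (u' # E) @ (v # C) @ (u # B) @ (v' # F)) = last (v' # F)"
    "hd (A @ (u' # E) @ (v # C) @ (u # B) @ (v' # F)) = hd (A @ u' # E)"
    by (simp_all add: last_append hd_append)
  ultimately show ?thesis
    unfolding cyc_list_def using lF by simp
qed

text \<open>An invariant of \<open>p\<close> factors through the orbits, so its number of values
  bounds the number of orbits from below. All circle counts below are obtained from suitable
  invariants.\<close>

lemma card_orbit_factor:
  assumes "finite S" and "\<And>d. d \<in> S \<Longrightarrow> p d \<in> S" and "\<And>d. d \<in> S \<Longrightarrow> h (p d) = h d"
  shows "card (h ` S) \<le> card (orbit p ` S)"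
proof -
  have const: "h e = h d \<and> e \<in> S" if "e \<in> orbit p d" "d \<in> S" for d e
    using that by (induction) (auto simp: assms)
  have "h ` S \<subseteq> (\<lambda>C. h (SOME x. x \<in> C)) ` orbit p ` S"
  proof
    fix y assume "y \<in> h ` S"
    then obtain d where d: "d \<in> S" "y = h d" by blast
    have "(SOME x. x \<in> orbit p d) \<in> orbit p d" using orbit.base by (rule someI)
    then have "h (SOME x. x \<in> orbit p d) = y" using const d by blast
    then show "y \<in> (\<lambda>C. h (SOME x. x \<in> C)) ` orbit p ` S" using d(1) by blast
  qed
  then have "card (h ` S) \<le> card ((\<lambda>C. h (SOME x. x \<in> C)) ` orbit p ` S)"
    using assms(1) by (intro card_mono) auto
  also have "\<dots> \<le> card (orbit p ` S)" using assms(1) by (intro card_image_le) auto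
  finally show ?thesis .
qed

lemma card_eq_sum_orbits:
  assumes "f permutes A" and "finite A"
  shows "card A = (\<Sum>v\<in>orbit f ` A. card v)"
proof -
  have p: "permutation f" using assms permutation_permutes by blast
  have U: "\<Union> (orbit f ` A) = A"
    using permutes_orbit_subset[OF assms(1)] permutation_self_in_orbit[OF p] by blast
  have eq: "orbit f y = orbit f x" if "y \<in> orbit f x" for x y
    using orbit_cyclic_eq3[OF cyclic_on_orbit'[OF p] that] .
  have "card (\<Union> (orbit f ` A)) = sum card (orbit f ` A)"
  proof (rule card_Union_disjoint)
    show "pairwise disjnt (orbit f ` A)"
      unfolding pairwise_def disjnt_def using eq by blast
    show "finite B" if "B \<in> orbit f ` A" for B
      using that finite_orbit[OF permutation_self_in_orbit[OF p]] by blast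
  qed
  then show ?thesis using U by simp
qed

section \<open>The circles of a checkerboard-coloured connected diagram\<close>

locale tait =
  fixes D :: "'d diagram" and S :: "'d set"
  assumes diagram: "link_diagram D" and one_piece: "connected_diagram D"
    and checkerboard: "checkerboard D S"
begin

abbreviation G :: "('d set, 'd set) signed_graph" where
  "G \<equiv> tait_graph D S"

abbreviation step :: "'d set set \<Rightarrow> 'd \<Rightarrow> 'd" where
  "step \<equiv> state_step D"

lemma wf: "wf_diagram D"
  using diagram by (simp add: link_diagram_def)

lemma face_eq: "face D = orbit (step {})"
proof -
  have "step {} = inv (rot D) \<circ> arc D" by (simp add: fun_eq_iff state_step_def)
  then show ?thesis by (intro ext) (simp only: face_def)
qed

lemma permutation_step: "permutation (step X)"
  using state_step_permutes[OF wf] wf_diagram_darts(4)[OF wf] permutation_permutes by blast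

lemma face_self [simp]: "d \<in> face D d"
  unfolding face_eq by (rule permutation_self_in_orbit[OF permutation_step])

lemma face_eqI: "e \<in> face D d \<Longrightarrow> face D e = face D d"
  unfolding face_eq by (rule orbit_cyclic_eq3[OF cyclic_on_orbit'[OF permutation_step]])

lemma face_arc: "face D (inv (rot D) (arc D d)) = face D d"
  by (rule face_eqI) (auto simp: face_def intro: orbit_eqI)

text \<open>Around a vertex, \<open>d\<close> and \<open>arc D (rot D d)\<close> lie on the same
  face, while \<open>arc\<close> changes the colour; hence \<open>rot\<close> changes it
  too.\<close>

lemma alternating: "alternating D S"
  unfolding alternating_def
proof (intro conjI ballI wf)
  show "S \<subseteq> darts D" using checkerboard by (simp add: checkerboard_def)
  have ch: "e \<in> S \<longleftrightarrow> d \<in> S" if "d \<in> darts D" "e \<in> face D d" for d e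
    using checkerboard[unfolded checkerboard_def, THEN conjunct2, THEN conjunct1] that by blast
  have arc_S: "arc D d \<in> S \<longleftrightarrow> d \<notin> S" if "d \<in> darts D" for d
    using checkerboard[unfolded checkerboard_def, THEN conjunct2, THEN conjunct2] that by blast
  fix d assume d: "d \<in> darts D"
  show "arc D d \<in> S \<longleftrightarrow> d \<notin> S" using arc_S d .
  have rd: "rot D d \<in> darts D" "arc D (rot D d) \<in> darts D"
    using d wf_diagram_darts[OF wf] by blast+
  have "face D d = face D (arc D (rot D d))"
    using face_arc[of "arc D (rot D d)"] wf by simp
  then have "d \<in> face D (arc D (rot D d))" using face_self by metis
  then have "d \<in> S \<longleftrightarrow> arc D (rot D d) \<in> S"
    using ch rd(2) by blast
  then show "rot D d \<in> S \<longleftrightarrow> d \<notin> S"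
    using arc_S[OF rd(1)] by blast
qed

lemma step_in: "d \<in> S \<Longrightarrow> step X d \<in> S"
  by (rule state_step_in[OF alternating])

lemma orbit_step_subset: "d \<in> S \<Longrightarrow> orbit (step X) d \<subseteq> S"
proof
  fix e assume "e \<in> orbit (step X) d" "d \<in> S"
  then show "e \<in> S" by induction (auto intro: step_in)
qed

lemma verts_G: "verts G = face D ` S"
proof -
  have "face D d \<subseteq> S" if "d \<in> S" for d
    using orbit_step_subset[OF that] by (simp add: face_eq)
  moreover have "d \<in> S" if "face D d \<subseteq> S" for d
    using that face_self by blast
  ultimately show ?thesis
    using alternatingD(2)[OF alternating] by (auto simp: tait_graph_def faces_def)
qed

lemma edges_G [simp]: "edges G = crossings D"
  by (simp add: tait_graph_def)

lemma ends_G: "ends G c = face D ` (c \<inter> S)"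
  by (simp add: tait_graph_def)

lemma crossing_shaded:
  assumes "c \<in> crossings D"
  obtains u u' where "u \<noteq> u'" and "c \<inter> S = {u, u'}" and "u \<in> S" and "u' \<in> S"
proof -
  have "c \<noteq> {}" using assms by (auto simp: crossings_def)
  then obtain d where d: "d \<in> c" by blast
  have "d \<in> S \<or> rot D d \<in> S"
    using alternatingD(5)[OF alternating crossing_vertex(2)[OF wf assms d]] by blast
  then obtain u where u: "u \<in> c" "u \<in> S" using d rot_in_crossing(1)[OF wf assms] by blast
  show thesis
    using crossing_Int_alternating[OF alternating assms u] u(2) that[of u "rot D (rot D u)"] by metis
qed

lemma crossing_shaded_eq:
  assumes "c \<in> crossings D" and "u \<in> c \<inter> S" and "u' \<in> c \<inter> S" and "u \<noteq> u'"
  shows "c \<inter> S = {u, u'}"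
proof -
  obtain v v' where "v \<noteq> v'" "c \<inter> S = {v, v'}" "v \<in> S" "v' \<in> S"
    by (rule crossing_shaded[OF assms(1)])
  then show ?thesis using assms(2-4) by auto
qed

sublocale multigraph G
proof
  show "finite (edges G)" using finite_crossings(1)[OF wf] by simp
  show "\<exists>u\<in>verts G. \<exists>v\<in>verts G. ends G c = {u, v}" if "c \<in> edges G" for c
  proof -
    have c: "c \<in> crossings D" using that by simp
    obtain u u' where "u \<noteq> u'" "c \<inter> S = {u, u'}" "u \<in> S" "u' \<in> S"
      by (rule crossing_shaded[OF c])
    then have "ends G c = {face D u, face D u'}" "face D u \<in> verts G" "face D u' \<in> verts G"
      by (simp_all add: ends_G verts_G)
    then show ?thesis by (intro bexI)
  qed
qed

text \<open>A walk that arrives at \<open>c\<close> can leave along the two neighbours of its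
  unshaded dart. These are the two shaded darts of \<open>c\<close>, and the switch exchanges
  them.\<close>

lemma step_toggle:
  assumes c: "c \<in> crossings D" "c \<inter> S = {u, u'}" and d: "d \<in> S"
  shows "step (sym_diff X {c}) d = transpose u u' (step X d)"
proof -
  let ?e = "arc D d"
  have e: "?e \<in> darts D" "?e \<notin> S" "d \<in> darts D"
    using d alternatingD(2,4)[OF alternating] wf_diagram_darts(2)[OF wf] by blast+
  show ?thesis
  proof (cases "vertex D ?e = c")
    case True
    then have ec: "?e \<in> c" using vertex_self[OF wf, of ?e] by simp
    have "rot D ?e \<in> S" "inv (rot D) ?e \<in> S"
      using e alternatingD(5,6)[OF alternating] by blast+
    moreover have "rot D ?e \<in> c" "inv (rot D) ?e \<in> c" using rot_in_crossing[OF wf c(1)] ec by blast+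
    moreover have "rot D ?e \<noteq> inv (rot D) ?e"
      using crossing_cases(2,4)[OF wf c(1) ec] by auto
    ultimately have "c \<inter> S = {rot D ?e, inv (rot D) ?e}"
      by (intro crossing_shaded_eq[OF c(1)]) simp_all
    then have "rot D ?e = u \<and> inv (rot D) ?e = u' \<or> rot D ?e = u' \<and> inv (rot D) ?e = u"
      using c(2) by (metis doubleton_eq_iff)
    then show ?thesis using True by (auto simp: state_step_def)
  next
    case False
    have "step X d \<notin> c"
    proof
      assume "step X d \<in> c"
      then have "vertex D (step X d) = c" using crossing_vertex(1)[OF wf c(1)] by blast
      then show False using False vertex_state_step[OF wf] by metis
    qed
    then have "step X d \<noteq> u" "step X d \<noteq> u'" using c(2) by auto
    moreover have "step (sym_diff X {c}) d = step X d" using False by (simp add: state_step_def)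
    ultimately show ?thesis by simp
  qed
qed

definition circles :: "'d set set \<Rightarrow> nat" where
  "circles X = card (orbit (step X) ` S)"

text \<open>Identifying the circles through \<open>u\<close> and \<open>u'\<close> yields an
  invariant of the switched walk and loses at most one value.\<close>

lemma circles_toggle:
  assumes c: "c \<in> crossings D"
  shows "circles X \<le> circles (sym_diff X {c}) + 1"
proof -
  obtain u u' where "u \<noteq> u'" and u: "c \<inter> S = {u, u'}" "u \<in> S" "u' \<in> S"
    by (rule crossing_shaded[OF c])
  let ?o = "orbit (step X)"
  define h where "h d = (if ?o d = ?o u then ?o u' else ?o d)" for d
  have fin: "finite S" by (rule alternatingD(3)[OF alternating])
  have os: "?o (step X d) = ?o d" for d
    by (rule permutation_orbit_step[OF permutation_step])
  have "card (h ` S) \<le> circles (sym_diff X {c})"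
    unfolding circles_def
  proof (rule card_orbit_factor[OF fin step_in])
    fix d assume d: "d \<in> S"
    have "h (transpose u u' e) = h e" for e
      by (auto simp: h_def transpose_def)
    moreover have "h (step X d) = h d" by (simp add: h_def os)
    ultimately show "h (step (sym_diff X {c}) d) = h d"
      using step_toggle[OF c u(1) d] by simp
  qed
  moreover have "card (?o ` S) \<le> card (insert (?o u) (h ` S))"
    using fin by (intro card_mono) (auto simp: h_def)
  moreover have "card (insert (?o u) (h ` S)) \<le> card (h ` S) + 1"
    using fin by (simp add: card_insert_if)
  ultimately show ?thesis unfolding circles_def by linarith
qed

lemma circles_bound:
  assumes "finite Z" and "Z \<subseteq> crossings D"
  shows "circles X \<le> circles (sym_diff X Z) + card Z"
  using assms
proof (induction Z)
  case (insert c Z)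
  have "sym_diff (sym_diff X Z) {c} = sym_diff X (insert c Z)" using insert.hyps by auto
  then show ?case using insert circles_toggle[of c "sym_diff X Z"] by simp
qed simp

lemma circles_empty: "circles {} = card (verts G)"
  by (simp add: circles_def verts_G face_eq)

text \<open>Resolving every crossing the other way yields the boundaries of the unshaded regions; their
  number is governed by Euler's formula.\<close>

lemma circles_crossings: "card (crossings D) + 2 \<le> card (verts G) + circles (crossings D)"
proof -
  note fin = wf_diagram_darts(4)[OF wf]
  have rp: "rot D permutes darts D" and ap: "arc D permutes darts D"
    using wf by (simp_all add: wf_diagram_def)
  have finV: "finite (vertices D)" using fin by (simp add: vertices_def)
  define B where "B = {v \<in> vertices D. card v = 2}"
  have split: "vertices D = crossings D \<union> B" "crossings D \<inter> B = {}"
    using wf by (auto simp: B_def crossings_def wf_diagram_def)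
  have finB: "finite B" using finV by (simp add: B_def)
  have "card (darts D) = (\<Sum>v\<in>vertices D. card v)"
    using card_eq_sum_orbits[OF rp fin] by (simp add: vertices_def)
  also have "\<dots> = (\<Sum>v\<in>crossings D. card v) + (\<Sum>v\<in>B. card v)"
    unfolding split(1) using finite_crossings(1)[OF wf] finB split(2) by (rule sum.union_disjoint)
  also have "\<dots> = 4 * card (crossings D) + 2 * card B"
    by (simp add: crossings_def B_def)
  finally have darts: "card (darts D) = 4 * card (crossings D) + 2 * card B" .
  have arc2: "card v = 2" if v: "v \<in> arcs D" for v
  proof -
    obtain d where d: "d \<in> darts D" "v = orbit (arc D) d" using v by (auto simp: arcs_def)
    have "arc D (arc D d) = d" "arc D d \<noteq> d" using d wf by (simp_all add: wf_diagram_def)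
    moreover have "v = {(arc D ^^ m) d |m. m < 2}"
      unfolding d(2) using calculation by (intro orbit_altdef_bounded) (simp_all add: numeral_2_eq_2)
    moreover have "{(arc D ^^ m) d |m. m < 2} = {d, arc D d}"
      by (auto simp: less_2_cases_iff intro: exI[of _ 0] exI[of _ "Suc 0"])
    ultimately show ?thesis by simp
  qed
  have "card (darts D) = (\<Sum>v\<in>arcs D. card v)"
    using card_eq_sum_orbits[OF ap fin] by (simp add: arcs_def)
  then have arcs: "card (darts D) = 2 * card (arcs D)" using arc2 by simp
  have "card (vertices D) = card (crossings D) + card B"
    unfolding split(1) using finite_crossings(1)[OF wf] finB split(2) by (rule card_Un_disjoint)
  \<comment> \<open>With c crossings and b points of valency 2 there are c + b vertices and 2c + b
    edges; the Euler characteristic of the one sphere is 2.\<close>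
  then have faces: "card (faces D) = card (crossings D) + 2"
    using darts arcs diagram one_piece by (simp add: link_diagram_def planar_def connected_diagram_def)
  have "faces D = face D ` S \<union> face D ` (darts D - S)"
    using alternatingD(2)[OF alternating] by (auto simp: faces_def)
  then have "card (faces D) \<le> card (verts G) + card (face D ` (darts D - S))"
    unfolding verts_G by (metis card_Un_le)
  moreover have "face D ` (darts D - S) \<subseteq> (\<lambda>d. face D (arc D d)) ` S"
  proof
    fix F assume "F \<in> face D ` (darts D - S)"
    then obtain d where d: "d \<in> darts D" "d \<notin> S" "F = face D d" by blast
    then have "arc D d \<in> S" "arc D (arc D d) = d"
      using alternatingD(4)[OF alternating] wf by simp_all
    then show "F \<in> (\<lambda>d. face D (arc D d)) ` S" using d(3) by force
  qed
  then have "card (face D ` (darts D - S)) \<le> card ((\<lambda>d. face D (arc D d)) ` S)"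
    using alternatingD(3)[OF alternating] by (intro card_mono) auto
  \<comment> \<open>A walk that always turns right stays along the unshaded region on its right,
    which is the face of \<open>arc D d\<close>. This region is therefore an invariant of the full
    state.\<close>
  moreover have "card ((\<lambda>d. face D (arc D d)) ` S) \<le> circles (crossings D)"
    unfolding circles_def
  proof (rule card_orbit_factor[OF alternatingD(3)[OF alternating] step_in])
    fix d assume "d \<in> S"
    then have d: "arc D d \<in> darts D"
      using alternatingD(2)[OF alternating] wf_diagram_darts(2)[OF wf] by blast
    have "step (crossings D) d = rot D (arc D d)"
      using bivalent_cases(4)[OF wf d] by (simp add: state_step_def)
    then show "face D (arc D (step (crossings D) d)) = face D (arc D d)"
      using face_arc[of "arc D (rot D (arc D d))"] wf by simp
  qed
  ultimately show ?thesis using faces by linarith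
qed

text \<open>The bound from the empty state says that \<open>X\<close> has at least V - 1 elements, V
  being the number of shaded regions, and the bound from the full state that it has at most that
  many.\<close>

lemma card_single_circle:
  assumes "X \<subseteq> crossings D" and "circles X = 1"
  shows "card X + 1 = card (verts G)"
proof -
  have fin: "finite X" using assms(1) finite_crossings(1)[OF wf] by (rule finite_subset)
  have "circles {} \<le> circles X + card X"
    using circles_bound[OF fin assms(1), of "{}"] by simp
  moreover have "circles (crossings D) \<le> circles X + card (crossings D - X)"
  proof -
    have *: "sym_diff (crossings D) (crossings D - X) = X" using assms(1) by blast
    have "finite (crossings D - X)" using finite_crossings(1)[OF wf] by simp
    from circles_bound[OF this Diff_subset, of "crossings D"] show ?thesis by (simp only: *)
  qed
  moreover have "card (crossings D - X) + card X = card (crossings D)"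
    using card_Diff_subset[OF fin assms(1)] card_mono[OF finite_crossings(1)[OF wf] assms(1)] by simp
  ultimately show ?thesis
    using assms(2) circles_crossings circles_empty by linarith
qed

text \<open>After a left turn the walk is still on the boundary of the same shaded region; after a
  right turn it has passed to the region at the other end of an edge of \<open>X\<close>.\<close>

lemma circle_joined:
  assumes "X \<subseteq> crossings D" and "d \<in> S" and "e \<in> orbit (step X) d"
  shows "joined G X (face D d) (face D e)"
proof -
  have one: "joined G X (face D e) (face D (step X e))" if e: "e \<in> S" for e
  proof (cases "vertex D (arc D e) \<in> X")
    case False
    then show ?thesis using face_arc[of e] by (simp add: state_step_def)
  next
    case True
    let ?a = "arc D e"
    have c: "vertex D ?a \<in> crossings D" using True assms(1) by blast
    have a: "?a \<in> darts D" "?a \<notin> S"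
      using e alternatingD(2,4)[OF alternating] wf_diagram_darts(2)[OF wf] by blast+
    have u: "inv (rot D) ?a \<in> vertex D ?a" "inv (rot D) ?a \<in> S"
      using rot_in_crossing(2)[OF wf c] alternatingD(6)[OF alternating a(1)] a(2) vertex_self[OF wf]
      by blast+
    have "vertex D ?a \<inter> S = {inv (rot D) ?a, rot D ?a}"
      using crossing_Int_alternating(1)[OF alternating c u] wf by simp
    then have "ends G (vertex D ?a) = {face D e, face D (rot D ?a)}"
      by (simp add: ends_G face_arc)
    then show ?thesis using True joined_edge by (metis state_step_def)
  qed
  have "joined G X (face D d) (face D e) \<and> e \<in> S"
    using assms(3,2)
  proof (induction)
    case base
    then show ?case using one step_in by blast
  next
    case (step y)
    then show ?case using one step_in joined_trans by metis
  qed
  then show ?thesis ..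
qed

text \<open>By induction on the forest, each component is surrounded by a single circle: a new edge
  connects two components, and its switch merges their two circles.\<close>

lemma forest_circles:
  assumes "finite Y" and "Y \<subseteq> crossings D" and "\<And>c. c \<in> Y \<Longrightarrow> \<not> spans G (Y - {c}) c"
    and "d \<in> S" and "d' \<in> S" and "joined G Y (face D d) (face D d')"
  shows "orbit (step Y) d = orbit (step Y) d'"
  using assms
proof (induction arbitrary: d d')
  case empty
  have "u = v" if "joined G {} u v" for u v
    using that unfolding joined_def by (induction rule: rtranclp_induct) auto
  then have "face D d = face D d'" using empty.prems(5) .
  then show ?case by (simp add: face_eq)
next
  case (insert c Y)
  let ?o = "orbit (step Y)" and ?o' = "orbit (step (insert c Y))"
  have c: "c \<in> crossings D" using insert.prems(1) by blast
  have forest: "\<not> spans G (Y - {e}) e" if "e \<in> Y" for e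
    using insert.prems(2)[of e] that spans_subset[of G "Y - {e}" e "insert c Y - {e}"] by blast
  have IH: "?o d = ?o d'" if "d \<in> S" "d' \<in> S" "joined G Y (face D d) (face D d')" for d d'
    using insert.IH insert.prems(1) forest that by blast
  obtain u u' where u: "u \<noteq> u'" "c \<inter> S = {u, u'}" "u \<in> S" "u' \<in> S"
    by (rule crossing_shaded[OF c])
  have ends: "ends G c = {face D u, face D u'}" by (simp add: ends_G u(2))
  have "\<not> spans G Y c" using insert.prems(2)[of c] insert.hyps(2) by simp
  then have nj: "\<not> joined G Y (face D u) (face D u')" by (simp add: spans_iff[OF ends])
  have self: "x \<in> ?o x" for x by (rule permutation_self_in_orbit[OF permutation_step])
  have oeq: "?o y = ?o x" if "y \<in> ?o x" for x y
    using orbit_cyclic_eq3[OF cyclic_on_orbit'[OF permutation_step] that] .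
  \<comment> \<open>On a common circle the two ends of \<open>c\<close> would already be joined by
    \<open>Y\<close>, so \<open>c\<close> would close a cycle.\<close>
  have disj: "?o u \<inter> ?o u' = {}"
  proof (rule ccontr)
    assume "?o u \<inter> ?o u' \<noteq> {}"
    then have "?o u = ?o u'" using oeq by blast
    then have "u' \<in> ?o u" using self by blast
    then show False using circle_joined[of Y u u'] insert.prems(1) u(3) nj by blast
  qed
  have tog: "step (insert c Y) x = transpose u u' (step Y x)" if "x \<in> S" for x
  proof -
    have "sym_diff Y {c} = insert c Y" using insert.hyps(2) by blast
    then show ?thesis using step_toggle[OF c u(2) that, of Y] by simp
  qed
  obtain A where A: "cyc_list (step Y) A" "hd A = u" "set A = ?o u"
    using cyc_list_exists[OF permutation_step] by blast
  obtain B where B: "cyc_list (step Y) B" "hd B = u'" "set B = ?o u'"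
    using cyc_list_exists[OF permutation_step] by blast
  obtain A' B' where AB: "A = u # A'" "B = u' # B'"
    using A B by (metis cyc_list_def list.collapse)
  have "cyc_list (step (insert c Y)) ((u # A') @ (u' # B'))"
  proof (rule cyc_list_merge)
    show "cyc_list (step Y) (u # A')" "cyc_list (step Y) (u' # B')" using A(1) B(1) AB by simp_all
    show "set (u # A') \<inter> set (u' # B') = {}" using A(3) B(3) AB disj by simp
    fix x assume "x \<in> set (u # A') \<union> set (u' # B')"
    then have "x \<in> S" using A(3) B(3) AB orbit_step_subset u(3,4) by blast
    then show "step (insert c Y) x = transpose u u' (step Y x)" by (rule tog)
  qed
  then have AB': "cyc_list (step (insert c Y)) (A @ B)" unfolding AB .
  have merged: "?o' x = ?o u \<union> ?o u'" if x: "x \<in> ?o u \<union> ?o u'" for x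
  proof -
    have "x \<in> set (A @ B)" using x unfolding set_append A(3) B(3) .
    from cyc_list_orbit[OF AB' this] show ?thesis unfolding set_append A(3) B(3) .
  qed
  \<comment> \<open>A circle through neither \<open>u\<close> nor \<open>u'\<close> is not affected
    by the transposition.\<close>
  have other: "?o' x = ?o x" if x: "x \<in> S" "x \<notin> ?o u \<union> ?o u'" for x
  proof (rule orbit_cong[OF self])
    fix s assume s: "s \<in> ?o x"
    then have "s \<in> S" using orbit_step_subset x(1) by blast
    moreover have "step Y s \<in> ?o x" using s by (rule orbit.step)
    then have "step Y s \<noteq> u" "step Y s \<noteq> u'" using oeq self x(2) by blast+
    ultimately show "step (insert c Y) s = step Y s" using tog by simp
  qed
  have coarser: "?o' d = ?o' d'" if d: "d \<in> S" "d' \<in> S" "joined G Y (face D d) (face D d')" for d d'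
  proof -
    have *: "?o d = ?o d'" using IH[OF d] .
    then have "d \<in> ?o u \<union> ?o u' \<longleftrightarrow> d' \<in> ?o u \<union> ?o u'"
      using oeq self by blast
    then show ?thesis using merged other d * by metis
  qed
  have uu': "?o' u = ?o' u'" using merged self by blast
  from joined_insert[OF insert.prems(5) ends] show ?case
    using coarser[of d d'] coarser[of d u] coarser[of u' d'] coarser[of d u'] coarser[of u d']
      insert.prems(3,4) u(3,4) uu' by metis
qed

lemma spanning_tree_circle:
  assumes T: "spanning_tree G T" and "d \<in> S"
  shows "orbit (step T) d = S"
proof
  show "orbit (step T) d \<subseteq> S" using assms(2) by (rule orbit_step_subset)
  show "S \<subseteq> orbit (step T) d"
  proof
    fix e assume e: "e \<in> S"
    have "joined G T (face D d) (face D e)"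
      using assms(2) e by (intro spanning_treeD(2)[OF T]) (auto simp: verts_G)
    then have "orbit (step T) d = orbit (step T) e"
      using spanning_treeD(1,3,5)[OF T] assms(2) e by (intro forest_circles) auto
    then show "e \<in> orbit (step T) d"
      using permutation_self_in_orbit[OF permutation_step] by metis
  qed
qed

lemma shaded_nonempty: "S \<noteq> {}"
proof -
  have "pieces D \<noteq> {}" using one_piece by (auto simp: connected_diagram_def)
  then obtain d where "d \<in> darts D" by (auto simp: pieces_def)
  then show ?thesis using alternatingD(4)[OF alternating] by blast
qed

lemma card_spanning_tree:
  assumes "spanning_tree G T"
  shows "card T + 1 = card (verts G)"
proof (rule card_single_circle)
  show "T \<subseteq> crossings D" using spanning_treeD(1)[OF assms] by simp
  have "orbit (step T) ` S = {S}" using spanning_tree_circle[OF assms] shaded_nonempty by auto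
  then show "circles T = 1" by (simp add: circles_def)
qed

text \<open>The circle meets all shaded regions, so \<open>X\<close> is connected and contains a
  spanning tree; as both have one element less than there are regions, they are equal.\<close>

lemma single_circle_spanning_tree:
  assumes "X \<subseteq> crossings D" and "d \<in> S" and "orbit (step X) d = S"
  shows "spanning_tree G X"
proof -
  have orb: "orbit (step X) e = S" if "e \<in> S" for e
    using orbit_cyclic_eq3[OF cyclic_on_orbit'[OF permutation_step], of e X d] that assms(3) by simp
  have "joined G X u v" if uv: "u \<in> verts G" "v \<in> verts G" for u v
  proof -
    obtain d e where de: "d \<in> S" "e \<in> S" "u = face D d" "v = face D e"
      using uv by (auto simp: verts_G)
    then show ?thesis using circle_joined[OF assms(1) de(1), of e] orb by simp
  qed
  then obtain T where T: "T \<subseteq> X" "spanning_tree G T"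
    using connected_contains_spanning_tree[of X] assms(1) by auto
  have "orbit (step X) ` S = {S}" using orb assms(2) by auto
  then have "card X + 1 = card (verts G)"
    by (intro card_single_circle[OF assms(1)]) (simp add: circles_def)
  then have "card X = card T" using card_spanning_tree[OF T(2)] by simp
  then have "T = X"
    using T(1) assms(1) finite_crossings(1)[OF wf] by (metis card_subset_eq finite_subset)
  then show ?thesis using T(2) by simp
qed

text \<open>Connectedness of the diagram is a statement about darts and must be transferred to
  shaded regions.\<close>

lemma exists_spanning_tree: "\<exists>T. spanning_tree G T"
proof -
  \<comment> \<open>The shaded one of the two regions along the edge of \<open>d\<close>. It stays
    the same along the edge and across a shaded corner or a 2-valent point; across an unshaded
    corner of a crossing it moves to the other end of that edge of the Tait graph.\<close>
  define sf where "sf d = (if d \<in> S then face D d else face D (arc D d))" for d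
  have step: "joined G (crossings D) (sf x) (sf y)" if xy: "dart_step D x y" for x y
  proof -
    have x: "x \<in> darts D" and y: "y = arc D x \<or> y = rot D x"
      using xy by (auto simp: dart_step_def)
    note alt = alternatingD(4,5)[OF alternating x]
    show ?thesis
    proof (cases "y = arc D x")
      case True
      then have "sf x = sf y" using alt(1) wf by (simp add: sf_def)
      then show ?thesis by simp
    next
      case False
      then have y: "y = rot D x" using y by simp
      show ?thesis
      proof (cases "x \<in> S")
        case True
        then have "sf y = face D x"
          using y alt(2) face_arc[of "arc D (rot D x)"] wf by (simp add: sf_def)
        then show ?thesis using True by (simp add: sf_def)
      next
        case nS: False
        then have sx: "sf x = face D (inv (rot D) x)" and sy: "sf y = face D (rot D x)"
          using y alt face_arc[of "arc D x"] wf by (simp_all add: sf_def)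
        show ?thesis
        proof (cases "vertex D x \<in> crossings D")
          case True
          have "inv (rot D) x \<in> S" using nS alternatingD(6)[OF alternating x] by simp
          moreover have "inv (rot D) x \<in> vertex D x"
            using rot_in_crossing(2)[OF wf True] vertex_self[OF wf] by blast
          ultimately have "vertex D x \<inter> S = {inv (rot D) x, rot D x}"
            using crossing_Int_alternating(1)[OF alternating True] wf by fastforce
          then have "ends G (vertex D x) = {sf x, sf y}" by (simp add: ends_G sx sy)
          then show ?thesis using True joined_edge by metis
        next
          case False
          then show ?thesis using sx sy bivalent_cases(4)[OF wf x] by simp
        qed
      qed
    qed
  qed
  have eq: "joined G (crossings D) (sf x) (sf y)" if "equivclp (dart_step D) x y" for x y
    using that
  proof (induction rule: equivclp_induct)
    case (step y z)
    then show ?case using \<open>\<And>x y. dart_step D x y \<Longrightarrow> _\<close> joined_sym joined_trans by metis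
  qed simp
  obtain P where P: "pieces D = {P}" using one_piece by (auto simp: connected_diagram_def card_1_singleton_iff)
  have "joined G (crossings D) (face D d) (face D e)" if de: "d \<in> S" "e \<in> S" for d e
  proof -
    have "d \<in> darts D" "e \<in> darts D" using de alternatingD(2)[OF alternating] by blast+
    then have "{y. equivclp (dart_step D) d y} \<in> pieces D" "{y. equivclp (dart_step D) e y} \<in> pieces D"
      by (simp_all add: pieces_def)
    then have "{y. equivclp (dart_step D) d y} = P" "{y. equivclp (dart_step D) e y} = P"
      by (simp_all add: P)
    then have "equivclp (dart_step D) d e" by (metis equivclp_refl mem_Collect_eq)
    then show ?thesis using eq[of d e] de by (simp add: sf_def)
  qed
  then have "joined G (crossings D) u v" if "u \<in> verts G" "v \<in> verts G" for u v
    using that unfolding verts_G by blast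
  then show ?thesis using connected_contains_spanning_tree[of "crossings D"] by auto
qed

text \<open>The two switches compose the walk with transpositions of two alternating pairs. The
  resulting walk traverses the arcs of the circle in a new order but still as one circle, and single
  circles are spanning trees.\<close>

lemma linked_exchange:
  assumes T: "spanning_tree G T" and L: "cyc_list (step T) L" "set L = S"
    and s: "subseq [u, v, u', v'] L" and c: "c \<in> crossings D" "c' \<in> crossings D" "c \<noteq> c'"
    and uv: "vertex D u = c" "vertex D u' = c" "vertex D v = c'" "vertex D v' = c'"
  shows "spanning_tree G (sym_diff T {c, c'})"
proof -
  obtain A L1 where 1: "L = A @ u # L1" "subseq [v, u', v'] L1" using list_emb_ConsD[OF s] by auto
  obtain B L2 where 2: "L1 = B @ v # L2" "subseq [u', v'] L2" using list_emb_ConsD[OF 1(2)] by auto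
  obtain C L3 where 3: "L2 = C @ u' # L3" "subseq [v'] L3" using list_emb_ConsD[OF 2(2)] by auto
  obtain E F where 4: "L3 = E @ v' # F" using list_emb_ConsD[OF 3(2)] by auto
  have L': "L = A @ (u # B) @ (v # C) @ (u' # E) @ (v' # F)" using 1 2 3 4 by simp
  have mem: "{u, v, u', v'} \<subseteq> S" using L(2) L' by auto
  have dist: "u \<noteq> u'" "v \<noteq> v'" using L(1) unfolding cyc_list_def L' by auto
  have "u \<in> c" "u' \<in> c" "v \<in> c'" "v' \<in> c'" using uv vertex_self[OF wf] by blast+
  then have "{u, u'} \<subseteq> c \<inter> S" "{v, v'} \<subseteq> c' \<inter> S" using mem by auto
  then have int: "c \<inter> S = {u, u'}" "c' \<inter> S = {v, v'}"
    using crossing_shaded_eq[OF c(1)] crossing_shaded_eq[OF c(2)] dist by simp_all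
  let ?T = "sym_diff T {c, c'}"
  have "?T = sym_diff (sym_diff T {c}) {c'}" using c(3) by auto
  then have tog: "step ?T d = transpose v v' (transpose u u' (step T d))" if "d \<in> S" for d
    using step_toggle[OF c(2) int(2) that, of "sym_diff T {c}"] step_toggle[OF c(1) int(1) that, of T] by simp
  have "cyc_list (step ?T) (A @ (u' # E) @ (v # C) @ (u # B) @ (v' # F))"
    using L(1)[unfolded L'] by (rule cyc_list_linked) (use tog L(2) L' in auto)
  then have "orbit (step ?T) u = set (A @ (u' # E) @ (v # C) @ (u # B) @ (v' # F))"
    by (rule cyc_list_orbit) simp
  also have "\<dots> = S" using L(2) unfolding L' by auto
  finally show ?thesis
    using spanning_treeD(1)[OF T] c(1,2) mem by (intro single_circle_spanning_tree[of _ u]) auto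
qed

end

section \<open>Partial smoothings\<close>

lemma smooth_simps [simp]:
  "darts (smooth D \<sigma>) = darts D" "arc (smooth D \<sigma>) = arc D"
  "over (smooth D \<sigma>) = over D - \<Union> (dom \<sigma>)"
  by (simp_all add: smooth_def)

lemma rot_smooth:
  "rot (smooth D \<sigma>) d = (case \<sigma> (vertex D d) of None \<Rightarrow> rot D d
     | Some s \<Rightarrow> if d \<in> over D \<longleftrightarrow> s = A_smoothing then inv (rot D) d else rot D d)"
  by (auto simp: smooth_def split: option.split smoothing.split)

lemma smooth_vertex_None:
  assumes wf: "wf_diagram D" and "\<sigma> (vertex D d) = None"
  shows "vertex (smooth D \<sigma>) d = vertex D d"
  using wf
proof (rule vertex_cong)
  fix e assume "e \<in> vertex D d"
  then show "rot (smooth D \<sigma>) e = rot D e"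
    using vertex_eqI[OF wf] assms(2) by (simp add: rot_smooth)
qed

text \<open>Adjacent darts of a crossing belong to different strands, so a dart and the neighbour to
  which it is joined turn in opposite senses and are mapped to each other.\<close>

lemma rot_smooth_Some:
  assumes wf: "wf_diagram D" and dom: "dom \<sigma> \<subseteq> crossings D" and s: "\<sigma> (vertex D d) = Some s"
  shows "rot (smooth D \<sigma>) d \<in> vertex D d" and "rot (smooth D \<sigma>) (rot (smooth D \<sigma>) d) = d"
    and "rot (smooth D \<sigma>) d \<noteq> d" and "vertex (smooth D \<sigma>) d = {d, rot (smooth D \<sigma>) d}"
proof -
  let ?r = "rot (smooth D \<sigma>)"
  have c: "vertex D d \<in> crossings D" using dom s by blast
  have d: "d \<in> vertex D d" using wf by simp
  have r: "?r d = (if d \<in> over D \<longleftrightarrow> s = A_smoothing then inv (rot D) d else rot D d)"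
    using s by (simp add: rot_smooth)
  show in_c: "?r d \<in> vertex D d"
    using rot_in_crossing[OF wf c] d by (simp add: r)
  have "\<sigma> (vertex D (?r d)) = Some s" using s vertex_eqI[OF wf in_c] by simp
  then have rr: "?r (?r d) = (if ?r d \<in> over D \<longleftrightarrow> s = A_smoothing then inv (rot D) (?r d) else rot D (?r d))"
    by (simp add: rot_smooth)
  show *: "?r (?r d) = d"
    unfolding rr using r over_alternates[OF wf c d] wf by simp
  have "rot D d \<noteq> d" "inv (rot D) d \<noteq> d" using crossing_cases(2,4)[OF wf c d] by auto
  then show "?r d \<noteq> d" using r by simp
  have "vertex (smooth D \<sigma>) d = {(?r ^^ m) d |m. m < 2}"
    using * by (intro orbit_altdef_bounded) (simp_all add: numeral_2_eq_2)
  also have "\<dots> = {d, ?r d}"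
    by (auto simp: less_2_cases_iff intro: exI[of _ 0] exI[of _ "Suc 0"])
  finally show "vertex (smooth D \<sigma>) d = {d, ?r d}" .
qed

lemma smooth_crossings:
  assumes wf: "wf_diagram D" and dom: "dom \<sigma> \<subseteq> crossings D"
  shows "wf_diagram (smooth D \<sigma>)" and "crossings (smooth D \<sigma>) = crossings D - dom \<sigma>"
proof -
  let ?U = "smooth D \<sigma>"
  have None_cong: "\<sigma> (vertex D (rot D d)) = \<sigma> (vertex D d)" for d using wf by simp
  have vU: "if \<sigma> (vertex D d) = None then vertex ?U d = vertex D d else card (vertex ?U d) = 2" for d
    using smooth_vertex_None[OF wf, of \<sigma> d] rot_smooth_Some(3,4)[OF wf dom, of d] by auto
  show cr: "crossings ?U = crossings D - dom \<sigma>"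
  proof (intro equalityI subsetI)
    fix c assume "c \<in> crossings ?U"
    then obtain d where d: "d \<in> darts D" "c = vertex ?U d" "card c = 4"
      by (auto simp: crossings_def vertices_def)
    then have "\<sigma> (vertex D d) = None" "c = vertex D d"
      using vU[of d] by (auto split: if_splits)
    then show "c \<in> crossings D - dom \<sigma>"
      using d vertex_in_crossings[OF wf d(1)] by auto
  next
    fix c assume c: "c \<in> crossings D - dom \<sigma>"
    then obtain d where d: "d \<in> darts D" "c = vertex D d" "card c = 4"
      by (auto simp: crossings_def vertices_def)
    then have "vertex ?U d = c" using vU[of d] c by auto
    then show "c \<in> crossings ?U"
      using d by (auto simp: crossings_def vertices_def)
  qed
  have r_in: "rot ?U d \<in> vertex D d" for d
  proof (cases "\<sigma> (vertex D d)")
    case None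
    then show ?thesis using orbit.base[of "rot D" d] by (simp add: rot_smooth)
  qed (rule rot_smooth_Some(1)[OF wf dom])
  have dr: "rot ?U d \<in> darts D" if "d \<in> darts D" for d
    using r_in vertex_subset_darts[OF wf that] by blast
  show "wf_diagram ?U"
    unfolding wf_diagram_def
  proof (intro conjI ballI)
    show "finite (darts ?U)" using wf_diagram_darts(4)[OF wf] by simp
    show "arc ?U permutes darts ?U" using wf by (simp add: wf_diagram_def)
    show "arc ?U d \<noteq> d" "arc ?U (arc ?U d) = d" if "d \<in> darts ?U" for d
      using wf that by (simp_all add: wf_diagram_def)
    show "rot ?U permutes darts ?U"
    proof (rule inj_imp_permutes)
      show "finite (darts ?U)" using wf_diagram_darts(4)[OF wf] by simp
      show "rot ?U d \<in> darts ?U" if "d \<in> darts ?U" for d using dr that by simp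
      show "rot ?U d = d" if "d \<notin> darts ?U" for d
      proof -
        have "rot D d = d"
          using that wf permutes_not_in[of "rot D" "darts D" d] by (simp add: wf_diagram_def)
        moreover from this have "inv (rot D) d = d" using wf_diagram_inv_rot(1)[OF wf, of d] by simp
        ultimately show ?thesis by (simp add: rot_smooth split: option.split)
      qed
      show "inj_on (rot ?U) (darts ?U)"
      proof (rule inj_onI)
        fix d e assume de: "rot ?U d = rot ?U e"
        have "vertex D d = vertex D e"
          using r_in[of d] r_in[of e] de vertex_eqI[OF wf] by metis
        show "d = e"
        proof (cases "\<sigma> (vertex D d)")
          case None
          then have "rot D d = rot D e" using de \<open>vertex D d = _\<close> by (simp add: rot_smooth)
          then show ?thesis by (metis wf_diagram_inv_rot(1)[OF wf])
        next
          case (Some s)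
          then have "\<sigma> (vertex D e) = Some s" using \<open>vertex D d = _\<close> by simp
          then show ?thesis
            using rot_smooth_Some(2)[OF wf dom] Some de by metis
        qed
      qed
    qed
    show "card v = 2 \<or> card v = 4" if v: "v \<in> vertices ?U" for v
    proof -
      obtain d where "d \<in> darts D" "v = vertex ?U d" using v by (auto simp: vertices_def)
      then show ?thesis using vU[of d] vertex_card[OF wf, of d] by (auto split: if_splits)
    qed
    show "over ?U \<subseteq> \<Union> (crossings ?U)"
    proof -
      have "over D \<subseteq> \<Union> (crossings D)" using wf by (simp add: wf_diagram_def)
      then show ?thesis unfolding cr smooth_simps by blast
    qed
    show "rot ?U d \<in> over ?U \<longleftrightarrow> d \<notin> over ?U" if d: "d \<in> \<Union> (crossings ?U)" for d
    proof -
      obtain c where c: "c \<in> crossings D" "c \<notin> dom \<sigma>" "d \<in> c" using d cr by blast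
      have "c' = c" if "c' \<in> dom \<sigma>" "e \<in> c'" "e \<in> c" for c' e
        using vertices_disjoint[OF wf] that c(1) dom by blast
      then have "e \<notin> \<Union> (dom \<sigma>)" if "e \<in> c" for e using c(2) that by blast
      moreover have "vertex D d = c" using crossing_vertex(1)[OF wf c(1,3)] .
      then have "rot ?U d = rot D d" using c(2) by (simp add: rot_smooth domIff)
      ultimately show ?thesis
        using over_alternates(1)[OF wf c(1,3)] rot_in_crossing(1)[OF wf c(1)] c(3) by simp
    qed
  qed
qed

lemma smooth_alternating:
  assumes alt: "alternating D S" and dom: "dom \<sigma> \<subseteq> crossings D"
  shows "alternating (smooth D \<sigma>) S"
  unfolding alternating_def
proof (intro conjI ballI)
  note wf = alternatingD(1)[OF alt]
  show "wf_diagram (smooth D \<sigma>)" by (rule smooth_crossings(1)[OF wf dom])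
  show "S \<subseteq> darts (smooth D \<sigma>)" using alternatingD(2)[OF alt] by simp
  fix d assume "d \<in> darts (smooth D \<sigma>)"
  then have d: "d \<in> darts D" by simp
  show "arc (smooth D \<sigma>) d \<in> S \<longleftrightarrow> d \<notin> S" using alternatingD(4)[OF alt d] by simp
  show "rot (smooth D \<sigma>) d \<in> S \<longleftrightarrow> d \<notin> S"
    using alternatingD(5,6)[OF alt d] by (simp add: rot_smooth split: option.split)
qed

text \<open>A smoothing that makes the choices of \<open>X\<close> performs the turns of the walk
  beforehand. The walk then meets 2-valent points in place of these crossings and keeps its
  course.\<close>

lemma smooth_state_step:
  assumes alt: "alternating D S" and dom: "dom \<sigma> \<subseteq> crossings D" and X: "X \<subseteq> crossings D"
    and \<sigma>: "\<And>c s. \<sigma> c = Some s \<Longrightarrow> s = A_smoothing \<longleftrightarrow> (c \<inter> over D \<subseteq> S \<longleftrightarrow> c \<in> X)"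
    and "d \<in> S"
  shows "state_step (smooth D \<sigma>) X d = state_step D X d"
proof -
  note wf = alternatingD(1)[OF alt]
  let ?U = "smooth D \<sigma>" and ?e = "arc D d"
  note wfU = smooth_crossings(1)[OF wf dom]
  have e: "?e \<in> darts D" "?e \<notin> S"
    using assms(5) alternatingD(2,4)[OF alt] wf_diagram_darts(2)[OF wf] by blast+
  show ?thesis
  proof (cases "\<sigma> (vertex D ?e)")
    case None
    have "\<sigma> (vertex D (inv (rot D) ?e)) = None" using None wf by simp
    then have "rot ?U (inv (rot D) ?e) = ?e" using wf by (simp add: rot_smooth)
    then have "inv (rot ?U) ?e = inv (rot D) ?e" using wf_diagram_inv_rot(1)[OF wfU] by metis
    then show ?thesis
      using None smooth_vertex_None[of D \<sigma> ?e, OF wf None] by (simp add: state_step_def rot_smooth)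
  next
    case (Some s)
    have c: "vertex D ?e \<in> crossings D" using Some dom by blast
    note rs = rot_smooth_Some[of D \<sigma> ?e, OF wf dom Some]
    \<comment> \<open>The walk arrives at an unshaded dart, which belongs to the upper strand
      exactly at a negative edge.\<close>
    have over_e: "?e \<in> over D \<longleftrightarrow> \<not> vertex D ?e \<inter> over D \<subseteq> S"
      using crossing_over_cases[OF alt c] vertex_self[OF wf, of ?e] e(2) by blast
    have "card (vertex ?U ?e) \<noteq> 4" using rs(3,4) by simp
    then have "vertex ?U ?e \<notin> X" using X by (auto simp: crossings_def)
    moreover have "inv (rot ?U) ?e = rot ?U ?e"
      using wf_diagram_inv_rot(1)[OF wfU, of "rot ?U ?e"] rs(2) by simp
    ultimately have "state_step ?U X d = rot ?U ?e" by (simp add: state_step_def)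
    also have "\<dots> = (if ?e \<in> over D \<longleftrightarrow> s = A_smoothing then inv (rot D) ?e else rot D ?e)"
      using Some by (simp add: rot_smooth)
    also have "\<dots> = state_step D X d"
      using \<sigma>[OF Some] unfolding over_e state_step_def by auto
    finally show ?thesis .
  qed
qed

section \<open>Weights\<close>

text \<open>For a homomorphism \<open>p\<close> from the integers, \<open>p (-1)\<close> is the only
  inverse of \<open>p 1\<close>, so the description in \<open>unit_power\<close> is resolved once
  for both units \<open>Avar\<close> and \<open>- Avar\<close>.\<close>

lemma unit_power_hom:
  fixes p :: "int \<Rightarrow> 'a::comm_ring_1"
  assumes "p 0 = 1" and "\<And>m n. p (m + n) = p m * p n"
  shows "unit_power (p 1) n = p n"
proof -
  have inv: "p 1 * p (-1) = 1" using assms(2)[of 1 "-1"] assms(1) by simp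
  have "(THE y. p 1 * y = 1) = p (-1)"
  proof (rule the_equality[of "\<lambda>y. p 1 * y = 1", OF inv])
    fix y assume y: "p 1 * y = 1"
    have "y = (p 1 * p (-1)) * y" by (simp add: inv)
    also have "\<dots> = p (-1) * (p 1 * y)" by (simp only: mult.assoc mult.commute mult.left_commute)
    finally show "y = p (-1)" by (simp add: y)
  qed
  moreover have "p 1 ^ k = p (int k)" "p (-1) ^ k = p (- int k)" for k
    by (induction k) (simp_all add: assms(1) assms(2)[symmetric])
  ultimately show ?thesis by (simp add: unit_power_def)
qed

lemma unit_power_Avar: "unit_power Avar n = Poly_Mapping.single n 1"
  using unit_power_hom[of "\<lambda>n. Poly_Mapping.single n (1::int)" n]
  by (simp add: Avar_def mult_single)

lemma unit_power_minus_Avar: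
  "unit_power (- Avar) n = Poly_Mapping.single n (if even n then 1 else -1)"
  using unit_power_hom[of "\<lambda>n. Poly_Mapping.single n (if even n then 1 else -1::int)" n]
  by (simp add: Avar_def mult_single single_uminus)

lemma prod_single:
  assumes "finite C"
  shows "(\<Prod>c\<in>C. Poly_Mapping.single (f c) (g c)) =
    (Poly_Mapping.single (\<Sum>c\<in>C. f c) (\<Prod>c\<in>C. g c) :: laurent)"
  using assms by (induction C) (simp_all add: mult_single)

context tait
begin

text \<open>1 where the choice of \<open>T\<close> is the A-smoothing and -1 where it is the
  B-smoothing, that is, the negative of \<open>kink_sign\<close>.\<close>

definition choice_sign :: "'d set set \<Rightarrow> 'd set \<Rightarrow> int" where
  "choice_sign T c = (if c \<inter> over D \<subseteq> S \<longleftrightarrow> c \<in> T then 1 else -1)"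

lemma activity_eq:
  "activity G r T c = (if c \<in> T then if live r T c then internally_active else internally_inactive
     else if live r T c then externally_active else externally_inactive)"
  by (simp add: live_def activity_def)

lemma positive_G: "c \<in> positive G \<longleftrightarrow> c \<in> crossings D \<and> c \<inter> over D \<subseteq> S"
  by (simp add: tait_graph_def)

text \<open>The eight rules for weights collapse into two: a live edge gives -A^(3k) with k the sign
  of its kink, a dead edge gives A or its inverse according to its smoothing.\<close>

lemma weight_eq:
  assumes "c \<in> crossings D"
  shows "weight (c \<in> positive G) (activity G r T c) =
    (if live r T c then Poly_Mapping.single (3 * kink_sign D S T c) (-1)
     else Poly_Mapping.single (choice_sign T c) 1)"
proof -
  have "weight True internally_inactive = Poly_Mapping.single 1 1"
    "weight False externally_inactive = Poly_Mapping.single 1 1"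
    by (simp_all add: Avar_def)
  then show ?thesis
    using assms
    by (cases "c \<in> T"; cases "live r T c"; cases "c \<inter> over D \<subseteq> S")
      (simp_all add: activity_eq positive_G kink_sign_def choice_sign_def unit_power_Avar single_uminus)
qed

lemma tree_state_eq:
  "tree_state G r T c = (if c \<in> crossings D \<and> \<not> live r T c
     then Some (if choice_sign T c = 1 then A_smoothing else B_smoothing) else None)"
  by (cases "c \<in> T"; cases "live r T c"; cases "c \<inter> over D \<subseteq> S")
    (simp_all add: tree_state_def activity_eq positive_G choice_sign_def)

lemma tree_weight_eq:
  assumes w: "w = (\<Sum>c\<in>crossings D - dom (tree_state G r T). kink_sign D S T c)"
  shows "tree_weight G r T =
    unit_power Avar (smoothing_balance (tree_state G r T)) * unit_power (- Avar) (3 * w)"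
proof -
  let ?\<sigma> = "tree_state G r T"
  define Lv where "Lv = {c \<in> crossings D. live r T c}"
  define Dd where "Dd = {c \<in> crossings D. \<not> live r T c}"
  have fin: "finite Lv" "finite Dd" using finite_crossings(1)[OF wf] by (simp_all add: Lv_def Dd_def)
  have split: "crossings D = Lv \<union> Dd" "Lv \<inter> Dd = {}" by (auto simp: Lv_def Dd_def)
  have dom: "crossings D - dom ?\<sigma> = Lv" by (auto simp: Lv_def tree_state_eq split: if_splits)
  have ks: "kink_sign D S T c = 1 \<or> kink_sign D S T c = -1" for c by (simp add: kink_sign_def)
  have "smoothing_balance ?\<sigma> = (\<Sum>c\<in>Dd. choice_sign T c)"
  proof -
    have "{c. ?\<sigma> c = Some A_smoothing} = {c \<in> Dd. choice_sign T c = 1}"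
      "{c. ?\<sigma> c = Some B_smoothing} = {c \<in> Dd. \<not> choice_sign T c = 1}"
      by (auto simp: tree_state_eq Dd_def split: if_splits)
    moreover have "(\<Sum>c\<in>Dd. choice_sign T c) = (\<Sum>c\<in>Dd. if choice_sign T c = 1 then 1 else -1)"
      by (rule sum.cong) (simp_all add: choice_sign_def)
    moreover have "\<dots> = int (card {c \<in> Dd. choice_sign T c = 1}) - int (card {c \<in> Dd. \<not> choice_sign T c = 1})"
      using fin(2) by (simp add: sum.If_cases Int_def)
    ultimately show ?thesis unfolding smoothing_balance_def by simp
  qed
  then have A: "unit_power Avar (smoothing_balance ?\<sigma>) = (\<Prod>c\<in>Dd. Poly_Mapping.single (choice_sign T c) 1)"
    by (simp add: unit_power_Avar prod_single[OF fin(2)])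
  \<comment> \<open>Each kink sign is odd, so three times their sum has the parity of the number of
    kinks. This matches the factors -1 of the live edges with the sign of the power of
    \<open>- Avar\<close>.\<close>
  have par: "(\<Prod>c\<in>C. -1) = (if even (3 * (\<Sum>c\<in>C. kink_sign D S T c)) then 1 else -1 :: int)"
    if "finite C" for C
    using that
  proof (induction C)
    case (insert c C)
    then show ?case using ks[of c] by (auto simp del: prod_constant)
  qed simp
  have B: "unit_power (- Avar) (3 * w) = (\<Prod>c\<in>Lv. Poly_Mapping.single (3 * kink_sign D S T c) (-1))"
    unfolding unit_power_minus_Avar w dom prod_single[OF fin(1)] par[OF fin(1)] sum_distrib_left ..
  have "tree_weight G r T = (\<Prod>c\<in>Lv \<union> Dd. weight (c \<in> positive G) (activity G r T c))"
    unfolding tree_weight_def edges_G split(1) ..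
  also have "\<dots> = (\<Prod>c\<in>Lv. weight (c \<in> positive G) (activity G r T c)) *
      (\<Prod>c\<in>Dd. weight (c \<in> positive G) (activity G r T c))"
    using fin split(2) by (rule prod.union_disjoint)
  also have "\<dots> = unit_power Avar (smoothing_balance ?\<sigma>) * unit_power (- Avar) (3 * w)"
    unfolding A B using weight_eq by (simp add: Lv_def Dd_def mult.commute)
  finally show ?thesis .
qed

end

section \<open>The skein resolution tree\<close>

lemma finite_linear_order_maximal:
  assumes "linear_order_on E r" and "finite A" and "A \<noteq> {}" and "A \<subseteq> E"
  shows "\<exists>e\<in>A. \<forall>f\<in>A. (f, e) \<in> r"
  using assms(2-4)
proof (induction rule: finite_ne_induct)
  case (singleton x)
  then show ?case
    using assms(1) by (auto simp: linear_order_on_def partial_order_on_def preorder_on_def refl_on_def)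
next
  case (insert x A)
  then obtain e where e: "e \<in> A" "\<forall>f\<in>A. (f, e) \<in> r" by auto
  have refl: "refl_on E r" and tr: "trans r" and tot: "total_on E r"
    using assms(1) by (auto simp: linear_order_on_def partial_order_on_def preorder_on_def)
  have x: "x \<in> E" "e \<in> E" using insert.prems e(1) by auto
  have "(x, x) \<in> r" using refl x(1) by (simp add: refl_on_def)
  moreover have "(x, e) \<in> r \<or> (e, x) \<in> r"
    using tot x insert.hyps(3) e(1) unfolding total_on_def by metis
  ultimately show ?case
    using e tr unfolding trans_def by (metis insert_iff)
qed

context tait
begin

text \<open>By \<open>dead_iff\<close>, membership of \<open>c\<close> and of the higher edges
  determines whether \<open>c\<close> is dead, and membership of \<open>c\<close> determines the
  smoothing. Hence the state of a processed edge is shared by all trees with the same earlier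
  choices.\<close>

lemma tree_state_cong:
  assumes "spanning_tree G T" and "spanning_tree G T'" and "linear_order_on (edges G) r"
    and "\<And>f. f \<in> crossings D \<Longrightarrow> (c, f) \<in> r \<Longrightarrow> f \<in> T \<longleftrightarrow> f \<in> T'"
  shows "tree_state G r T c = tree_state G r T' c"
proof (cases "c \<in> crossings D")
  case True
  then have cE: "c \<in> edges G" by simp
  have "(c, c) \<in> r"
    using True assms(3) by (auto simp: linear_order_on_def partial_order_on_def preorder_on_def refl_on_def)
  then have cT: "c \<in> T \<longleftrightarrow> c \<in> T'" using assms(4) True by blast
  have "live r T c \<longleftrightarrow> live r T' c"
    using dead_iff[OF assms(1) cE assms(3)] dead_iff[OF assms(2) cE assms(3)] assms(4) cT
    by simp metis
  then show ?thesis using cT by (simp add: tree_state_eq choice_sign_def)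
qed (simp add: tree_state_eq)

text \<open>The set \<open>P\<close> holds the edges already processed, and \<open>F\<close> the
  spanning trees that agree with the choices made on them, represented by \<open>T\<^sub>0\<close>.
  The subtree for \<open>F\<close> is built by induction on the number of remaining edges, and its
  root carries the part of the state on \<open>P\<close>.\<close>

lemma skein_tree:
  assumes r: "linear_order_on (edges G) r" and "P \<subseteq> crossings D"
    and up: "\<forall>e\<in>P. \<forall>f\<in>crossings D. (e, f) \<in> r \<longrightarrow> f \<in> P"
    and "spanning_tree G T\<^sub>0"
  defines "F \<equiv> {T. spanning_tree G T \<and> T \<inter> P = T\<^sub>0 \<inter> P}"
  shows "\<exists>t. root_state t = tree_state G r T\<^sub>0 |` P \<and> resolves D t \<and> distinct (leaf_states t) \<and>
    set (leaf_states t) = tree_state G r ` F \<and> inj_on (tree_state G r) F"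
  using assms(2-4) unfolding F_def
proof (induction "card (crossings D - P)" arbitrary: P T\<^sub>0 rule: less_induct)
  case less
  let ?st = "tree_state G r"
  let ?F = "\<lambda>P T\<^sub>0. {T. spanning_tree G T \<and> T \<inter> P = T\<^sub>0 \<inter> P}"
  note P = less.prems(1) and up = less.prems(2) and T0 = less.prems(3)
  have sub: "T \<subseteq> crossings D" if "spanning_tree G T" for T
    using spanning_treeD(1)[OF that] by simp
  show ?case
  proof (cases "P = crossings D")
    case True
    have "?F P T\<^sub>0 = {T\<^sub>0}" using sub T0 True by blast
    moreover have "?st T\<^sub>0 |` P = ?st T\<^sub>0"
      using True by (auto simp: fun_eq_iff restrict_map_def tree_state_eq)
    ultimately show ?thesis by (intro exI[of _ "Leaf (?st T\<^sub>0)"]) simp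
  next
    case False
    have fin: "finite (crossings D - P)" using finite_crossings(1)[OF wf] by simp
    obtain e where e: "e \<in> crossings D - P" and max: "\<And>f. f \<in> crossings D - P \<Longrightarrow> (f, e) \<in> r"
      using finite_linear_order_maximal[OF r fin] False P by auto
    have eE: "e \<in> edges G" using e by simp
    have antisym: "antisym r" and tot: "total_on (crossings D) r"
      using r by (simp_all add: linear_order_on_def partial_order_on_def)
    \<comment> \<open>As \<open>P\<close> is closed upwards and \<open>e\<close> is the highest edge
      outside it, agreement on \<open>P\<close> is the same as agreement above \<open>e\<close>, the
      condition in \<open>dead_iff\<close>.\<close>
    have above: "f \<in> P \<longleftrightarrow> (e, f) \<in> r \<and> f \<noteq> e" if f: "f \<in> crossings D" for f
    proof
      assume fP: "f \<in> P"
      then have "f \<noteq> e" using e by blast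
      moreover have "(f, e) \<notin> r" using up fP e by blast
      ultimately show "(e, f) \<in> r \<and> f \<noteq> e" using tot f e unfolding total_on_def by blast
    next
      assume ef: "(e, f) \<in> r \<and> f \<noteq> e"
      show "f \<in> P"
      proof (rule ccontr)
        assume "f \<notin> P"
        then have "(f, e) \<in> r" using max f by blast
        then show False using antisym ef by (metis antisymD)
      qed
    qed
    let ?P = "insert e P"
    have smaller: "card (crossings D - ?P) < card (crossings D - P)"
      using fin e by (intro psubset_card_mono) auto
    have P': "?P \<subseteq> crossings D" using P e by blast
    have up': "\<forall>g\<in>?P. \<forall>f\<in>crossings D. (g, f) \<in> r \<longrightarrow> f \<in> ?P"
      using up above by blast
    note IH = less.hyps[OF smaller P' up']
    have dead: "\<not> live r T e \<longleftrightarrow> (\<exists>T'\<in>?F P T. e \<in> T' \<longleftrightarrow> e \<notin> T)" if T: "spanning_tree G T" for T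
    proof -
      have "T' \<inter> P = T \<inter> P \<longleftrightarrow> (\<forall>f\<in>edges G. (e, f) \<in> r \<longrightarrow> f \<noteq> e \<longrightarrow> (f \<in> T' \<longleftrightarrow> f \<in> T))" for T'
        using above P by auto
      then show ?thesis unfolding dead_iff[OF T eE r] by blast
    qed
    have st_cong: "?st T c = ?st T' c"
      if "spanning_tree G T" "spanning_tree G T'" "T \<inter> Q = T' \<inter> Q" "c \<in> Q" "Q = P \<or> Q = ?P" for T T' Q c
      using that(1,2) r
    proof (rule tree_state_cong)
      fix f assume f: "f \<in> crossings D" "(c, f) \<in> r"
      then have "f \<in> Q" using that(4,5) up up' by blast
      then show "f \<in> T \<longleftrightarrow> f \<in> T'" using that(3) by blast
    qed
    show ?thesis
    proof (cases "\<exists>T\<in>?F P T\<^sub>0. e \<in> T \<longleftrightarrow> e \<notin> T\<^sub>0")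
      case False
      \<comment> \<open>Here all trees of the family agree at \<open>e\<close>, so \<open>e\<close>
        is live and stays unsmoothed. The family and the root state do not change, and the tree for
        the larger set serves as it is.\<close>
      then have "?F ?P T\<^sub>0 = ?F P T\<^sub>0" by auto
      moreover have "live r T\<^sub>0 e" using dead[OF T0] False by blast
      then have "?st T\<^sub>0 |` ?P = ?st T\<^sub>0 |` P"
        by (auto simp: fun_eq_iff restrict_map_def tree_state_eq)
      ultimately show ?thesis using IH[OF T0] by simp
    next
      case True
      then obtain T\<^sub>1 where T1: "spanning_tree G T\<^sub>1" "T\<^sub>1 \<inter> P = T\<^sub>0 \<inter> P" "e \<in> T\<^sub>1 \<longleftrightarrow> e \<notin> T\<^sub>0" by blast
      \<comment> \<open>Trees that differ at \<open>e\<close> make opposite choices there. They are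
        renamed because the first child of a node must belong to the A-smoothing, and whether this
        means to contain \<open>e\<close> depends on the sign of \<open>e\<close>.\<close>
      obtain TA TB where TAB: "{TA, TB} = {T\<^sub>0, T\<^sub>1}" and
        cs: "choice_sign TA e = 1" "choice_sign TB e = -1"
      proof (cases "choice_sign T\<^sub>0 e = 1")
        case True
        then have "choice_sign T\<^sub>1 e = -1" using T1(3) by (auto simp: choice_sign_def split: if_splits)
        then show thesis using that[of T\<^sub>0 T\<^sub>1] True by simp
      next
        case False
        then have "choice_sign T\<^sub>1 e = 1" "choice_sign T\<^sub>0 e = -1"
          using T1(3) by (auto simp: choice_sign_def split: if_splits)
        then show thesis using that[of T\<^sub>1 T\<^sub>0] by (simp add: insert_commute)
      qed
      have tA: "spanning_tree G TA" "TA \<inter> P = T\<^sub>0 \<inter> P" and tB: "spanning_tree G TB" "TB \<inter> P = T\<^sub>0 \<inter> P"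
        using TAB T0 T1 by (metis insert_iff singletonD)+
      have eAB: "e \<in> TA \<longleftrightarrow> e \<notin> TB" using TAB T1(3) by (auto simp: doubleton_eq_iff)
      obtain a where a: "root_state a = ?st TA |` ?P" "resolves D a" "distinct (leaf_states a)"
        "set (leaf_states a) = ?st ` ?F ?P TA" "inj_on ?st (?F ?P TA)"
        using IH[OF tA(1)] by blast
      obtain b where b: "root_state b = ?st TB |` ?P" "resolves D b" "distinct (leaf_states b)"
        "set (leaf_states b) = ?st ` ?F ?P TB" "inj_on ?st (?F ?P TB)"
        using IH[OF tB(1)] by blast
      have F: "?F P T\<^sub>0 = ?F ?P TA \<union> ?F ?P TB" using tA(2) tB(2) eAB by auto
      have "\<not> live r TA e" "\<not> live r TB e"
        using dead[OF tA(1)] dead[OF tB(1)] tA tB eAB by auto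
      then have stA: "?st TA e = Some A_smoothing" and stB: "?st TB e = Some B_smoothing"
        using e cs by (simp_all add: tree_state_eq)
      have roots: "?st TA |` ?P = (?st T\<^sub>0 |` P)(e \<mapsto> A_smoothing)"
        "?st TB |` ?P = (?st T\<^sub>0 |` P)(e \<mapsto> B_smoothing)"
        using stA stB st_cong[OF tA(1) T0 tA(2)] st_cong[OF tB(1) T0 tB(2)]
        by (auto simp: fun_eq_iff restrict_map_def)
      have FA: "?st T e = Some A_smoothing" if "T \<in> ?F ?P TA" for T
        using that st_cong[of T TA ?P e] tA(1) stA by auto
      have FB: "?st T e = Some B_smoothing" if "T \<in> ?F ?P TB" for T
        using that st_cong[of T TB ?P e] tB(1) stB by auto
      \<comment> \<open>States from the two branches differ at \<open>e\<close>; this gives both the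
        distinctness of the leaves and the injectivity of the correspondence.\<close>
      have disj: "?st ` ?F ?P TA \<inter> ?st ` ?F ?P TB = {}"
      proof (rule ccontr)
        assume "?st ` ?F ?P TA \<inter> ?st ` ?F ?P TB \<noteq> {}"
        then obtain T T' where TT': "T \<in> ?F ?P TA" "T' \<in> ?F ?P TB" "?st T = ?st T'" by blast
        show False using FA[OF TT'(1)] FB[OF TT'(2)] TT'(3) by simp
      qed
      have dom: "dom (?st T\<^sub>0 |` P) \<subseteq> P" by simp
      have "e \<in> crossings (smooth D (?st T\<^sub>0 |` P))"
        unfolding smooth_crossings(2)[OF wf subset_trans[OF dom P]] using dom e by blast
      then have "resolves D (Node (?st T\<^sub>0 |` P) a b)"
        using a(1,2) b(1,2) roots by auto
      moreover have "inj_on ?st (?F P T\<^sub>0)"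
        unfolding F inj_on_Un using a(5) b(5) disj by blast
      ultimately show ?thesis
        using a(3,4) b(3,4) disj F
        by (intro exI[of _ "Node (?st T\<^sub>0 |` P) a b"]) (simp add: image_Un)
    qed
  qed
qed

text \<open>The dead crossings are smoothed as the tree chooses, so its circle persists in the
  partial smoothing. The crossings left over are live, and linked chords among them would allow an
  exchange that live edges forbid.\<close>

lemma smooth_tree_state:
  fixes r and T
  defines "\<sigma> \<equiv> tree_state G r T"
  assumes T: "spanning_tree G T" and r: "linear_order_on (edges G) r"
  obtains L where "alternating (smooth D \<sigma>) S" and "cyc_list (state_step (smooth D \<sigma>) T) L"
    and "set L = S" and "noncrossing (smooth D \<sigma>) L"
    and "crossings (smooth D \<sigma>) = crossings D - dom \<sigma>"
    and "\<And>c. c \<in> crossings (smooth D \<sigma>) \<Longrightarrow> kink_sign (smooth D \<sigma>) S T c = kink_sign D S T c"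
proof -
  let ?U = "smooth D \<sigma>"
  have dom: "dom \<sigma> \<subseteq> crossings D" by (auto simp: \<sigma>_def tree_state_eq split: if_splits)
  have TE: "T \<subseteq> crossings D" using spanning_treeD(1)[OF T] by simp
  have alt: "alternating ?U S" by (rule smooth_alternating[OF alternating dom])
  note wfU = smooth_crossings(1)[OF wf dom] and crU = smooth_crossings(2)[OF wf dom]
  obtain b where b: "b \<in> S" using shaded_nonempty by blast
  obtain L where L: "cyc_list (step T) L" "hd L = b" "set L = orbit (step T) b"
    by (rule cyc_list_exists[OF permutation_step])
  have LS: "set L = S" using L(3) spanning_tree_circle[OF T b] by simp
  have step_eq: "state_step ?U T d = step T d" if "d \<in> S" for d
    using alternating dom TE _ that
  proof (rule smooth_state_step)
    fix c s assume "\<sigma> c = Some s"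
    then show "s = A_smoothing \<longleftrightarrow> (c \<inter> over D \<subseteq> S \<longleftrightarrow> c \<in> T)"
      by (auto simp: \<sigma>_def tree_state_eq choice_sign_def split: if_splits)
  qed
  have "successively (\<lambda>x y. state_step ?U T x = y) L"
    using L(1) step_eq LS by (auto simp: cyc_list_def elim!: successively_mono)
  moreover have "last L \<in> S" using L(1) LS by (auto simp: cyc_list_def)
  ultimately have cyc: "cyc_list (state_step ?U T) L"
    using L(1) step_eq by (simp add: cyc_list_def)
  have vU: "vertex D u = vertex ?U u" "live r T (vertex ?U u)" "vertex ?U u \<in> crossings D"
    if u: "vertex ?U u \<in> crossings ?U" for u
  proof -
    show c: "vertex ?U u \<in> crossings D" using u crU by blast
    show "vertex D u = vertex ?U u" using crossing_vertex(1)[OF wf c] vertex_self[OF wfU] by blast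
    have "vertex ?U u \<notin> dom \<sigma>" using u crU by blast
    then show "live r T (vertex ?U u)" using c by (simp add: \<sigma>_def tree_state_eq domIff split: if_splits)
  qed
  have nc: "noncrossing ?U L"
    unfolding noncrossing_def
  proof (intro allI impI, rule ccontr)
    fix u v u' v'
    assume s: "subseq [u, v, u', v'] L" and c: "vertex ?U u \<in> crossings ?U" "vertex ?U v \<in> crossings ?U"
      and eq: "vertex ?U u = vertex ?U u'" "vertex ?U v = vertex ?U v'" and ne: "vertex ?U u \<noteq> vertex ?U v"
    have "spanning_tree G (sym_diff T {vertex ?U u, vertex ?U v})"
      using T L(1) LS s
    proof (rule linked_exchange)
      show "vertex D u' = vertex ?U u" "vertex D v' = vertex ?U v" using vU(1) c eq by simp_all
    qed (use vU c ne in auto)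
    moreover have "\<not> spanning_tree G (sym_diff T {vertex ?U u, vertex ?U v})"
      using T _ _ ne r vU(2)[OF c(1)] vU(2)[OF c(2)]
      by (rule live_not_exchangeable) (use vU(3) c in simp_all)
    ultimately show False by contradiction
  qed
  have "kink_sign ?U S T c = kink_sign D S T c" if c: "c \<in> crossings ?U" for c
  proof -
    have cD: "c \<in> crossings D" "c \<notin> dom \<sigma>" using c crU by simp_all
    have "c' = c" if "c' \<in> dom \<sigma>" "x \<in> c'" "x \<in> c" for c' x
      using vertices_disjoint[OF wf _ cD(1) that(2,3)] that(1) dom by blast
    then have "c \<inter> \<Union> (dom \<sigma>) = {}" using cD(2) by blast
    then have "c \<inter> over ?U = c \<inter> over D" by auto
    then show ?thesis by (simp add: kink_sign_def)
  qed
  then show thesis using that[OF alt cyc LS nc crU] by blast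
qed

end

theorem theorem2:
  fixes D :: "nat diagram" and S :: "nat set"
    and G :: "(nat set, nat set) signed_graph" and r :: "nat set rel"
  assumes "link_diagram D" and "connected_diagram D"
    and "checkerboard D S"
    and "G = tait_graph D S"
    and "linear_order_on (edges G) r"
  shows "\<exists>t. partial_skein_resolution_tree D t \<and>
    distinct (leaf_states t) \<and>
    bij_betw (tree_state G r) {T. spanning_tree G T} (set (leaf_states t)) \<and>
    (\<forall>\<sigma>\<in>set (leaf_states t). twisted_unknot (smooth D \<sigma>)) \<and>
    (\<forall>T \<sigma>. spanning_tree G T \<and> \<sigma> = tree_state G r T \<longrightarrow>
       tree_weight G r T =
         unit_power Avar (smoothing_balance \<sigma>) * unit_power (- Avar) (3 * writhe (smooth D \<sigma>)))"
proof -
  interpret tait D S using assms(1-3) by unfold_locales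
  note r = assms(5)[unfolded assms(4)]
  have leaf: "twisted_unknot (smooth D (tree_state (tait_graph D S) r T)) \<and>
      writhe (smooth D (tree_state (tait_graph D S) r T)) =
        (\<Sum>c\<in>crossings D - dom (tree_state (tait_graph D S) r T). kink_sign D S T c)"
    if T: "spanning_tree (tait_graph D S) T" for T
  proof -
    let ?U = "smooth D (tree_state (tait_graph D S) r T)"
    obtain L where L: "alternating ?U S" "cyc_list (state_step ?U T) L" "set L = S" "noncrossing ?U L"
      and cr: "crossings ?U = crossings D - dom (tree_state (tait_graph D S) r T)"
      and ks: "\<And>c. c \<in> crossings ?U \<Longrightarrow> kink_sign ?U S T c = kink_sign D S T c"
      by (rule smooth_tree_state[OF T r]) blast
    have "(\<Sum>c\<in>crossings ?U. kink_sign ?U S T c) = (\<Sum>c\<in>crossings ?U. kink_sign D S T c)"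
      by (rule sum.cong[OF refl ks])
    then show ?thesis using noncrossing_circle[OF L] cr by simp
  qed
  obtain T\<^sub>0 where T0: "spanning_tree (tait_graph D S) T\<^sub>0" using exists_spanning_tree by blast
  obtain t where t: "root_state t = Map.empty" "resolves D t" "distinct (leaf_states t)"
    "set (leaf_states t) = tree_state (tait_graph D S) r ` {T. spanning_tree (tait_graph D S) T}"
    "inj_on (tree_state (tait_graph D S) r) {T. spanning_tree (tait_graph D S) T}"
    \<comment> \<open>With no edge processed the family consists of all spanning trees, and the root
      carries the empty state.\<close>
    using skein_tree[OF r, of "{}" T\<^sub>0] T0 by auto
  show ?thesis
    unfolding assms(4)
  proof (intro exI[of _ t] conjI allI impI)
    show "partial_skein_resolution_tree D t"
      using t(1,2) by (simp add: partial_skein_resolution_tree_def)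
    show "distinct (leaf_states t)" by fact
    show "bij_betw (tree_state (tait_graph D S) r) {T. spanning_tree (tait_graph D S) T} (set (leaf_states t))"
      using t(4,5) by (simp add: bij_betw_def)
    show "\<forall>\<sigma>\<in>set (leaf_states t). twisted_unknot (smooth D \<sigma>)"
      using t(4) leaf by auto
    fix T \<sigma> assume "spanning_tree (tait_graph D S) T \<and> \<sigma> = tree_state (tait_graph D S) r T"
    then show "tree_weight (tait_graph D S) r T =
        unit_power Avar (smoothing_balance \<sigma>) * unit_power (- Avar) (3 * writhe (smooth D \<sigma>))"
      using tree_weight_eq leaf by blast
  qed
qed

end
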